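(* Let $r\in\mathbb N$, let $V_r=\operatorname{span}(v_1,\dots,v_r)\subset V$ with $v_1,\dots,v_r\in V$, and let $U_r=\operatorname{span}(\mathcal J_U^{-1}B'v_1,\dots,\mathcal J_U^{-1}B'v_r)\subset U$. Let $\bar u\in L^2(0,T;U)$ be the unique minimizer of $\hat J$ over $L^2(0,T;U)$, with optimal state $\bar y=y(\bar u)$ and optimal adjoint state $\bar p=p(\bar y)$. Let $\bar u^r\in L^2(0,T;U_r)$ be the unique minimizer of $\hat J^r$ over $L^2(0,T;U_r)$, with optimal reduced state $\bar y^r=y^r(\bar u^r)$ and optimal reduced adjoint state $\bar p^r=p^r(\bar y^r)$, and set $\bar x^r=(\bar y^r,\bar u^r,\bar p^r)$. Then $$\hat J(\bar u)-\hat J^r(\bar u^r)=\tfrac12\inf\big\{L'_y(\bar x^r)(\bar y-y^r)+L'_p(\bar x^r)(\bar p-p^r)\ \big|\ y^r,p^r\in W^r(0,T)\big\},$$ where $L'_z(\bar x^r)$ denotes the partial Fréchet derivative of the Lagrange function $L$ at $\bar x^r$ with respect to $z\in\{y,u,p\}$.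
   Context: Setting: $T>0$; $U,V,H$ are real separable Hilbert spaces with $V\subset H$ compactly and densely embedded; $H$ is identified with its dual, so $V\subset H\subset V'$. $\mathcal L(X,Y)$ is the space of bounded linear operators, $|\cdot|_X$ the norm of $X$, $\mathcal J_X:X\to X'$ the Riesz isomorphism. $W(0,T)=H^1(0,T;V')\cap L^2(0,T;V)$ and $W^r(0,T)=H^1(0,T;V_r')\cap L^2(0,T;V_r)$. For $B\in\mathcal L(U,V')$ the dual operator $B'\in\mathcal L(V,U')$ is defined by $\langle B'v,u\rangle_{U',U}=\langle Bu,v\rangle_{V',V}$; $A'(t)$ and $C'(t)$ are the dual (adjoint) operators of $A(t)$ and $C(t)$. Assumptions: (A1) $A\in L^\infty(0,T;\mathcal L(V,V'))$ and there is $\eta_V>0$ with $\langle A(t)v,v\rangle_{V',V}\ge\eta_V|v|_V^2$ for all $t\in(0,T)$, $v\in V$. (A2) $C\in L^\infty(0,T;\mathcal L(H,H))$, $B\in\mathcal L(U,V')$, $\beta>0$, $y_d\in L^2(0,T;H)$, $y_0\in H$. Measurability of $A$ means that $t\mapsto\langle A(t)v,w\rangle_{V',V}$ is measurable for all $v,w\in V$, and analogously for $C$. Cost: $J(y,u)=\int_0^T\tfrac12|C(t)y(t)-y_d(t)|_H^2+\tfrac\beta2|u(t)|_U^2\,dt$. Full-order problem: for $u\in L^2(0,T;U)$, $y=y(u)\in W(0,T)$ is the unique solution of $$\partial_t y(t)+A(t)y(t)=Bu(t)\ \text{ in }V'\text{ for a.e. }t\in(0,T),\qquad y(0)=y_0\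 \text{ in }H,$$ and $\hat J(u)=J(y(u),u)$. For $y\in L^2(0,T;H)$, $p=p(y)\in W(0,T)$ is the unique solution of $$-\partial_t p(t)+A'(t)p(t)=C'(t)(C(t)y(t)-y_d(t))\ \text{ in }V'\text{ for a.e. }t\in(0,T),\qquad p(T)=0\ \text{ in }H.$$ Reduced problem: for $u\in L^2(0,T;U)$, $y^r=y^r(u)\in W^r(0,T)$ is the unique solution of $$\partial_t y^r(t)+A(t)y^r(t)=Bu(t)\ \text{ in }V_r'\text{ for a.e. }t\in(0,T),\qquad y^r(0)=\Pi^H_{V_r}y_0,$$ where equality in $V_r'$ means equality when tested with elements of $V_r$ and $\Pi^H_{V_r}$ is the $H$-orthogonal projection onto $V_r$; $\hat J^r(u)=J(y^r(u),u)$. For $y\in L^2(0,T;H)$, $p^r=p^r(y)\in W^r(0,T)$ is the unique solution of $$-\partial_t p^r(t)+A'(t)p^r(t)=C'(t)(C(t)y(t)-y_d(t))\ \text{ in }V_r'\text{ for a.e. }t\in(0,T),\qquad p^r(T)=0.$$ Lagrange function: on $\mathcal X=W(0,T)\times L^2(0,T;U)\times W(0,T)$ (product topology), for $x=(y,u,p)$, $$L(x)=J(y,u)+\langle Bu-Ay-\dot y,p\rangle_{L^2(0,T;V'),L^2(0,T;V)}+\langle y_0-y(0),p(0)\rangle_H,$$ where $\dot y=\partial_t y$ and $(Ay)(t)=A(t)y(t)$. *)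

theory Defs
  imports "HOL-Analysis.Analysis"
begin

text \<open>
  Elements of Lebesgue and Sobolev spaces over \<open>(0,T)\<close> are represented by functions on \<open>real\<close>
  of which only the values almost everywhere on \<open>(0,T)\<close> matter. The dual of \<open>'v\<close> is the type
  \<open>'v \<Rightarrow>\<^sub>L real\<close> with the operator norm; operators into it have type \<open>'u \<Rightarrow>\<^sub>L ('v \<Rightarrow>\<^sub>L real)\<close>.
  The embedding of \<open>V\<close> into \<open>H\<close> is an explicit operator \<open>\<iota> :: 'v \<Rightarrow>\<^sub>L 'h\<close>.
\<close>

section \<open>Hilbert space notions\<close>

abbreviation riesz :: "'a::real_inner \<Rightarrow> ('a \<Rightarrow>\<^sub>L real)" where
  "riesz \<equiv> blinfun_inner_right"

definition dual_op ::
  "('u::real_normed_vector \<Rightarrow>\<^sub>L ('v::real_normed_vector \<Rightarrow>\<^sub>L real)) \<Rightarrow> ('v \<Rightarrow>\<^sub>L ('u \<Rightarrow>\<^sub>L real))" where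
  "dual_op B = Blinfun (\<lambda>v. Blinfun (\<lambda>u. B u v))"

lemma dual_op_apply [simp]: "dual_op B v u = B u v"
proof -
  have 1: "bounded_linear (\<lambda>u. B u w)" for w
    by (intro bounded_linear_intros)
  have 2: "bounded_linear (\<lambda>w. Blinfun (\<lambda>u. B u w))"
  proof (rule bounded_linear_intro[where K = "norm B"])
    show "Blinfun (\<lambda>u. B u (x + y)) = Blinfun (\<lambda>u. B u x) + Blinfun (\<lambda>u. B u y)" for x y
      by (rule blinfun_eqI)
        (simp only: bounded_linear_Blinfun_apply[OF 1] blinfun.add_left, simp add: blinfun.add_right)
    show "Blinfun (\<lambda>u. B u (c *\<^sub>R x)) = c *\<^sub>R Blinfun (\<lambda>u. B u x)" for c x
      by (rule blinfun_eqI)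
        (simp only: bounded_linear_Blinfun_apply[OF 1] blinfun.scaleR_left, simp add: blinfun.scaleR_right)
    show "norm (Blinfun (\<lambda>u. B u x)) \<le> norm x * norm B" for x
    proof (rule norm_blinfun_bound)
      fix u
      have "norm (B u x) \<le> norm (B u) * norm x" by (rule norm_blinfun)
      also have "\<dots> \<le> norm B * norm u * norm x"
        by (intro mult_right_mono norm_blinfun norm_ge_zero)
      finally show "norm (Blinfun (\<lambda>u. B u x) u) \<le> norm x * norm B * norm u"
        by (simp add: bounded_linear_Blinfun_apply[OF 1] mult_ac)
    qed simp
  qed
  show ?thesis
    by (simp add: dual_op_def bounded_linear_Blinfun_apply[OF 1] bounded_linear_Blinfun_apply[OF 2])
qed

definition orth_proj :: "'a::real_inner set \<Rightarrow> 'a \<Rightarrow> 'a" where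
  "orth_proj S x = (THE z. z \<in> S \<and> (\<forall>w\<in>S. inner (x - z) w = 0))"

definition compact_dense_embedding :: "('v::real_normed_vector \<Rightarrow>\<^sub>L 'h::real_normed_vector) \<Rightarrow> bool" where
  "compact_dense_embedding \<iota> \<longleftrightarrow>
     inj (blinfun_apply \<iota>) \<and>
     compact (closure (blinfun_apply \<iota> ` cball 0 1)) \<and>
     closure (range (blinfun_apply \<iota>)) = UNIV"

text \<open>The inclusion of the pivot space \<open>H\<close>, identified with its dual, into the dual of \<open>V\<close>.\<close>

definition pivot :: "('v::real_normed_vector \<Rightarrow>\<^sub>L 'h::real_inner) \<Rightarrow> 'h \<Rightarrow> ('v \<Rightarrow>\<^sub>L real)" where
  "pivot \<iota> h = riesz h o\<^sub>L \<iota>"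


section \<open>Function spaces on \<open>(0,T)\<close>\<close>

abbreviation time :: "real \<Rightarrow> real measure" where
  "time T \<equiv> lebesgue_on {0<..<T}"

text \<open>
  For a separable range space, which includes the dual of a separable Hilbert space, Borel
  measurability coincides with strong measurability.
\<close>

definition L2 :: "real \<Rightarrow> (real \<Rightarrow> 'a::real_normed_vector) set" where
  "L2 T = {f. f \<in> borel_measurable (time T) \<and> integrable (time T) (\<lambda>t. (norm (f t))\<^sup>2)}"

definition L2_in :: "real \<Rightarrow> 'a::real_normed_vector set \<Rightarrow> (real \<Rightarrow> 'a) set" where
  "L2_in T S = {f \<in> L2 T. AE t in time T. f t \<in> S}"

text \<open>
  Since \<open>(0,T)\<close> is bounded, a support contained in it is compact.
\<close>

definition test_functions :: "real \<Rightarrow> (real \<Rightarrow> real) set" where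
  "test_functions T =
     {\<phi>. (\<forall>n x. (deriv ^^ n) \<phi> field_differentiable at x) \<and> closure {x. \<phi> x \<noteq> 0} \<subseteq> {0<..<T}}"

text \<open>
  Weak derivatives of functions with values in the dual of a subspace \<open>S\<close> of \<open>V\<close>. Functionals on
  \<open>S\<close> are represented by functionals on \<open>V\<close>, of which only the restriction to \<open>S\<close> matters. If \<open>S\<close> is
  closed, composition with the orthogonal projection onto \<open>S\<close> extends every functional on \<open>S\<close> to
  \<open>V\<close> with the same norm, so square integrability does not depend on this representation.
  For \<open>S = UNIV\<close> one obtains functions with values in the dual of \<open>V\<close> itself.
  The identity between the dual-valued integrals is stated by evaluating both sides at \<open>v \<in> S\<close>.
\<close>

definition has_weak_deriv ::
  "real \<Rightarrow> 'v::real_normed_vector set \<Rightarrow> (real \<Rightarrow> ('v \<Rightarrow>\<^sub>L real)) \<Rightarrow> (real \<Rightarrow> ('v \<Rightarrow>\<^sub>L real)) \<Rightarrow> bool" where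
  "has_weak_deriv T S f w \<longleftrightarrow>
     (\<forall>\<phi>\<in>test_functions T. \<forall>v\<in>S.
        (LINT t|time T. deriv \<phi> t * f t v) = - (LINT t|time T. \<phi> t * w t v))"

definition H1_dual :: "real \<Rightarrow> 'v::real_normed_vector set \<Rightarrow> (real \<Rightarrow> ('v \<Rightarrow>\<^sub>L real)) set" where
  "H1_dual T S = {f \<in> L2 T. \<exists>w\<in>L2 T. has_weak_deriv T S f w}"

text \<open>
  \<open>W \<iota> T UNIV\<close> is \<open>W(0,T)\<close> and \<open>W \<iota> T V\<^sub>r\<close> is \<open>W\<^sup>r(0,T)\<close>.
\<close>

definition W ::
  "('v::real_normed_vector \<Rightarrow>\<^sub>L 'h::real_inner) \<Rightarrow> real \<Rightarrow> 'v set \<Rightarrow> (real \<Rightarrow> 'v) set" where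
  "W \<iota> T S = {y \<in> L2_in T S. (\<lambda>t. pivot \<iota> (\<iota> (y t))) \<in> H1_dual T S}"

text \<open>
  The time derivative is determined almost everywhere on \<open>(0,T)\<close> as a functional on \<open>S\<close>.
\<close>

definition time_deriv ::
  "('v::real_normed_vector \<Rightarrow>\<^sub>L 'h::real_inner) \<Rightarrow> real \<Rightarrow> 'v set \<Rightarrow> (real \<Rightarrow> 'v) \<Rightarrow> real \<Rightarrow> ('v \<Rightarrow>\<^sub>L real)" where
  "time_deriv \<iota> T S y = (SOME w. w \<in> L2 T \<and> has_weak_deriv T S (\<lambda>t. pivot \<iota> (\<iota> (y t))) w)"

text \<open>
  Point values in \<open>H\<close> are those of the continuous representative on \<open>[0,T]\<close>, which exists for
  members of \<open>W(0,T)\<close>.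
\<close>

definition point_value ::
  "('v::real_normed_vector \<Rightarrow>\<^sub>L 'h::real_inner) \<Rightarrow> real \<Rightarrow> (real \<Rightarrow> 'v) \<Rightarrow> real \<Rightarrow> 'h" where
  "point_value \<iota> T y s =
     (THE h. \<exists>g. continuous_on {0..T} g \<and> (AE t in time T. g t = \<iota> (y t)) \<and> h = g s)"

definition norm_W ::
  "('v::real_normed_vector \<Rightarrow>\<^sub>L 'h::real_inner) \<Rightarrow> real \<Rightarrow> (real \<Rightarrow> 'v) \<Rightarrow> real" where
  "norm_W \<iota> T y =
     sqrt ((LINT t|time T. (norm (y t))\<^sup>2) + (LINT t|time T. (norm (time_deriv \<iota> T UNIV y t))\<^sup>2))"


section \<open>Optimal control problems\<close>

definition cost ::
  "real \<Rightarrow> (real \<Rightarrow> ('h::real_inner \<Rightarrow>\<^sub>L 'h)) \<Rightarrow> real \<Rightarrow> (real \<Rightarrow> 'h) \<Rightarrow> (real \<Rightarrow> 'h)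
     \<Rightarrow> (real \<Rightarrow> 'u::real_inner) \<Rightarrow> real" where
  "cost T C \<beta> y\<^sub>d y u =
     (LINT t|time T. 1/2 * (norm (C t (y t) - y\<^sub>d t))\<^sup>2 + \<beta>/2 * (norm (u t))\<^sup>2)"

definition is_state ::
  "('v::real_normed_vector \<Rightarrow>\<^sub>L 'h::real_inner) \<Rightarrow> real \<Rightarrow> (real \<Rightarrow> ('v \<Rightarrow>\<^sub>L ('v \<Rightarrow>\<^sub>L real)))
     \<Rightarrow> ('u::real_inner \<Rightarrow>\<^sub>L ('v \<Rightarrow>\<^sub>L real)) \<Rightarrow> 'h \<Rightarrow> (real \<Rightarrow> 'u) \<Rightarrow> (real \<Rightarrow> 'v) \<Rightarrow> bool" where
  "is_state \<iota> T A B y\<^sub>0 u y \<longleftrightarrow>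
     y \<in> W \<iota> T UNIV \<and>
     (AE t in time T. time_deriv \<iota> T UNIV y t + A t (y t) = B (u t)) \<and>
     point_value \<iota> T y 0 = y\<^sub>0"

definition is_adjoint_state ::
  "('v::real_normed_vector \<Rightarrow>\<^sub>L 'h::real_inner) \<Rightarrow> real \<Rightarrow> (real \<Rightarrow> ('v \<Rightarrow>\<^sub>L ('v \<Rightarrow>\<^sub>L real)))
     \<Rightarrow> (real \<Rightarrow> ('h \<Rightarrow>\<^sub>L 'h)) \<Rightarrow> (real \<Rightarrow> 'h) \<Rightarrow> (real \<Rightarrow> 'h) \<Rightarrow> (real \<Rightarrow> 'v) \<Rightarrow> bool" where
  "is_adjoint_state \<iota> T A C y\<^sub>d y p \<longleftrightarrow>
     p \<in> W \<iota> T UNIV \<and>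
     (AE t in time T. - time_deriv \<iota> T UNIV p t + dual_op (A t) (p t)
        = pivot \<iota> (adjoint (C t) (C t (y t) - y\<^sub>d t))) \<and>
     point_value \<iota> T p T = 0"

definition is_reduced_state ::
  "('v::real_normed_vector \<Rightarrow>\<^sub>L 'h::real_inner) \<Rightarrow> real \<Rightarrow> (real \<Rightarrow> ('v \<Rightarrow>\<^sub>L ('v \<Rightarrow>\<^sub>L real)))
     \<Rightarrow> ('u::real_inner \<Rightarrow>\<^sub>L ('v \<Rightarrow>\<^sub>L real)) \<Rightarrow> 'h \<Rightarrow> 'v set \<Rightarrow> (real \<Rightarrow> 'u) \<Rightarrow> (real \<Rightarrow> 'v) \<Rightarrow> bool" where
  "is_reduced_state \<iota> T A B y\<^sub>0 V\<^sub>r u y \<longleftrightarrow>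
     y \<in> W \<iota> T V\<^sub>r \<and>
     (AE t in time T. \<forall>v\<in>V\<^sub>r. (time_deriv \<iota> T V\<^sub>r y t + A t (y t)) v = B (u t) v) \<and>
     point_value \<iota> T y 0 = orth_proj (blinfun_apply \<iota> ` V\<^sub>r) y\<^sub>0"

definition is_reduced_adjoint_state ::
  "('v::real_normed_vector \<Rightarrow>\<^sub>L 'h::real_inner) \<Rightarrow> real \<Rightarrow> (real \<Rightarrow> ('v \<Rightarrow>\<^sub>L ('v \<Rightarrow>\<^sub>L real)))
     \<Rightarrow> (real \<Rightarrow> ('h \<Rightarrow>\<^sub>L 'h)) \<Rightarrow> (real \<Rightarrow> 'h) \<Rightarrow> 'v set \<Rightarrow> (real \<Rightarrow> 'h) \<Rightarrow> (real \<Rightarrow> 'v) \<Rightarrow> bool" where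
  "is_reduced_adjoint_state \<iota> T A C y\<^sub>d V\<^sub>r y p \<longleftrightarrow>
     p \<in> W \<iota> T V\<^sub>r \<and>
     (AE t in time T. \<forall>v\<in>V\<^sub>r. (- time_deriv \<iota> T V\<^sub>r p t + dual_op (A t) (p t)) v
        = pivot \<iota> (adjoint (C t) (C t (y t) - y\<^sub>d t)) v) \<and>
     point_value \<iota> T p T = 0"

text \<open>
  The choice selects a representative of the solution, which is unique up to null sets.
\<close>

definition J_hat ::
  "('v::real_normed_vector \<Rightarrow>\<^sub>L 'h::real_inner) \<Rightarrow> real \<Rightarrow> (real \<Rightarrow> ('v \<Rightarrow>\<^sub>L ('v \<Rightarrow>\<^sub>L real)))
     \<Rightarrow> ('u::real_inner \<Rightarrow>\<^sub>L ('v \<Rightarrow>\<^sub>L real)) \<Rightarrow> (real \<Rightarrow> ('h \<Rightarrow>\<^sub>L 'h)) \<Rightarrow> real \<Rightarrow> (real \<Rightarrow> 'h) \<Rightarrow> 'h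
     \<Rightarrow> (real \<Rightarrow> 'u) \<Rightarrow> real" where
  "J_hat \<iota> T A B C \<beta> y\<^sub>d y\<^sub>0 u = cost T C \<beta> y\<^sub>d (\<lambda>t. \<iota> ((SOME y. is_state \<iota> T A B y\<^sub>0 u y) t)) u"

definition J_hat_reduced ::
  "('v::real_normed_vector \<Rightarrow>\<^sub>L 'h::real_inner) \<Rightarrow> real \<Rightarrow> (real \<Rightarrow> ('v \<Rightarrow>\<^sub>L ('v \<Rightarrow>\<^sub>L real)))
     \<Rightarrow> ('u::real_inner \<Rightarrow>\<^sub>L ('v \<Rightarrow>\<^sub>L real)) \<Rightarrow> (real \<Rightarrow> ('h \<Rightarrow>\<^sub>L 'h)) \<Rightarrow> real \<Rightarrow> (real \<Rightarrow> 'h) \<Rightarrow> 'h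
     \<Rightarrow> 'v set \<Rightarrow> (real \<Rightarrow> 'u) \<Rightarrow> real" where
  "J_hat_reduced \<iota> T A B C \<beta> y\<^sub>d y\<^sub>0 V\<^sub>r u =
     cost T C \<beta> y\<^sub>d (\<lambda>t. \<iota> ((SOME y. is_reduced_state \<iota> T A B y\<^sub>0 V\<^sub>r u y) t)) u"


section \<open>The Lagrange function and its partial derivatives\<close>

definition lagrangian ::
  "('v::real_normed_vector \<Rightarrow>\<^sub>L 'h::real_inner) \<Rightarrow> real \<Rightarrow> (real \<Rightarrow> ('v \<Rightarrow>\<^sub>L ('v \<Rightarrow>\<^sub>L real)))
     \<Rightarrow> ('u::real_inner \<Rightarrow>\<^sub>L ('v \<Rightarrow>\<^sub>L real)) \<Rightarrow> (real \<Rightarrow> ('h \<Rightarrow>\<^sub>L 'h)) \<Rightarrow> real \<Rightarrow> (real \<Rightarrow> 'h) \<Rightarrow> 'h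
     \<Rightarrow> (real \<Rightarrow> 'v) \<Rightarrow> (real \<Rightarrow> 'u) \<Rightarrow> (real \<Rightarrow> 'v) \<Rightarrow> real" where
  "lagrangian \<iota> T A B C \<beta> y\<^sub>d y\<^sub>0 y u p =
     cost T C \<beta> y\<^sub>d (\<lambda>t. \<iota> (y t)) u
     + (LINT t|time T. (B (u t) - A t (y t) - time_deriv \<iota> T UNIV y t) (p t))
     + inner (y\<^sub>0 - point_value \<iota> T y 0) (point_value \<iota> T p 0)"

text \<open>
  Frechet derivatives of functionals on a vector space \<open>X\<close> of functions with norm \<open>N\<close>,
  functions at distance zero being identified. The derivative is determined on \<open>X\<close> only.
\<close>

definition has_frechet_deriv ::
  "(real \<Rightarrow> 'a::real_vector) set \<Rightarrow> ((real \<Rightarrow> 'a) \<Rightarrow> real) \<Rightarrow> ((real \<Rightarrow> 'a) \<Rightarrow> real)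
     \<Rightarrow> (real \<Rightarrow> 'a) \<Rightarrow> ((real \<Rightarrow> 'a) \<Rightarrow> real) \<Rightarrow> bool" where
  "has_frechet_deriv X N F x D \<longleftrightarrow>
     (\<forall>h\<in>X. \<forall>k\<in>X. D (\<lambda>t. h t + k t) = D h + D k) \<and>
     (\<forall>c. \<forall>h\<in>X. D (\<lambda>t. c *\<^sub>R h t) = c * D h) \<and>
     (\<exists>K. \<forall>h\<in>X. \<bar>D h\<bar> \<le> K * N h) \<and>
     (\<forall>\<epsilon>>0. \<exists>\<delta>>0. \<forall>h\<in>X. N h < \<delta> \<longrightarrow> \<bar>F (\<lambda>t. x t + h t) - F x - D h\<bar> \<le> \<epsilon> * N h)"

definition frechet_deriv ::
  "(real \<Rightarrow> 'a::real_vector) set \<Rightarrow> ((real \<Rightarrow> 'a) \<Rightarrow> real) \<Rightarrow> ((real \<Rightarrow> 'a) \<Rightarrow> real)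
     \<Rightarrow> (real \<Rightarrow> 'a) \<Rightarrow> ((real \<Rightarrow> 'a) \<Rightarrow> real)" where
  "frechet_deriv X N F x = (SOME D. has_frechet_deriv X N F x D)"

definition lagrangian_y ::
  "('v::real_normed_vector \<Rightarrow>\<^sub>L 'h::real_inner) \<Rightarrow> real \<Rightarrow> (real \<Rightarrow> ('v \<Rightarrow>\<^sub>L ('v \<Rightarrow>\<^sub>L real)))
     \<Rightarrow> ('u::real_inner \<Rightarrow>\<^sub>L ('v \<Rightarrow>\<^sub>L real)) \<Rightarrow> (real \<Rightarrow> ('h \<Rightarrow>\<^sub>L 'h)) \<Rightarrow> real \<Rightarrow> (real \<Rightarrow> 'h) \<Rightarrow> 'h
     \<Rightarrow> (real \<Rightarrow> 'v) \<Rightarrow> (real \<Rightarrow> 'u) \<Rightarrow> (real \<Rightarrow> 'v) \<Rightarrow> (real \<Rightarrow> 'v) \<Rightarrow> real" where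
  "lagrangian_y \<iota> T A B C \<beta> y\<^sub>d y\<^sub>0 y u p =
     frechet_deriv (W \<iota> T UNIV) (norm_W \<iota> T) (\<lambda>z. lagrangian \<iota> T A B C \<beta> y\<^sub>d y\<^sub>0 z u p) y"

definition lagrangian_p ::
  "('v::real_normed_vector \<Rightarrow>\<^sub>L 'h::real_inner) \<Rightarrow> real \<Rightarrow> (real \<Rightarrow> ('v \<Rightarrow>\<^sub>L ('v \<Rightarrow>\<^sub>L real)))
     \<Rightarrow> ('u::real_inner \<Rightarrow>\<^sub>L ('v \<Rightarrow>\<^sub>L real)) \<Rightarrow> (real \<Rightarrow> ('h \<Rightarrow>\<^sub>L 'h)) \<Rightarrow> real \<Rightarrow> (real \<Rightarrow> 'h) \<Rightarrow> 'h
     \<Rightarrow> (real \<Rightarrow> 'v) \<Rightarrow> (real \<Rightarrow> 'u) \<Rightarrow> (real \<Rightarrow> 'v) \<Rightarrow> (real \<Rightarrow> 'v) \<Rightarrow> real" where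
  "lagrangian_p \<iota> T A B C \<beta> y\<^sub>d y\<^sub>0 y u p =
     frechet_deriv (W \<iota> T UNIV) (norm_W \<iota> T) (\<lambda>z. lagrangian \<iota> T A B C \<beta> y\<^sub>d y\<^sub>0 y u z) p"

end

theory Submission
  imports Defs
begin

text \<open>
  The Lagrange function is quadratic. Its derivatives in \<open>y\<close> and \<open>p\<close> at the reduced optimum vanish on
  \<open>W\<^sup>r(0,T)\<close>, by the reduced adjoint and state equations, so the infimum is taken over a single value.
  Inserting the full and the reduced state and adjoint equations, tested with the full and the reduced
  optimal variables and integrated by parts, that value becomes twice the difference of the costs, up to
  the two gradient conditions \<open>\<beta> u + \<J>\<^sub>U\<^sup>-\<^sup>1 B' p = 0\<close>. For the reduced problem this condition holds against all
  of \<open>L\<^sup>2(0,T;U)\<close> and not only against \<open>L\<^sup>2(0,T;U\<^sub>r)\<close>, because \<open>\<J>\<^sub>U\<^sup>-\<^sup>1 B'\<close> maps \<open>V\<^sub>r\<close> into \<open>U\<^sub>r\<close>.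

  The gradient conditions need solutions of the linearised state equations, which Lions' projection
  argument provides, and integration by parts in \<open>W(0,T)\<close>, which follows from the energy identity for
  \<open>|y(t)|\<^sub>H\<^sup>2\<close>. Elements of the dual of \<open>V\<close> are represented in \<open>V\<close> through the Riesz isomorphism.
\<close>

section \<open>Riesz representation and weak measurability\<close>

text \<open>Both problems are instances of one locale, \<open>control\<close>, with test space S = V
  or S = V_r. The obstacle is that a member of \<open>W \<iota> T V\<^sub>r\<close> carries a weak
  derivative that is only tested on V_r, while L contains the derivative as a functional on V. Since
  V_r has finite dimension, the H-orthogonal projection onto its image is a bounded operator with
  values in V; composed with it, the derivative becomes one against all of V that agrees with the
  old one on V_r. Hence the reduced space lies in the full one, and one notion of point value and
  one integration by parts serve both.

  Functions, not classes, are the objects, and states, time derivatives and Frechet derivatives are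
  picked by choice. Equations therefore hold almost everywhere, and each chosen object is pinned
  down by a uniqueness lemma before it is used.

  Riesz representation and Lions' argument are the same quadratic minimization, over V in one case
  and over smooth test paths in the other. The lemma on minimizing sequences is thus stated for a
  form on an abstract carrier; completeness enters only afterwards, in V and in the space of square
  integrable functions respectively.\<close>

lemma minimizing_sequence:
  fixes X :: "'x set" and b :: "'x \<Rightarrow> 'x \<Rightarrow> real" and l :: "'x \<Rightarrow> real"
    and comb :: "'x \<Rightarrow> real \<Rightarrow> 'x \<Rightarrow> 'x"
  assumes "X \<noteq> {}"
    and comb: "\<And>x c y. x \<in> X \<Longrightarrow> y \<in> X \<Longrightarrow> comb x c y \<in> X"
    and b_comb: "\<And>x c y z. x \<in> X \<Longrightarrow> y \<in> X \<Longrightarrow> z \<in> X \<Longrightarrow> b (comb x c y) z = b x z + c * b y z"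
    and b_sym: "\<And>x y. x \<in> X \<Longrightarrow> y \<in> X \<Longrightarrow> b x y = b y x"
    and b_nonneg: "\<And>x. x \<in> X \<Longrightarrow> 0 \<le> b x x"
    and l_comb: "\<And>x c y. x \<in> X \<Longrightarrow> y \<in> X \<Longrightarrow> l (comb x c y) = l x + c * l y"
    and l_bound: "\<And>x. x \<in> X \<Longrightarrow> (l x)\<^sup>2 \<le> K * b x x"
  obtains s where "\<And>n. s n \<in> X"
    "\<And>e. e > 0 \<Longrightarrow> \<exists>N. \<forall>m\<ge>N. \<forall>n\<ge>N. b (comb (s m) (-1) (s n)) (comb (s m) (-1) (s n)) < e"
    "\<And>x. x \<in> X \<Longrightarrow> (\<lambda>n. b (s n) x) \<longlonglongrightarrow> l x"
proof -
  \<comment> \<open>Quadratic energy whose stationarity condition is \<open>b x y = l y\<close> for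
    all \<open>y\<close>; \<open>s\<close> will be a sequence along which it tends to its
    infimum.\<close>
  define J where "J x = b x x / 2 - l x" for x
  have b_comb2: "b z (comb x c y) = b z x + c * b z y" if "x \<in> X" "y \<in> X" "z \<in> X" for x c y z
    using b_comb[of x y z c] b_sym[of z "comb x c y"] b_sym[of z x] b_sym[of z y] comb that by simp
  have J_comb: "J (comb x c y) = J x + c * (b x y - l y) + c\<^sup>2 * b y y / 2" if "x \<in> X" "y \<in> X" for x c y
    using that comb by (simp add: J_def b_comb b_comb2 l_comb b_sym[of y x]) (simp add: field_simps power2_eq_square)
  have J_lower: "- max K 0 / 2 \<le> J x" if "x \<in> X" for x
  proof -
    have "(l x)\<^sup>2 \<le> max K 0 * b x x"
      using l_bound[OF that] b_nonneg[OF that] mult_right_mono[of K "max K 0" "b x x"] by linarith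
    also have "\<dots> \<le> ((max K 0 + b x x) / 2)\<^sup>2"
      using sum_squares_bound[of "max K 0 / 2" "- (b x x / 2)"] zero_le_power2[of "max K 0 - b x x"]
      by (simp add: power2_eq_square field_simps)
    finally have "l x \<le> (max K 0 + b x x) / 2"
      by (rule power2_le_imp_le) (use b_nonneg[OF that] in simp)
    thus ?thesis unfolding J_def by simp
  qed
  define m where "m = Inf (J ` X)"
  have bdd: "bdd_below (J ` X)" using J_lower by (auto intro!: bdd_belowI2)
  have m_le: "m \<le> J x" if "x \<in> X" for x
    unfolding m_def using bdd that by (auto intro: cInf_lower)
  have "\<exists>x. x \<in> X \<and> J x < m + 1 / real (Suc n)" for n
  proof -
    have "Inf (J ` X) < m + 1 / real (Suc n)" by (simp add: m_def)
    thus ?thesis using cInf_lessD[of "J ` X"] \<open>X \<noteq> {}\<close> by auto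
  qed
  then obtain s where s: "\<And>n. s n \<in> X" and sJ: "\<And>n. J (s n) < m + 1 / real (Suc n)" by metis
  \<comment> \<open>The quadratic polynomial \<open>J (comb x c y) - m\<close> in \<open>c\<close>
    is nonnegative, so its discriminant is not positive. If \<open>b y y = 0\<close>, it is affine
    in \<open>c\<close> and its slope has to vanish; the \<open>c\<close> chosen below would
    otherwise push the energy to \<open>m - 1\<close>.\<close>
  have est: "(b x y - l y)\<^sup>2 \<le> 2 * (J x - m) * b y y" if x: "x \<in> X" and y: "y \<in> X" for x y
  proof (cases "b y y = 0")
    case True
    have "b x y - l y = 0"
    proof (rule ccontr)
      assume ne: "b x y - l y \<noteq> 0"
      define c where "c = - (J x - m + 1) / (b x y - l y)"
      have "J (comb x c y) = m - 1" unfolding J_comb[OF x y] True c_def using ne by simp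
      thus False using m_le[OF comb[OF x y, of c]] by simp
    qed
    thus ?thesis using True by simp
  next
    case False
    hence pos: "b y y > 0" using b_nonneg[OF y] by simp
    define c where "c = - (b x y - l y) / b y y"
    have "m \<le> J (comb x c y)" by (rule m_le[OF comb[OF x y]])
    also have "\<dots> = J x - (b x y - l y)\<^sup>2 / (2 * b y y)"
      unfolding J_comb[OF x y] c_def using pos by (simp add: field_simps power2_eq_square)
    finally have "(b x y - l y)\<^sup>2 / (2 * b y y) \<le> J x - m" by simp
    thus ?thesis using pos by (simp add: field_simps)
  qed
  have lim0: "(\<lambda>n. J (s n) - m) \<longlonglongrightarrow> 0"
  proof (rule tendsto_sandwich[of "\<lambda>_. 0" _ _ "\<lambda>n. 1 / real (Suc n)"])
    show "\<forall>\<^sub>F n in sequentially. 0 \<le> J (s n) - m" using m_le[OF s] by simp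
    show "\<forall>\<^sub>F n in sequentially. J (s n) - m \<le> 1 / real (Suc n)"
      using sJ by (intro always_eventually allI) (smt (verit))
    show "(\<lambda>n. 1 / real (Suc n)) \<longlonglongrightarrow> 0" by (rule LIMSEQ_Suc[OF lim_1_over_n])
  qed simp
  show ?thesis
  proof (rule that[OF s])
    fix e :: real assume "e > 0"
    then obtain N where N: "\<And>n. n \<ge> N \<Longrightarrow> J (s n) - m < e / 8"
      using order_tendstoD(2)[OF lim0, of "e/8"] by (auto simp: eventually_sequentially)
    have "b (comb (s i) (-1) (s j)) (comb (s i) (-1) (s j)) < e" if "i \<ge> N" "j \<ge> N" for i j
    proof -
      let ?d = "comb (s i) (-1) (s j)"
      \<comment> \<open>The midpoint of \<open>s i\<close> and \<open>s j\<close>: by the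
        parallelogram law its energy lies \<open>b ?d ?d / 8\<close> below the mean of the two
        energies, and it cannot fall below \<open>m\<close>.\<close>
      let ?h = "comb (s j) (1/2) ?d"
      have d: "?d \<in> X" by (intro comb s)
      have 1: "J ?h = (J (s i) + J (s j)) / 2 - b ?d ?d / 8"
        unfolding J_comb[OF s d] unfolding J_def using s comb
        by (simp add: b_comb b_comb2 l_comb b_sym[of "s j" "s i"]) (simp add: field_simps power2_eq_square)
      have 2: "m \<le> J ?h" by (intro m_le comb s)
      have "B < e" if "Jh = (Ji + Jj) / 2 - B / 8" "m \<le> Jh" "Ji - m < e / 8" "Jj - m < e / 8"
        for Jh Ji Jj B :: real
        using that by argo
      from this[OF 1 2 N[OF that(1)] N[OF that(2)]] show ?thesis .
    qed
    thus "\<exists>N. \<forall>m\<ge>N. \<forall>n\<ge>N. b (comb (s m) (-1) (s n)) (comb (s m) (-1) (s n)) < e" by blast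
  next
    fix x assume x: "x \<in> X"
    have "(\<lambda>n. (b (s n) x - l x)\<^sup>2) \<longlonglongrightarrow> 0"
    proof (rule tendsto_sandwich[of "\<lambda>_. 0" _ _ "\<lambda>n. 2 * (J (s n) - m) * b x x"])
      show "\<forall>\<^sub>F n in sequentially. (b (s n) x - l x)\<^sup>2 \<le> 2 * (J (s n) - m) * b x x"
        using est[OF s x] by simp
      show "(\<lambda>n. 2 * (J (s n) - m) * b x x) \<longlonglongrightarrow> 0"
        using tendsto_mult_right[OF tendsto_mult_left[OF lim0, of 2], of "b x x"] by simp
    qed simp_all
    hence "(\<lambda>n. b (s n) x - l x) \<longlonglongrightarrow> 0" by (simp add: power_tendsto_0_iff)
    thus "(\<lambda>n. b (s n) x) \<longlonglongrightarrow> l x" by (simp add: LIM_zero_iff)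
  qed
qed

text \<open>A minimizing sequence for \<open>x \<bullet> x / 2 - f x\<close> is Cauchy, and its
  limit represents \<open>f\<close>.\<close>

lemma riesz_surj: "surj (riesz :: 'a::{real_inner, banach} \<Rightarrow> ('a \<Rightarrow>\<^sub>L real))"
unfolding surj_def
proof (intro allI)
  fix f :: "'a \<Rightarrow>\<^sub>L real"
  have "(f x)\<^sup>2 \<le> (norm f)\<^sup>2 * (x \<bullet> x)" for x
    using norm_blinfun[of f x] power_mono[of "\<bar>f x\<bar>" "norm f * norm x" 2]
    by (simp add: power_mult_distrib power2_norm_eq_inner)
  note bound = this
  have "\<exists>s. (\<forall>e>0. \<exists>N. \<forall>m\<ge>N. \<forall>n\<ge>N. (s m + (-1) *\<^sub>R s n) \<bullet> (s m + (-1) *\<^sub>R s n) < e) \<and>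
      (\<forall>x. (\<lambda>n. s n \<bullet> x) \<longlonglongrightarrow> f x)"
  proof (rule minimizing_sequence[of "UNIV :: 'a set" "\<lambda>x c y. x + c *\<^sub>R y" inner f "(norm f)\<^sup>2"], goal_cases)
    case (4 x y)
    show ?case by (rule inner_commute)
  next
    case (7 x)
    show ?case by (rule bound)
  next
    case (8 s)
    show ?case using 8(2) 8(3)[OF UNIV_I] by blast
  qed (simp_all add: inner_add_left blinfun.add_right blinfun.scaleR_right)
  then obtain s where
    cau: "\<And>e. e > 0 \<Longrightarrow> \<exists>N. \<forall>m\<ge>N. \<forall>n\<ge>N. (s m + (-1) *\<^sub>R s n) \<bullet> (s m + (-1) *\<^sub>R s n) < e"
    and lim: "\<And>x. (\<lambda>n. s n \<bullet> x) \<longlonglongrightarrow> f x" by blast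
  have "Cauchy s"
  proof (rule metric_CauchyI)
    fix e :: real assume "e > 0"
    then obtain N where "\<forall>m\<ge>N. \<forall>n\<ge>N. (s m + (-1) *\<^sub>R s n) \<bullet> (s m + (-1) *\<^sub>R s n) < e\<^sup>2"
      using cau[of "e\<^sup>2"] by auto
    hence "\<forall>m\<ge>N. \<forall>n\<ge>N. (norm (s m - s n))\<^sup>2 < e\<^sup>2" by (simp add: power2_norm_eq_inner)
    hence "\<forall>m\<ge>N. \<forall>n\<ge>N. norm (s m - s n) < e"
      using power2_less_imp_less[OF _ less_imp_le[OF \<open>e > 0\<close>]] by blast
    thus "\<exists>N. \<forall>m\<ge>N. \<forall>n\<ge>N. dist (s m) (s n) < e"
      unfolding dist_norm by blast
  qed
  then obtain a where "s \<longlonglongrightarrow> a" by (auto simp: Cauchy_convergent_iff convergent_def)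
  hence "(\<lambda>n. s n \<bullet> x) \<longlonglongrightarrow> a \<bullet> x" for x by (intro tendsto_intros)
  hence "a \<bullet> x = f x" for x by (rule LIMSEQ_unique[OF _ lim])
  thus "\<exists>x. f = riesz x" by (intro exI[of _ a] blinfun_eqI) simp
qed

lemma inj_riesz: "inj (riesz :: 'a::real_inner \<Rightarrow> ('a \<Rightarrow>\<^sub>L real))"
proof (rule injI)
  fix x y :: 'a assume "riesz x = riesz y"
  hence "riesz x (x - y) = riesz y (x - y)" by simp
  hence "(x - y) \<bullet> (x - y) = 0" by (simp add: inner_diff_left)
  thus "x = y" by simp
qed

text \<open>Moves functionals into V, where the inner product and second countability are at hand
  that the facts on sums and products of square integrable functions ask for.\<close>

abbreviation rz :: "('a::{real_inner, banach} \<Rightarrow>\<^sub>L real) \<Rightarrow> 'a" where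
  "rz \<equiv> inv riesz"

lemma riesz_rz [simp]: "riesz (rz f) = f"
  by (rule surj_f_inv_f[OF riesz_surj])

lemma rz_riesz [simp]: "rz (riesz x) = x"
  by (rule inv_f_f[OF inj_riesz])

lemma inner_rz [simp]: "rz f \<bullet> v = f v"
  using riesz_rz[of f] by (metis blinfun_inner_right.rep_eq)

lemma rz_eqI:
  fixes f :: "'a::{real_inner, banach} \<Rightarrow>\<^sub>L real"
  shows "(\<And>v. x \<bullet> v = f v) \<Longrightarrow> rz f = x"
  by (metis blinfun_eqI blinfun_inner_right.rep_eq rz_riesz)

lemma rz_add: "rz (f + g) = rz f + rz g"
  and rz_scaleR: "rz (c *\<^sub>R f) = c *\<^sub>R rz f"
  by (rule rz_eqI, simp add: inner_add_left blinfun.bilinear_simps)+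

lemma norm_rz: "norm (rz f) = norm f"
proof (rule antisym)
  have "norm (rz f) * norm (rz f) = f (rz f)"
    by (simp flip: inner_rz add: dot_square_norm power2_eq_square)
  also have "\<dots> \<le> norm f * norm (rz f)"
    using norm_blinfun[of f "rz f"] by simp
  finally show "norm (rz f) \<le> norm f"
    by (cases "norm (rz f) = 0") (auto simp: mult_le_cancel_right)
  show "norm f \<le> norm (rz f)"
    by (rule norm_blinfun_bound) (use Cauchy_Schwarz_ineq2[of "rz f"] in auto)
qed

lemma bounded_linear_rz: "bounded_linear rz"
  by (rule bounded_linear_intro[where K = 1]) (auto simp: rz_add rz_scaleR norm_rz)

text \<open>\<open>adjoint\<close> is defined by choice, so its identity needs a witness: the Riesz
  representer of \<open>x \<mapsto> C x \<bullet> k\<close>.\<close>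

lemma inner_adjoint_blinfun:
  fixes C :: "'a::{real_inner, banach} \<Rightarrow>\<^sub>L 'b::real_inner"
  shows "C x \<bullet> k = x \<bullet> adjoint C k"
proof -
  have "\<forall>x k. C x \<bullet> k = x \<bullet> rz (riesz k o\<^sub>L C)"
    by (simp add: inner_commute[of _ "rz _"] inner_commute[of "C _"])
  hence "\<exists>f. \<forall>x k. C x \<bullet> k = x \<bullet> f k" by (intro exI[of _ "\<lambda>k. rz (riesz k o\<^sub>L C)"])
  thus ?thesis unfolding adjoint_def by (rule someI2_ex) auto
qed

text \<open>Norms are suprema of countably many inner products, so weak measurability controls balls.\<close>

lemma borel_measurable_inner_weakI:
  fixes f :: "'a \<Rightarrow> 'b::{real_inner, second_countable_topology}"
  assumes weak: "\<And>v. (\<lambda>t. f t \<bullet> v) \<in> borel_measurable M"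
  shows "f \<in> borel_measurable M"
proof -
  obtain D :: "'b set" where D: "countable D" "\<And>X. open X \<Longrightarrow> X \<noteq> {} \<Longrightarrow> \<exists>d\<in>D. d \<in> X"
    using countable_dense_setE by blast
  have norm_less: "norm x \<le> r \<longleftrightarrow> (\<forall>d\<in>D. x \<bullet> d \<le> r * norm d)" if "r \<ge> 0" for x :: 'b and r
  proof
    assume "norm x \<le> r"
    thus "\<forall>d\<in>D. x \<bullet> d \<le> r * norm d"
      using norm_cauchy_schwarz[of x] by (meson mult_right_mono norm_ge_zero order_trans)
  next
    assume *: "\<forall>d\<in>D. x \<bullet> d \<le> r * norm d"
    have "x \<in> closure D"
      using D(2) by (auto simp: closure_iff_nhds_not_empty)
    moreover have "closed {d. x \<bullet> d \<le> r * norm d}"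
      by (intro closed_Collect_le continuous_intros)
    ultimately have "x \<bullet> x \<le> r * norm x"
      using * closure_minimal[of D "{d. x \<bullet> d \<le> r * norm d}"] by auto
    thus "norm x \<le> r" using that
      by (cases "norm x = 0") (auto simp: dot_square_norm power2_eq_square)
  qed
  have cb: "{t \<in> space M. f t \<in> cball c r} \<in> sets M" for c r
  proof (cases "r \<ge> 0")
    case True
    have "{t \<in> space M. f t \<in> cball c r} = {t \<in> space M. \<forall>d\<in>D. f t \<bullet> d - c \<bullet> d \<le> r * norm d}"
      using norm_less[OF True] by (auto simp: dist_norm norm_minus_commute[of c] inner_diff_left)
    also have "\<dots> \<in> sets M"
      using D(1) weak by measurable
    finally show ?thesis .
  next
    case False
    hence "{t \<in> space M. f t \<in> cball c r} = {}" by simp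
    thus ?thesis by (metis sets.empty_sets)
  qed
  show ?thesis
  proof (rule borel_measurableI)
    fix S :: "'b set" assume S: "open S"
    \<comment> \<open>Countably many balls exhaust an open set: centres from the dense set, radii
      \<open>1 / (n + 1)\<close>.\<close>
    define I where "I = {(d, n). d \<in> D \<and> cball d (1 / real (Suc n)) \<subseteq> S}"
    have "S = (\<Union>(d, n)\<in>I. cball d (1 / real (Suc n)))"
    proof (intro set_eqI iffI)
      fix x assume "x \<in> S"
      then obtain e where e: "e > 0" "ball x e \<subseteq> S" using S openE by blast
      obtain n where n: "1 / real (Suc n) < e / 2"
        using e(1) nat_approx_posE[of "e/2"] by auto
      obtain d where d: "d \<in> D" "d \<in> ball x (1 / real (Suc n))"
        using D(2)[of "ball x (1 / real (Suc n))"] by auto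
      have "cball d (1 / real (Suc n)) \<subseteq> S"
      proof
        fix z assume "z \<in> cball d (1 / real (Suc n))"
        hence "dist x z < e" using d(2) n dist_triangle[of x z d] by (simp add: dist_commute)
        thus "z \<in> S" using e by auto
      qed
      thus "x \<in> (\<Union>(d, n)\<in>I. cball d (1 / real (Suc n)))"
        using d by (intro UN_I[of "(d, n)"]) (auto simp: I_def dist_commute)
    qed (auto simp: I_def)
    hence "f -` S \<inter> space M = (\<Union>i\<in>I. {t \<in> space M. f t \<in> cball (fst i) (1 / real (Suc (snd i)))})"
      by fastforce
    also have "\<dots> \<in> sets M"
    proof (rule sets.countable_UN')
      show "countable I"
        by (rule countable_subset[of _ "D \<times> UNIV"]) (auto simp: I_def D(1))
    qed (use cb in blast)
    finally show "f -` S \<inter> space M \<in> sets M" .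
  qed
qed

text \<open>Weak measurability is used twice. For a fixed second argument the transposed operator
  gives a measurable V-valued function, whose inner product with \<open>x t\<close> is measurable;
  this is the weak measurability of the composition with \<open>x\<close>.\<close>

lemma borel_measurable_dual_opD:
  fixes a :: "'t \<Rightarrow> ('v::{real_inner, banach, second_countable_topology} \<Rightarrow>\<^sub>L ('v \<Rightarrow>\<^sub>L real))"
  assumes a: "\<And>v w. (\<lambda>t. a t v w) \<in> borel_measurable M" and x: "x \<in> borel_measurable M"
  shows "(\<lambda>t. rz (a t (x t))) \<in> borel_measurable M"
    and "(\<lambda>t. rz (dual_op (a t) (x t))) \<in> borel_measurable M"
proof -
  have 1: "(\<lambda>t. rz (dual_op (a t) w)) \<in> borel_measurable M" "(\<lambda>t. rz (a t w)) \<in> borel_measurable M" for w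
    by (rule borel_measurable_inner_weakI, simp add: a)+
  have 2: "(\<lambda>t. a t (x t) w) \<in> borel_measurable M" for w
    using borel_measurable_inner[OF 1(1)[of w] x] by simp
  have 3: "(\<lambda>t. a t w (x t)) \<in> borel_measurable M" for w
    using borel_measurable_inner[OF 1(2)[of w] x] by simp
  show "(\<lambda>t. rz (a t (x t))) \<in> borel_measurable M"
    by (rule borel_measurable_inner_weakI) (simp only: inner_rz 2)
  show "(\<lambda>t. rz (dual_op (a t) (x t))) \<in> borel_measurable M"
    by (rule borel_measurable_inner_weakI) (simp only: inner_rz dual_op_apply 3)
qed

lemma borel_measurable_blinfun_apply_weak:
  fixes C :: "'t \<Rightarrow> ('h::{real_inner, banach, second_countable_topology} \<Rightarrow>\<^sub>L 'h)"
  assumes C: "\<And>h k. (\<lambda>t. C t h \<bullet> k) \<in> borel_measurable M" and x: "x \<in> borel_measurable M"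
  shows "(\<lambda>t. C t (x t)) \<in> borel_measurable M"
proof -
  have 1: "(\<lambda>t. adjoint (C t) w) \<in> borel_measurable M" for w
    by (rule borel_measurable_inner_weakI)
      (use C in \<open>simp add: inner_commute[of "adjoint _ _"] flip: inner_adjoint_blinfun\<close>)
  show ?thesis
    by (rule borel_measurable_inner_weakI)
      (simp add: inner_adjoint_blinfun, intro borel_measurable_inner 1 x)
qed

lemma finite_span_projection:
  fixes \<iota> :: "'v::real_normed_vector \<Rightarrow>\<^sub>L 'h::real_inner"
  assumes "inj (blinfun_apply \<iota>)" and "finite X"
  shows "\<exists>Q :: 'h \<Rightarrow>\<^sub>L 'v. range Q \<subseteq> span X \<and> (\<forall>h. \<forall>s\<in>span X. (h - \<iota> (Q h)) \<bullet> \<iota> s = 0)"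
  using assms(2)
proof induction
  case empty
  show ?case by (rule exI[of _ 0]) (auto simp: blinfun.zero_right)
next
  case (insert a X)
  then obtain Q :: "'h \<Rightarrow>\<^sub>L 'v" where Q: "\<And>h. Q h \<in> span X"
    and orth: "\<And>h s. s \<in> span X \<Longrightarrow> (h - \<iota> (Q h)) \<bullet> \<iota> s = 0" by (auto simp: image_subset_iff)
  define b where "b = a - Q (\<iota> a)"
  have bX: "\<iota> b \<bullet> \<iota> s = 0" if "s \<in> span X" for s
    using orth[OF that, of "\<iota> a"] by (simp add: b_def blinfun.diff_right)
  have Q': "Q h \<in> span (insert a X)" for h
    using Q[of h] span_mono[of X "insert a X"] by blast
  have b: "b \<in> span (insert a X)"
    unfolding b_def by (intro span_diff span_base Q') simp
  have dec: "\<exists>k s'. s = k *\<^sub>R b + s' \<and> s' \<in> span X" if "s \<in> span (insert a X)" for s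
  proof -
    from that obtain k where k: "s - k *\<^sub>R a \<in> span X" by (auto simp: span_insert)
    have "s - k *\<^sub>R b = (s - k *\<^sub>R a) + k *\<^sub>R Q (\<iota> a)" by (simp add: b_def algebra_simps)
    also have "\<dots> \<in> span X" using k Q by (intro span_add span_scale) auto
    finally have "s - k *\<^sub>R b \<in> span X" .
    thus ?thesis by (intro exI[of _ k] exI[of _ "s - k *\<^sub>R b"]) simp
  qed
  \<comment> \<open>For a generator that depends on the earlier ones, \<open>b\<close> is zero by
    injectivity and the added term disappears; division by zero has the value zero.\<close>
  define g where "g h = Q h + (h \<bullet> (\<iota> b /\<^sub>R (\<iota> b \<bullet> \<iota> b))) *\<^sub>R b" for h
  have "bounded_linear g"
    unfolding g_def
    by (rule bounded_linear_add[OF blinfun.bounded_linear_right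
        bounded_linear_compose[OF bounded_linear_scaleR_left bounded_linear_inner_left]])
  then obtain G where G: "blinfun_apply G = g" using bounded_linear_Blinfun_apply by blast
  have nb: "\<iota> b \<bullet> \<iota> b \<noteq> 0 \<or> b = 0"
    using injD[OF assms(1), of b 0] by (auto simp: blinfun.zero_right)
  show ?case
  proof (intro exI[of _ G] conjI allI ballI)
    show "range G \<subseteq> span (insert a X)"
      unfolding G g_def using Q' b by (auto intro!: span_add span_scale)
    fix h s assume "s \<in> span (insert a X)"
    from dec[OF this] obtain k s' where s: "s = k *\<^sub>R b + s'" "s' \<in> span X" by blast
    have 1: "\<iota> (Q h) \<bullet> \<iota> b = 0" using bX[OF Q[of h]] by (simp add: inner_commute)
    show "(h - \<iota> (G h)) \<bullet> \<iota> s = 0"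
      unfolding G g_def s(1) using orth[OF s(2), of h] bX[OF s(2)] 1 nb
      by (auto simp: blinfun.bilinear_simps inner_simps)
  qed
qed

section \<open>Square integrable functions\<close>

text \<open>The measure is a parameter because shifts in time are studied on the whole line under
  \<open>lborel\<close>, everything else on the interval.\<close>

definition Lsq :: "'t measure \<Rightarrow> ('t \<Rightarrow> 'a::real_normed_vector) set" where
  "Lsq M = {f. f \<in> borel_measurable M \<and> integrable M (\<lambda>t. (norm (f t))\<^sup>2)}"

definition nsq :: "'t measure \<Rightarrow> ('t \<Rightarrow> 'a::real_normed_vector) \<Rightarrow> real" where
  "nsq M f = (LINT t|M. (norm (f t))\<^sup>2)"

lemma L2_Lsq: "L2 T = Lsq (time T)"
  by (simp add: L2_def Lsq_def)

lemma LsqI: "f \<in> borel_measurable M \<Longrightarrow> integrable M (\<lambda>t. (norm (f t))\<^sup>2) \<Longrightarrow> f \<in> Lsq M"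
  and Lsq_measurable: "f \<in> Lsq M \<Longrightarrow> f \<in> borel_measurable M"
  and Lsq_integrable: "f \<in> Lsq M \<Longrightarrow> integrable M (\<lambda>t. (norm (f t))\<^sup>2)"
  by (auto simp: Lsq_def)

lemma nsq_nonneg [simp]: "0 \<le> nsq M f"
  by (simp add: nsq_def)

lemma Lsq_bound:
  assumes "g \<in> Lsq M" "f \<in> borel_measurable M" "AE t in M. norm (f t) \<le> K * norm (g t)"
  shows "f \<in> Lsq M" "nsq M f \<le> K\<^sup>2 * nsq M g"
proof -
  have *: "AE t in M. (norm (f t))\<^sup>2 \<le> K\<^sup>2 * (norm (g t))\<^sup>2"
    using assms(3) by eventually_elim (metis norm_ge_zero power_mono power_mult_distrib)
  have I: "integrable M (\<lambda>t. K\<^sup>2 * (norm (g t))\<^sup>2)"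
    using Lsq_integrable[OF assms(1)] by simp
  show f: "f \<in> Lsq M"
    by (rule LsqI[OF assms(2) Bochner_Integration.integrable_bound[OF I]])
      (use assms(2) * in auto)
  have "nsq M f \<le> (LINT t|M. K\<^sup>2 * (norm (g t))\<^sup>2)"
    unfolding nsq_def by (rule integral_mono_AE[OF Lsq_integrable[OF f] I *])
  thus "nsq M f \<le> K\<^sup>2 * nsq M g" by (simp add: nsq_def)
qed

lemma Lsq_cong_AE:
  assumes "f \<in> borel_measurable M" "g \<in> Lsq M" "AE t in M. f t = g t"
  shows "f \<in> Lsq M" "nsq M f = nsq M g"
proof -
  show f: "f \<in> Lsq M"
    by (rule Lsq_bound(1)[where K = 1 and g = g]) (use assms in auto)
  show "nsq M f = nsq M g"
    unfolding nsq_def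
    by (rule integral_cong_AE) (use assms(3) Lsq_integrable[OF assms(2)] Lsq_integrable[OF f] in \<open>auto dest: borel_measurable_integrable\<close>)
qed

lemma Lsq_add:
  fixes f g :: "'t \<Rightarrow> 'a::{real_normed_vector, second_countable_topology}"
  assumes "f \<in> Lsq M" "g \<in> Lsq M"
  shows "(\<lambda>t. f t + g t) \<in> Lsq M"
proof (rule LsqI)
  show m: "(\<lambda>t. f t + g t) \<in> borel_measurable M"
    by (intro borel_measurable_add Lsq_measurable assms)
  have "(norm (f t + g t))\<^sup>2 \<le> 2 * (norm (f t))\<^sup>2 + 2 * (norm (g t))\<^sup>2" for t
    using power_mono[OF norm_triangle_ineq[of "f t" "g t"], of 2]
      sum_squares_bound[of "norm (f t)" "norm (g t)"] by (simp add: power2_sum)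
  note le = this
  show "integrable M (\<lambda>t. (norm (f t + g t))\<^sup>2)"
    by (rule Bochner_Integration.integrable_bound[of M "\<lambda>t. 2 * (norm (f t))\<^sup>2 + 2 * (norm (g t))\<^sup>2"])
      (use m Lsq_integrable[OF assms(1)] Lsq_integrable[OF assms(2)] le in auto)
qed

lemma Lsq_scaleR:
  assumes "f \<in> Lsq M"
  shows "(\<lambda>t. c *\<^sub>R f t) \<in> Lsq M" "nsq M (\<lambda>t. c *\<^sub>R f t) = c\<^sup>2 * nsq M f"
  using assms by (auto simp: Lsq_def nsq_def power_mult_distrib)

lemma Lsq_diff:
  fixes f g :: "'t \<Rightarrow> 'a::{real_normed_vector, second_countable_topology}"
  assumes "f \<in> Lsq M" "g \<in> Lsq M"
  shows "(\<lambda>t. f t - g t) \<in> Lsq M"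
  using Lsq_add[OF assms(1) Lsq_scaleR(1)[OF assms(2), of "-1"]] by simp

lemma Lsq_blinfun:
  fixes Q :: "'a::real_normed_vector \<Rightarrow>\<^sub>L 'b::real_normed_vector"
  assumes "f \<in> Lsq M"
  shows "(\<lambda>t. Q (f t)) \<in> Lsq M" "nsq M (\<lambda>t. Q (f t)) \<le> (norm Q)\<^sup>2 * nsq M f"
proof -
  have m: "(\<lambda>t. Q (f t)) \<in> borel_measurable M"
    by (rule borel_measurable_continuous_on[OF linear_continuous_on[OF blinfun.bounded_linear_right] Lsq_measurable[OF assms]])
  have "AE t in M. norm (Q (f t)) \<le> norm Q * norm (f t)"
    by (simp add: norm_blinfun)
  note * = Lsq_bound[OF assms m this]
  show "(\<lambda>t. Q (f t)) \<in> Lsq M" by (rule *)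
  show "nsq M (\<lambda>t. Q (f t)) \<le> (norm Q)\<^sup>2 * nsq M f" by (rule *)
qed

section \<open>Cauchy-Schwarz inequality and completeness\<close>

lemma integrable_norm_mult_Lsq:
  assumes "f \<in> Lsq M" "g \<in> Lsq M"
  shows "integrable M (\<lambda>t. norm (f t) * norm (g t))"
proof (rule Bochner_Integration.integrable_bound[of M "\<lambda>t. (norm (f t))\<^sup>2 + (norm (g t))\<^sup>2"])
  show "AE t in M. norm (norm (f t) * norm (g t)) \<le> norm ((norm (f t))\<^sup>2 + (norm (g t))\<^sup>2)"
  proof (rule AE_I2)
    fix t
    have "norm (f t) * norm (g t) \<le> (norm (f t))\<^sup>2 + (norm (g t))\<^sup>2"
      using sum_squares_bound[of "norm (f t)" "norm (g t)"] mult_nonneg_nonneg[OF norm_ge_zero[of "f t"] norm_ge_zero[of "g t"]]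
      by argo
    thus "norm (norm (f t) * norm (g t)) \<le> norm ((norm (f t))\<^sup>2 + (norm (g t))\<^sup>2)" by simp
  qed
qed (use Lsq_integrable[OF assms(1)] Lsq_integrable[OF assms(2)] Lsq_measurable[OF assms(1)] Lsq_measurable[OF assms(2)] in auto)

lemma integral_norm_mult_Lsq:
  assumes f: "f \<in> Lsq M" and g: "g \<in> Lsq M"
  shows "(LINT t|M. norm (f t) * norm (g t)) \<le> sqrt (nsq M f) * sqrt (nsq M g)"
proof -
  define a b where "a = sqrt (nsq M f)" and "b = sqrt (nsq M g)"
  have ab: "a \<ge> 0" "b \<ge> 0" "nsq M f = a\<^sup>2" "nsq M g = b\<^sup>2" by (auto simp: a_def b_def)
  define I where "I = (LINT t|M. norm (f t) * norm (g t))"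
  \<comment> \<open>Young's inequality, integrated, with a free weight \<open>c\<close>. The optimal
    weight is \<open>b / a\<close>; if \<open>a\<close> or \<open>b\<close> is zero, a weight
    adapted to \<open>I\<close> contradicts \<open>I > 0\<close>.\<close>
  have young: "2 * c * I \<le> c\<^sup>2 * a\<^sup>2 + b\<^sup>2" if "c \<ge> 0" for c
  proof -
    have "(LINT t|M. 2 * c * (norm (f t) * norm (g t))) \<le> (LINT t|M. c\<^sup>2 * (norm (f t))\<^sup>2 + (norm (g t))\<^sup>2)"
    proof (rule integral_mono)
      show "2 * c * (norm (f t) * norm (g t)) \<le> c\<^sup>2 * (norm (f t))\<^sup>2 + (norm (g t))\<^sup>2" for t
        using sum_squares_bound[of "c * norm (f t)" "norm (g t)"] by (simp add: power_mult_distrib mult_ac)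
    qed (use integrable_norm_mult_Lsq[OF f g] Lsq_integrable[OF f] Lsq_integrable[OF g] in auto)
    also have "\<dots> = c\<^sup>2 * nsq M f + nsq M g"
      using Lsq_integrable[OF f] Lsq_integrable[OF g] by (simp add: nsq_def)
    finally show ?thesis unfolding I_def ab by simp
  qed
  have "I \<le> a * b"
  proof (cases "a = 0")
    case True
    have "I \<le> 0"
    proof (rule ccontr)
      assume "\<not> I \<le> 0"
      hence "I > 0" by simp
      hence "2 * ((b\<^sup>2 + 1) / (2 * I)) * I = b\<^sup>2 + 1" by (simp add: field_simps)
      thus False using young[of "(b\<^sup>2 + 1) / (2 * I)"] \<open>I > 0\<close> True by simp
    qed
    thus ?thesis using True by simp
  next
    case False
    hence "a > 0" using ab by simp
    have "2 * (b / a) * I \<le> 2 * b\<^sup>2" using young[of "b / a"] ab \<open>a > 0\<close> by (simp add: power_divide)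
    hence "b * I \<le> b * (a * b)" using \<open>a > 0\<close> by (simp add: field_simps power2_eq_square)
    moreover have "I \<le> 0" if "b = 0"
    proof (rule ccontr)
      assume "\<not> I \<le> 0"
      hence pos: "I > 0" by simp
      have "2 * (I / a\<^sup>2) * I \<le> (I / a\<^sup>2)\<^sup>2 * a\<^sup>2" using young[of "I / a\<^sup>2"] pos that by simp
      hence "2 * I\<^sup>2 \<le> I\<^sup>2" using \<open>a > 0\<close> by (simp add: field_simps power2_eq_square)
      thus False using pos by simp
    qed
    ultimately show ?thesis using ab by (cases "b = 0") (auto simp: mult_le_cancel_left)
  qed
  thus ?thesis by (simp add: I_def a_def b_def)
qed

lemma integrable_inner_Lsq:
  fixes f g :: "'t \<Rightarrow> 'a::{real_inner, second_countable_topology}"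
  assumes "f \<in> Lsq M" "g \<in> Lsq M"
  shows "integrable M (\<lambda>t. f t \<bullet> g t)"
  by (rule Bochner_Integration.integrable_bound[OF integrable_norm_mult_Lsq[OF assms]])
    (auto intro!: borel_measurable_inner Lsq_measurable[OF assms(1)] Lsq_measurable[OF assms(2)] Cauchy_Schwarz_ineq2)

lemma integral_inner_Lsq_le:
  fixes f g :: "'t \<Rightarrow> 'a::{real_inner, second_countable_topology}"
  assumes "f \<in> Lsq M" "g \<in> Lsq M"
  shows "\<bar>LINT t|M. f t \<bullet> g t\<bar> \<le> sqrt (nsq M f) * sqrt (nsq M g)"
proof -
  have "\<bar>LINT t|M. f t \<bullet> g t\<bar> \<le> (LINT t|M. \<bar>f t \<bullet> g t\<bar>)"
    using integral_norm_bound[of M "\<lambda>t. f t \<bullet> g t"] by simp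
  also have "\<dots> \<le> (LINT t|M. norm (f t) * norm (g t))"
    by (rule integral_mono)
      (use integrable_inner_Lsq[OF assms] integrable_norm_mult_Lsq[OF assms] in \<open>auto simp: Cauchy_Schwarz_ineq2\<close>)
  also have "\<dots> \<le> sqrt (nsq M f) * sqrt (nsq M g)" by (rule integral_norm_mult_Lsq[OF assms])
  finally show ?thesis .
qed

lemma nsq_inner: "nsq M f = (LINT t|M. f t \<bullet> f t)" for f :: "'t \<Rightarrow> 'a::real_inner"
  by (simp add: nsq_def power2_norm_eq_inner)

lemma nsq_triangle:
  fixes f g :: "'t \<Rightarrow> 'a::{real_normed_vector, second_countable_topology}"
  assumes f: "f \<in> Lsq M" and g: "g \<in> Lsq M"
  shows "sqrt (nsq M (\<lambda>t. f t + g t)) \<le> sqrt (nsq M f) + sqrt (nsq M g)"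
proof -
  have "nsq M (\<lambda>t. f t + g t) \<le> (LINT t|M. (norm (f t))\<^sup>2 + 2 * (norm (f t) * norm (g t)) + (norm (g t))\<^sup>2)"
    unfolding nsq_def
  proof (rule integral_mono)
    show "(norm (f t + g t))\<^sup>2 \<le> (norm (f t))\<^sup>2 + 2 * (norm (f t) * norm (g t)) + (norm (g t))\<^sup>2" for t
      using power_mono[OF norm_triangle_ineq[of "f t" "g t"], of 2] by (simp add: power2_sum)
  qed (use Lsq_integrable[OF Lsq_add[OF f g]] Lsq_integrable[OF f] Lsq_integrable[OF g]
      integrable_norm_mult_Lsq[OF f g] in auto)
  also have "\<dots> = nsq M f + 2 * (LINT t|M. norm (f t) * norm (g t)) + nsq M g"
    using Lsq_integrable[OF f] Lsq_integrable[OF g] integrable_norm_mult_Lsq[OF f g] by (simp add: nsq_def)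
  also have "\<dots> \<le> (sqrt (nsq M f) + sqrt (nsq M g))\<^sup>2"
    using integral_norm_mult_Lsq[OF f g] by (simp add: power2_sum)
  finally show ?thesis by (intro real_le_lsqrt) auto
qed

lemma Lsq_eq_0_AE:
  assumes "f \<in> Lsq M" "nsq M f = 0" shows "AE t in M. f t = 0"
  using integral_nonneg_eq_0_iff_AE[OF Lsq_integrable[OF assms(1)]] assms(2) by (auto simp: nsq_def)

lemma (in finite_measure) Lsq_integrable1:
  fixes f :: "'a \<Rightarrow> 'b::{banach, second_countable_topology}"
  assumes "f \<in> Lsq M" shows "integrable M f"
proof (rule Bochner_Integration.integrable_bound)
  show "integrable M (\<lambda>t. 1 + (norm (f t))\<^sup>2)" using Lsq_integrable[OF assms] by simp
  have "norm (f t) \<le> 1 + (norm (f t))\<^sup>2" for t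
    using sum_squares_bound[of 1 "norm (f t)"] norm_ge_zero[of "f t"] unfolding one_power2 mult_1_right by argo
  thus "AE t in M. norm (f t) \<le> norm (1 + (norm (f t))\<^sup>2)" by (intro AE_I2) (simp add: add_nonneg_nonneg)
qed (use Lsq_measurable[OF assms] in auto)

lemma (in finite_measure) Lsq_bounded:
  assumes "f \<in> borel_measurable M" "\<And>t. t \<in> space M \<Longrightarrow> norm (f t) \<le> K"
  shows "f \<in> Lsq M"
proof (rule LsqI[OF assms(1)])
  show "integrable M (\<lambda>t. (norm (f t))\<^sup>2)"
    by (rule integrable_const_bound[where B = "K\<^sup>2"])
      (use assms in \<open>auto intro!: power_mono\<close>)
qed

lemma Lsq_mult_bounded:
  fixes f :: "'t \<Rightarrow> 'a::{real_normed_vector, second_countable_topology}"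
  assumes "f \<in> Lsq M" "\<phi> \<in> borel_measurable M" "AE t in M. \<bar>\<phi> t\<bar> \<le> K"
  shows "(\<lambda>t. \<phi> t *\<^sub>R f t) \<in> Lsq M"
  by (rule Lsq_bound[where K = K, OF assms(1)])
    (use assms(3) in \<open>auto intro!: mult_right_mono borel_measurable_scaleR Lsq_measurable[OF assms(1)] assms(2)\<close>)

text \<open>Riesz-Fischer. Increments along a subsequence have squared norms below
  \<open>(1/8)^k\<close>; weighted by \<open>2^k\<close> they still sum up, which forces pointwise
  convergence almost everywhere. Fatou's lemma then turns the Cauchy bounds into bounds for the
  distance to the pointwise limit.\<close>

lemma Lsq_complete:
  fixes f :: "nat \<Rightarrow> 't \<Rightarrow> 'a::{banach, second_countable_topology}"
  assumes f: "\<And>n. f n \<in> Lsq M"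
    and cau: "\<And>e. e > 0 \<Longrightarrow> \<exists>N. \<forall>m\<ge>N. \<forall>n\<ge>N. nsq M (\<lambda>t. f m t - f n t) < e"
  obtains g where "g \<in> Lsq M" "(\<lambda>n. nsq M (\<lambda>t. f n t - g t)) \<longlonglongrightarrow> 0"
proof -
  have [measurable]: "f n \<in> borel_measurable M" for n using f by (rule Lsq_measurable)
  have I: "integrable M (\<lambda>t. (norm (f m t - f n t))\<^sup>2)" for m n
    by (intro Lsq_integrable Lsq_diff f)
  have "\<forall>k. \<exists>N. \<forall>m\<ge>N. \<forall>n\<ge>N. nsq M (\<lambda>t. f m t - f n t) < (1/8)^k"
    using cau by simp
  then obtain N where N: "\<And>k m n. m \<ge> N k \<Longrightarrow> n \<ge> N k \<Longrightarrow> nsq M (\<lambda>t. f m t - f n t) < (1/8)^k"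
    by metis
  \<comment> \<open>Partial sums of the thresholds form an increasing index sequence that stays
    above each threshold.\<close>
  define r where "r k = (\<Sum>i\<le>k. N i)" for k
  have rN1: "r k \<ge> N k" for k unfolding r_def by (rule member_le_sum) auto
  have rN: "r k \<ge> N k" "r (Suc k) \<ge> N k" for k using rN1[of k] by (auto simp: r_def)
  have rmono: "r i \<le> r j" if "i \<le> j" for i j
    unfolding r_def using that by (intro sum_mono2) auto
  define D where "D k t = f (r (Suc k)) t - f (r k) t" for k t
  have nn: "(\<integral>\<^sup>+t. ennreal ((norm (h t))\<^sup>2) \<partial>M) = ennreal (nsq M h)" if "h \<in> Lsq M" for h :: "'t \<Rightarrow> 'a"
    unfolding nsq_def by (rule nn_integral_eq_integral[OF Lsq_integrable[OF that]]) auto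
  have "(\<integral>\<^sup>+t. (\<Sum>k. ennreal (2^k * (norm (D k t))\<^sup>2)) \<partial>M) = (\<Sum>k. \<integral>\<^sup>+t. ennreal (2^k * (norm (D k t))\<^sup>2) \<partial>M)"
    unfolding D_def by (rule nn_integral_suminf) measurable
  also have "\<dots> \<le> (\<Sum>k. ennreal ((1/4)^k))"
  proof (intro suminf_le summableI)
    fix k
    have "(\<integral>\<^sup>+t. ennreal (2^k * (norm (D k t))\<^sup>2) \<partial>M) = ennreal (2^k) * ennreal (nsq M (D k))"
      unfolding ennreal_mult'[of "2^k", simplified] D_def
      by (subst nn_integral_cmult) (auto simp: nn[OF Lsq_diff[OF f f]])
    also have "\<dots> \<le> ennreal (2^k) * ennreal ((1/8)^k)"
      using N[OF rN(2) rN(1), of k] unfolding D_def by (intro mult_left_mono ennreal_leI) auto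
    also have "\<dots> = ennreal ((1/4)^k)"
      by (simp flip: ennreal_mult' power_mult_distrib)
    finally show "(\<integral>\<^sup>+t. ennreal (2^k * (norm (D k t))\<^sup>2) \<partial>M) \<le> ennreal ((1/4)^k)" .
  qed
  also have "\<dots> = ennreal (\<Sum>k. (1/4)^k)"
    by (rule suminf_ennreal2) (auto intro: summable_geometric)
  also have "\<dots> < \<infinity>" by simp
  finally have "AE t in M. (\<Sum>k. ennreal (2^k * (norm (D k t))\<^sup>2)) \<noteq> \<infinity>"
    by (intro nn_integral_PInf_AE) (auto simp: D_def)
  hence conv: "AE t in M. convergent (\<lambda>k. f (r k) t)"
  proof eventually_elim
    case (elim t)
    have sm: "summable (\<lambda>k. 2^k * (norm (D k t))\<^sup>2)"
      by (rule summable_suminf_not_top) (use elim in auto)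
    have "summable (\<lambda>k. (1/2)^k + 2^k * (norm (D k t))\<^sup>2)"
      by (intro summable_add sm summable_geometric) simp
    \<comment> \<open>The arithmetic-geometric mean inequality bounds \<open>norm (D k t)\<close> by
      \<open>(1/2)^k + 2^k * (norm (D k t))\<^sup>2\<close>: the weight of the squares is paid for
      by a geometric series.\<close>
    hence "summable (\<lambda>k. D k t)"
    proof (rule summable_comparison_test'[of _ 0])
      fix k :: nat
      have "2 * (sqrt (1/2)^k * (sqrt 2 ^ k * norm (D k t))) \<le> (sqrt (1/2)^k)\<^sup>2 + (sqrt 2 ^ k * norm (D k t))\<^sup>2"
        using sum_squares_bound[of "sqrt (1/2)^k" "sqrt 2 ^ k * norm (D k t)"] by (simp add: mult_ac)
      moreover have "sqrt (1/2)^k * (sqrt 2 ^ k * norm (D k t)) = norm (D k t)"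
        by (simp add: real_sqrt_divide power_divide)
      moreover have "(sqrt (1/2)^k)\<^sup>2 = (1/2)^k" "(sqrt 2 ^ k)\<^sup>2 = 2^k"
        by (simp_all flip: power_mult add: mult.commute[of _ 2], simp_all add: power_mult)
      ultimately show "norm (D k t) \<le> (1/2)^k + 2^k * (norm (D k t))\<^sup>2"
        by (smt (verit) norm_ge_zero power_mult_distrib)
    qed
    hence "convergent (\<lambda>n. \<Sum>k<n. D k t)" by (simp add: summable_iff_convergent)
    hence "convergent (\<lambda>n. (\<Sum>k<n. D k t) + f (r 0) t)"
      by (intro convergent_add convergent_const)
    moreover have "(\<Sum>k<n. D k t) + f (r 0) t = f (r n) t" for n
      unfolding D_def by (subst sum_lessThan_telescope[of "\<lambda>k. f (r k) t"]) simp
    ultimately show ?case by simp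
  qed
  define g where "g t = lim (\<lambda>k. f (r k) t)" for t
  have [measurable]: "g \<in> borel_measurable M" unfolding g_def by measurable
  have fg: "AE t in M. (\<lambda>k. f (r k) t) \<longlonglongrightarrow> g t"
    using conv unfolding g_def by eventually_elim (simp add: convergent_LIMSEQ_iff)
  \<comment> \<open>Stated as a nonnegative integral, because integrability of the difference is
    itself a consequence of this bound.\<close>
  have bound: "(\<integral>\<^sup>+t. ennreal ((norm (f n t - g t))\<^sup>2) \<partial>M) \<le> ennreal ((1/8)^k)" if n: "n \<ge> N k" for n k
  proof -
    have "(\<integral>\<^sup>+t. ennreal ((norm (f n t - g t))\<^sup>2) \<partial>M) = (\<integral>\<^sup>+t. liminf (\<lambda>j. ennreal ((norm (f n t - f (r j) t))\<^sup>2)) \<partial>M)"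
    proof (rule nn_integral_cong_AE)
      show "AE t in M. ennreal ((norm (f n t - g t))\<^sup>2) = liminf (\<lambda>j. ennreal ((norm (f n t - f (r j) t))\<^sup>2))"
        using fg
      proof eventually_elim
        case (elim t)
        hence "(\<lambda>j. ennreal ((norm (f n t - f (r j) t))\<^sup>2)) \<longlonglongrightarrow> ennreal ((norm (f n t - g t))\<^sup>2)"
          by (intro tendsto_intros)
        from lim_imp_Liminf[OF _ this] show ?case by simp
      qed
    qed
    also have "\<dots> \<le> liminf (\<lambda>j. \<integral>\<^sup>+t. ennreal ((norm (f n t - f (r j) t))\<^sup>2) \<partial>M)"
      by (rule nn_integral_liminf) measurable
    also have "\<dots> \<le> ennreal ((1/8)^k)"
    proof (rule Liminf_le)
      have "(\<integral>\<^sup>+t. ennreal ((norm (f n t - f (r j) t))\<^sup>2) \<partial>M) \<le> ennreal ((1/8)^k)" if "j \<ge> k" for j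
      proof -
        have "r j \<ge> N k" using rN(1)[of k] rmono[OF that] by linarith
        thus ?thesis using N[OF n \<open>r j \<ge> N k\<close>] by (simp add: nn[OF Lsq_diff[OF f f]] ennreal_leI)
      qed
      thus "\<forall>\<^sub>F j in sequentially. (\<integral>\<^sup>+t. ennreal ((norm (f n t - f (r j) t))\<^sup>2) \<partial>M) \<le> ennreal ((1/8)^k)"
        by (auto simp: eventually_sequentially)
    qed simp
    finally show ?thesis .
  qed
  have d: "(\<lambda>t. f n t - g t) \<in> Lsq M" if "n \<ge> N k" for n k
  proof (rule LsqI)
    show "integrable M (\<lambda>t. (norm (f n t - g t))\<^sup>2)"
    proof (rule integrableI_nonneg)
      show "(\<integral>\<^sup>+ x. ennreal ((norm (f n x - g x))\<^sup>2) \<partial>M) < \<infinity>"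
        using bound[OF that] by (simp add: le_less_trans)
    qed auto
  qed measurable
  have "(\<lambda>t. f (N 0) t - (f (N 0) t - g t)) \<in> Lsq M"
    by (rule Lsq_diff[OF f d[of 0]]) simp
  hence g: "g \<in> Lsq M" by simp
  have "(\<lambda>n. nsq M (\<lambda>t. f n t - g t)) \<longlonglongrightarrow> 0"
  proof (rule LIMSEQ_I)
    fix e :: real assume "e > 0"
    then obtain k where k: "(1/8::real)^k < e" using real_arch_pow_inv[of e "1/8"] by auto
    have "nsq M (\<lambda>t. f n t - g t) < e" if "n \<ge> N k" for n
    proof -
      have "nsq M (\<lambda>t. f n t - g t) \<le> (1/8)^k"
        using bound[OF that] by (simp add: nn[OF d[OF that]])
      thus ?thesis using k by simp
    qed
    thus "\<exists>no. \<forall>n\<ge>no. norm (nsq M (\<lambda>t. f n t - g t) - 0) < e" by auto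
  qed
  with g show ?thesis by (rule that)
qed

section \<open>Test functions\<close>

text \<open>\<open>flat 0\<close> is the classical smooth function exp(-1/x), extended by zero. The
  powers of 1/x make the family closed under differentiation up to linear combinations, so
  smoothness follows by induction.\<close>

definition flat :: "nat \<Rightarrow> real \<Rightarrow> real" where
  "flat k x = (if x > 0 then (1 / x) ^ k / exp (1 / x) else 0)"

lemma flat_tendsto_0: "(flat k \<longlongrightarrow> 0) (at 0)"
  unfolding filterlim_split_at_real
proof (rule filterlim_split_at)
  show "(flat k \<longlongrightarrow> 0) (at_left 0)"
    by (rule tendsto_eventually) (auto simp: flat_def eventually_at_filter)
  have "((\<lambda>x::real. (inverse x) ^ k / exp (inverse x)) \<longlongrightarrow> 0) (at_right 0)"
    by (rule filterlim_compose[OF tendsto_power_div_exp_0 filterlim_inverse_at_top_right])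
  thus "(flat k \<longlongrightarrow> 0) (at_right 0)"
    by (rule Lim_transform_eventually) (auto simp: flat_def eventually_at_filter inverse_eq_divide)
qed

lemma flat_deriv: "(flat k has_real_derivative (- real k * flat (k + 1) x + flat (k + 2) x)) (at x)"
proof -
  consider "x < 0" | "x = 0" | "x > 0" by linarith
  thus ?thesis
  proof cases
    case 1
    have "((\<lambda>_. 0) has_real_derivative (- real k * flat (k + 1) x + flat (k + 2) x)) (at x)"
      using 1 by (auto simp: flat_def)
    thus ?thesis
      by (rule has_field_derivative_transform_within_open[where S = "{..<0}"]) (use 1 in \<open>auto simp: flat_def\<close>)
  next
    case 2
    \<comment> \<open>The difference quotient of \<open>flat k\<close> at 0 is
      \<open>flat (k + 1)\<close>.\<close>
    have "((\<lambda>h. (flat k (0 + h) - flat k 0) / h) \<longlongrightarrow> 0) (at 0)"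
      by (rule Lim_transform_eventually[OF flat_tendsto_0[of "k + 1"]])
        (auto simp: flat_def eventually_at_filter)
    thus ?thesis using 2 by (simp add: DERIV_def flat_def)
  next
    case 3
    have "((\<lambda>x. (1 / x) ^ k * exp (- (1 / x))) has_real_derivative
        (- real k * flat (k + 1) x + flat (k + 2) x)) (at x)"
    proof (cases k)
      case 0
      show ?thesis unfolding 0 flat_def using 3
        by (auto intro!: derivative_eq_intros simp: exp_minus field_simps power2_eq_square)
    next
      case (Suc j)
      have "((\<lambda>x. (1 / x) ^ Suc j * exp (- (1 / x))) has_real_derivative
         (real (Suc j) * (1/x)^j * (- ((1/x)^2)) * exp (- (1/x)) + (1/x)^Suc j * (exp (- (1/x)) * (1/x)^2))) (at x)"
      proof -
        have g: "((\<lambda>x. 1 / x) has_real_derivative - ((1/x)^2)) (at x)"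
          using 3 by (auto intro!: derivative_eq_intros simp: power2_eq_square)
        have e: "((\<lambda>x. exp (- (1 / x))) has_real_derivative exp (- (1/x)) * (1/x)^2) (at x)"
          using DERIV_fun_exp[OF DERIV_minus[OF g]] by simp
        show ?thesis
          using DERIV_mult[OF DERIV_power_Suc[OF g, of j] e] by (simp add: algebra_simps)
      qed
      thus ?thesis unfolding Suc flat_def using 3
        by (simp add: exp_minus divide_inverse power2_eq_square algebra_simps)
    qed
    thus ?thesis
      by (rule has_field_derivative_transform_within_open[where S = "{0<..}"])
        (use 3 in \<open>auto simp: flat_def exp_minus divide_inverse\<close>)
  qed
qed

text \<open>The derivatives of orders 0 to \<open>n\<close> are differentiable. Peeling off the
  innermost \<open>deriv\<close> lets the sum, product and chain rules be proved by induction with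
  the function generalized.\<close>

fun Cn :: "nat \<Rightarrow> (real \<Rightarrow> real) \<Rightarrow> bool" where
  "Cn 0 f = (\<forall>x. f field_differentiable at x)"
| "Cn (Suc n) f = ((\<forall>x. f field_differentiable at x) \<and> Cn n (deriv f))"

lemma Cn_Suc_D: "Cn (Suc n) f \<Longrightarrow> Cn n f"
  by (induction n arbitrary: f) auto

lemma Cn_iff: "Cn n f \<longleftrightarrow> (\<forall>k\<le>n. \<forall>x. (deriv ^^ k) f field_differentiable at x)"
proof (induction n arbitrary: f)
  case (Suc n)
  have "(\<forall>k\<le>Suc n. P k) \<longleftrightarrow> P 0 \<and> (\<forall>k\<le>n. P (Suc k))" for P :: "nat \<Rightarrow> bool"
    by (metis Suc_le_mono le0 not0_implies_Suc)
  thus ?case using Suc by (simp add: funpow_swap1)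
qed simp

lemma deriv_eqI: "(\<And>x. (f has_field_derivative g x) (at x)) \<Longrightarrow> deriv f = g"
  by (rule ext, rule DERIV_imp_deriv)

lemma Cn_add: "Cn n f \<Longrightarrow> Cn n g \<Longrightarrow> Cn n (\<lambda>x. f x + g x)"
proof (induction n arbitrary: f g)
  case (Suc n)
  have "deriv (\<lambda>x. f x + g x) = (\<lambda>x. deriv f x + deriv g x)"
    using Suc.prems by (auto simp: fun_eq_iff)
  thus ?case using Suc by (auto intro: field_differentiable_add)
qed (auto intro: field_differentiable_add)

lemma Cn_mult: "Cn n f \<Longrightarrow> Cn n g \<Longrightarrow> Cn n (\<lambda>x. f x * g x)"
proof (induction n arbitrary: f g)
  case (Suc n)
  have d: "f field_differentiable at x" "g field_differentiable at x" for x
    using Suc.prems by auto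
  have "deriv (\<lambda>x. f x * g x) = (\<lambda>x. f x * deriv g x + deriv f x * g x)"
    using d by (simp add: fun_eq_iff)
  moreover have "Cn n (\<lambda>x. f x * deriv g x + deriv f x * g x)"
    using Suc.prems Cn_Suc_D by (intro Cn_add Suc.IH) auto
  ultimately show ?case using d by (auto intro: field_differentiable_mult)
qed (auto intro: field_differentiable_mult)

lemma Cn_const: "Cn n (\<lambda>x. c)"
  by (induction n arbitrary: c) auto

lemma Cn_affine: "Cn n f \<Longrightarrow> Cn n (\<lambda>x. f (a * x + b))"
proof (induction n arbitrary: f)
  case 0
  have "((\<lambda>x. f (a * x + b)) has_field_derivative deriv f (a * x + b) * a) (at x)" for x
    using 0 by (intro DERIV_chain2[of f]) (auto intro!: derivative_eq_intros simp: field_differentiable_derivI)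
  thus ?case by (auto simp: field_differentiable_def)
next
  case (Suc n)
  have D: "((\<lambda>x. f (a * x + b)) has_field_derivative a * deriv f (a * x + b)) (at x)" for x
  proof -
    have "((\<lambda>x. f (a * x + b)) has_field_derivative deriv f (a * x + b) * a) (at x)"
      by (rule DERIV_chain2[of f]) (use Suc.prems in \<open>auto intro!: derivative_eq_intros simp: field_differentiable_derivI\<close>)
    thus ?thesis by (simp add: mult.commute)
  qed
  have "deriv (\<lambda>x. f (a * x + b)) = (\<lambda>x. a * deriv f (a * x + b))"
    by (rule deriv_eqI[OF D])
  moreover have "Cn n (\<lambda>x. a * deriv f (a * x + b))"
    by (intro Cn_mult Cn_const Suc.IH) (use Suc.prems in auto)
  ultimately show ?case using D by (auto simp: field_differentiable_def)
qed

lemma Cn_flat: "Cn n (flat k)"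
proof (induction n arbitrary: k)
  case 0
  show ?case using flat_deriv by (auto simp: field_differentiable_def)
next
  case (Suc n)
  have "deriv (flat k) = (\<lambda>x. - real k * flat (k + 1) x + flat (k + 2) x)"
    by (rule deriv_eqI[OF flat_deriv])
  moreover have "Cn n (\<lambda>x. - real k * flat (k + 1) x + flat (k + 2) x)"
    by (intro Cn_add Cn_mult Cn_const Suc.IH)
  ultimately show ?case using flat_deriv by (auto simp: field_differentiable_def)
qed

section \<open>Bump functions and properties of test functions\<close>

lemma test_functions_iff:
  "\<phi> \<in> test_functions T \<longleftrightarrow> (\<forall>n. Cn n \<phi>) \<and> closure {x. \<phi> x \<noteq> 0} \<subseteq> {0<..<T}"
  by (auto simp: test_functions_def Cn_iff)

text \<open>Scaling by \<open>Suc n\<close> steepens the flanks at \<open>a\<close> and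
  \<open>b\<close>, so the bumps tend to the indicator of the open interval. The arguments are
  written as affine maps of \<open>x\<close> to fit \<open>Cn_affine\<close>.\<close>

definition bump :: "real \<Rightarrow> real \<Rightarrow> nat \<Rightarrow> real \<Rightarrow> real" where
  "bump a b n x = flat 0 (real (Suc n) * x + - (real (Suc n) * a)) * flat 0 (- real (Suc n) * x + real (Suc n) * b)"

lemma bump_eq: "bump a b n x = flat 0 (real (Suc n) * (x - a)) * flat 0 (real (Suc n) * (b - x))"
  by (simp add: bump_def algebra_simps)

lemma flat_0_pos: "flat 0 x > 0 \<longleftrightarrow> x > 0"
  and flat_0_bounds: "0 \<le> flat 0 x" "flat 0 x \<le> 1"
  by (auto simp: flat_def)

lemma bump_nonzero: "bump a b n x \<noteq> 0 \<longleftrightarrow> x \<in> {a<..<b}"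
  using flat_0_pos[of "real (Suc n) * (x - a)"] flat_0_pos[of "real (Suc n) * (b - x)"]
    flat_0_bounds(1)[of "real (Suc n) * (x - a)"] flat_0_bounds(1)[of "real (Suc n) * (b - x)"]
  by (auto simp: bump_eq zero_less_mult_iff)

lemma bump_bounds: "0 \<le> bump a b n x" "bump a b n x \<le> 1"
  using flat_0_bounds by (auto simp: bump_eq intro!: mult_le_one)

lemma bump_test_function:
  assumes "0 < a" "b < T" shows "bump a b n \<in> test_functions T"
  unfolding test_functions_iff
proof
  show "\<forall>k. Cn k (bump a b n)"
    unfolding bump_def by (intro allI Cn_mult Cn_affine Cn_flat)
  have "closure {x. bump a b n x \<noteq> 0} \<subseteq> {a..b}"
    by (rule closure_minimal) (auto simp: bump_nonzero)
  also have "\<dots> \<subseteq> {0<..<T}" using assms by auto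
  finally show "closure {x. bump a b n x \<noteq> 0} \<subseteq> {0<..<T}" .
qed

lemma bump_tendsto: "(\<lambda>n. bump a b n x) \<longlonglongrightarrow> indicator {a<..<b} x"
proof (cases "x \<in> {a<..<b}")
  case True
  have *: "(\<lambda>n. flat 0 (real (Suc n) * y)) \<longlonglongrightarrow> 1" if "y > 0" for y
  proof -
    have "(\<lambda>n. 1 / exp (1 / real (Suc n) * (1 / y))) \<longlonglongrightarrow> 1 / exp (0 * (1 / y))"
      by (intro tendsto_intros LIMSEQ_Suc[OF lim_1_over_n]) auto
    thus ?thesis using that by (simp add: flat_def zero_less_mult_iff)
  qed
  from tendsto_mult[OF *[of "x - a"] *[of "b - x"]] True show ?thesis by (simp add: bump_eq)
next
  case False
  hence "bump a b n x = 0" for n using bump_nonzero by metis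
  thus ?thesis using False by simp
qed

text \<open>The disjunct \<open>T \<le> 0\<close> covers the empty interval: only the zero function
  is a test function there, and no \<open>b\<close> with \<open>0 < a \<le> b < T\<close>
  exists.\<close>

lemma test_function_support:
  assumes "\<phi> \<in> test_functions T"
  obtains a b where "0 < a" "a \<le> b" "b < T \<or> T \<le> 0" "\<And>x. x \<notin> {a..b} \<Longrightarrow> \<phi> x = 0"
proof -
  define K where "K = closure {x. \<phi> x \<noteq> 0}"
  have K: "K \<subseteq> {0<..<T}" using assms by (simp add: K_def test_functions_iff)
  have "compact K"
    using K bounded_subset[of "{0<..<T}" K] by (auto simp: compact_eq_bounded_closed K_def)
  have out: "\<phi> x = 0" if "x \<notin> K" for x
    using that closure_subset[of "{x. \<phi> x \<noteq> 0}"] unfolding K_def by blast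
  show ?thesis
  proof (cases "K = {}")
    case True
    show ?thesis
    proof (rule that[of "if T > 0 then T/2 else 1" "if T > 0 then T/2 else 1"])
    qed (use out True in auto)
  next
    case False
    obtain a b where a: "a \<in> K" "\<And>x. x \<in> K \<Longrightarrow> a \<le> x" and b: "b \<in> K" "\<And>x. x \<in> K \<Longrightarrow> x \<le> b"
      using compact_attains_inf[OF \<open>compact K\<close> False] compact_attains_sup[OF \<open>compact K\<close> False] by metis
    show ?thesis
    proof (rule that[of a b])
      show "\<phi> x = 0" if "x \<notin> {a..b}" for x using that a(2) b(2) out by force
    qed (use a b K in auto)
  qed
qed

lemma test_function_deriv:
  "\<phi> \<in> test_functions T \<Longrightarrow> (\<phi> has_real_derivative deriv \<phi> x) (at x)"
  by (simp add: test_functions_iff DERIV_deriv_iff_field_differentiable) (metis Cn.simps(1))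

lemma deriv_test_function:
  assumes "\<phi> \<in> test_functions T" shows "deriv \<phi> \<in> test_functions T"
  unfolding test_functions_iff
proof
  show "\<forall>n. Cn n (deriv \<phi>)" using assms unfolding test_functions_iff by (metis Cn.simps(2))
  have "{x. deriv \<phi> x \<noteq> 0} \<subseteq> closure {x. \<phi> x \<noteq> 0}"
  proof (rule ccontr)
    assume "\<not> ?thesis"
    then obtain x where x: "deriv \<phi> x \<noteq> 0" "x \<in> - closure {x. \<phi> x \<noteq> 0}" by auto
    have "((\<lambda>_. 0) has_real_derivative deriv \<phi> x) (at x)"
      by (rule has_field_derivative_transform_within_open[OF test_function_deriv[OF assms] _ x(2)])
        (use closure_subset[of "{x. \<phi> x \<noteq> 0}"] in auto)
    thus False using x(1) DERIV_unique[OF DERIV_const] by fastforce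
  qed
  hence "closure {x. deriv \<phi> x \<noteq> 0} \<subseteq> closure {x. \<phi> x \<noteq> 0}" by (simp add: closure_minimal)
  thus "closure {x. deriv \<phi> x \<noteq> 0} \<subseteq> {0<..<T}" using assms unfolding test_functions_iff by blast
qed

lemma continuous_test_function: "\<phi> \<in> test_functions T \<Longrightarrow> continuous_on A \<phi>"
  by (meson DERIV_isCont continuous_at_imp_continuous_on test_function_deriv)

lemma test_function_measurable: "\<phi> \<in> test_functions T \<Longrightarrow> \<phi> \<in> borel_measurable borel"
  by (simp add: borel_measurable_continuous_onI continuous_test_function)

lemma borel_measurable_time: "f \<in> borel_measurable borel \<Longrightarrow> f \<in> borel_measurable (time T)"
  by (simp add: measurable_completion measurable_restrict_space1)

lemma test_function_bounded:
  assumes "\<phi> \<in> test_functions T" obtains K where "K > 0" "\<And>x. \<bar>\<phi> x\<bar> \<le> K"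
proof -
  obtain a b where ab: "0 < a" "a \<le> b" "\<And>x. x \<notin> {a..b} \<Longrightarrow> \<phi> x = 0"
    using test_function_support[OF assms] by metis
  have "bounded (\<phi> ` {a..b})"
    by (intro compact_imp_bounded compact_continuous_image continuous_test_function[OF assms]) auto
  then obtain K where K: "K > 0" "\<forall>x\<in>{a..b}. \<bar>\<phi> x\<bar> \<le> K" by (auto simp: bounded_pos)
  show ?thesis
  proof (rule that[OF K(1)])
    show "\<bar>\<phi> x\<bar> \<le> K" for x using K ab(3)[of x] by (cases "x \<in> {a..b}") auto
  qed
qed

lemma test_function_zero:
  assumes "\<phi> \<in> test_functions T" "x \<notin> {0<..<T}" shows "\<phi> x = 0"
  using assms closure_subset[of "{x. \<phi> x \<noteq> 0}"] unfolding test_functions_iff by blast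

lemma test_function_lincomb:
  assumes "\<phi> \<in> test_functions T" "\<psi> \<in> test_functions T"
  shows "(\<lambda>x. \<phi> x + c * \<psi> x) \<in> test_functions T"
  unfolding test_functions_iff
proof
  show "\<forall>n. Cn n (\<lambda>x. \<phi> x + c * \<psi> x)"
    using assms by (auto simp: test_functions_iff intro!: Cn_add Cn_mult Cn_const)
  have "closure {x. \<phi> x + c * \<psi> x \<noteq> 0} \<subseteq> closure ({x. \<phi> x \<noteq> 0} \<union> {x. \<psi> x \<noteq> 0})"
    by (intro closure_mono) auto
  thus "closure {x. \<phi> x + c * \<psi> x \<noteq> 0} \<subseteq> {0<..<T}"
    using assms by (auto simp: test_functions_iff)
qed

section \<open>Integration over the time interval and weak derivatives of scalar functions\<close>

interpretation time: finite_measure "time T" for T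
  by (rule finite_measure_lebesgue_on) simp

interpretation time: pair_sigma_finite "time T" "time T" for T
  by unfold_locales

text \<open>\<open>time T\<close> carries the completed sigma-algebra; Borel integrands can be moved
  to \<open>lborel\<close>, where the fundamental theorem of calculus and substitution are
  available.\<close>

lemma integral_time_lborel:
  fixes f :: "real \<Rightarrow> 'a::{banach, second_countable_topology}"
  assumes "f \<in> borel_measurable borel"
  shows "(LINT t|time T. f t) = (LINT t|lborel. indicator {0<..<T} t *\<^sub>R f t)"
    and "integrable (time T) f \<longleftrightarrow> integrable lborel (\<lambda>t. indicator {0<..<T} t *\<^sub>R f t)"
proof -
  have m: "(\<lambda>t. indicator {0<..<T} t *\<^sub>R f t) \<in> borel_measurable lborel"
    using assms by measurable
  show "(LINT t|time T. f t) = (LINT t|lborel. indicator {0<..<T} t *\<^sub>R f t)"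
    by (subst integral_restrict_space) (use m in \<open>auto simp: integral_completion\<close>)
  show "integrable (time T) f \<longleftrightarrow> integrable lborel (\<lambda>t. indicator {0<..<T} t *\<^sub>R f t)"
    by (subst integrable_restrict_space) (use m in \<open>auto simp: integrable_completion\<close>)
qed

lemma integral_time_FTC:
  fixes F :: "real \<Rightarrow> real"
  assumes "0 \<le> a" "a \<le> b" "b \<le> T"
    and F: "\<And>x. (F has_real_derivative f x) (at x)" and f: "continuous_on UNIV f"
  shows "(LINT t|time T. indicator {a<..<b} t * f t) = F b - F a"
proof -
  have [measurable]: "f \<in> borel_measurable borel" using f by (rule borel_measurable_continuous_onI)
  have "(LINT t|time T. indicator {a<..<b} t * f t) = (LINT t|lborel. indicator {0<..<T} t *\<^sub>R (indicator {a<..<b} t * f t))"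
    by (rule integral_time_lborel) measurable
  also have "\<dots> = (LINT t|lborel. indicator {a..b} t *\<^sub>R f t)"
  proof (rule integral_cong_AE)
    show "AE t in lborel. indicator {0<..<T} t *\<^sub>R (indicator {a<..<b} t * f t) = indicator {a..b} t *\<^sub>R f t"
      using AE_lborel_singleton[of a] AE_lborel_singleton[of b]
      by eventually_elim (use assms(1-3) in \<open>auto simp: indicator_def\<close>)
  qed measurable
  also have "\<dots> = F b - F a"
    by (rule integral_FTC_atLeastAtMost[OF assms(2)])
      (use F f in \<open>auto simp: has_real_derivative_iff_has_vector_derivative
        intro: has_vector_derivative_at_within continuous_on_subset\<close>)
  finally show ?thesis .
qed

text \<open>Bumps converge to indicators, so by dominated convergence the integral of
  \<open>Z\<close> over every inner interval is zero. By Lebesgue differentiation \<open>Z\<close>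
  is almost everywhere the limit of such averages.\<close>

lemma fundamental_lemma:
  assumes Z: "integrable (time T) Z"
    and test: "\<And>\<phi>. \<phi> \<in> test_functions T \<Longrightarrow> (LINT t|time T. \<phi> t * Z t) = 0"
  shows "AE t in time T. Z t = 0"
proof -
  have [measurable]: "Z \<in> borel_measurable (time T)" using Z by auto
  have zero: "(LINT t|time T. indicator {a<..<b} t * Z t) = 0" if "0 < a" "b < T" for a b
  proof (rule LIMSEQ_unique)
    show "(\<lambda>n. LINT t|time T. bump a b n t * Z t) \<longlonglongrightarrow> (LINT t|time T. indicator {a<..<b} t * Z t)"
    proof (rule integral_dominated_convergence[where w = "\<lambda>t. \<bar>Z t\<bar>"])
      show "(\<lambda>t. bump a b n t * Z t) \<in> borel_measurable (time T)" for n
        by (rule borel_measurable_times[OF borel_measurable_time[OF test_function_measurable[OF bump_test_function[OF that]]]])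
          (use Z in auto)
      show "(\<lambda>t. indicator {a<..<b} t * Z t) \<in> borel_measurable (time T)"
        by (rule borel_measurable_times[OF borel_measurable_time]) (use Z in auto)
      show "AE t in time T. (\<lambda>n. bump a b n t * Z t) \<longlonglongrightarrow> indicator {a<..<b} t * Z t"
        by (intro AE_I2 tendsto_mult bump_tendsto tendsto_const)
      show "AE t in time T. norm (bump a b n t * Z t) \<le> \<bar>Z t\<bar>" for n
        using bump_bounds[of a b n] by (auto simp: abs_mult intro!: mult_left_le_one_le AE_I2)
    qed (use Z in auto)
    show "(\<lambda>n. LINT t|time T. bump a b n t * Z t) \<longlonglongrightarrow> 0"
      by (simp add: test[OF bump_test_function[OF that]])
  qed
  define F where "F x = (if x \<in> {0<..<T} then Z x else 0)" for x
  have "Z integrable_on {0<..<T}" by (rule integrable_on_lebesgue_on[OF Z]) auto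
  hence FU: "F integrable_on UNIV" unfolding F_def by (simp only: integrable_restrict_UNIV)
  have "F integrable_on cbox a b" for a b
    by (rule integrable_on_subcbox[OF FU]) auto
  then obtain N where N: "negligible N" and
    diff: "\<And>x e. \<lbrakk>x \<notin> N; 0 < e\<rbrakk> \<Longrightarrow>
               \<exists>d>0. \<forall>h. 0 < h \<and> h < d \<longrightarrow>
                         norm(integral (cbox x (x + h *\<^sub>R One)) F /\<^sub>R h ^ DIM(real) - F x) < e"
    by (rule integrable_ccontinuous_explicit) blast
  have "Z x = 0" if x: "x \<in> {0<..<T}" "x \<notin> N" for x
  proof (rule ccontr)
    assume "Z x \<noteq> 0"
    then obtain d where d: "d > 0" "\<And>h. 0 < h \<Longrightarrow> h < d \<Longrightarrow> norm (integral {x..x + h} F /\<^sub>R h - F x) < \<bar>Z x\<bar>"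
      using diff[OF x(2), of "\<bar>Z x\<bar>"] by auto
    define h where "h = min (d / 2) ((T - x) / 2)"
    have h: "0 < h" "h < d" "x + h < T" using d(1) x by (auto simp: h_def min_def field_simps)
    have "integral {x..x + h} F = integral {x<..<x + h} F"
      by (rule integral_open_interval_real)
    also have "\<dots> = integral {x<..<x + h} Z"
      by (rule Henstock_Kurzweil_Integration.integral_cong) (use x h in \<open>auto simp: F_def\<close>)
    also have "\<dots> = integral\<^sup>L (lebesgue_on {x<..<x + h}) Z"
    proof (rule lebesgue_integral_eq_integral[symmetric])
      show "integrable (lebesgue_on {x<..<x+h}) Z"
      proof -
        have "integrable lebesgue (\<lambda>t. indicator {0<..<T} t *\<^sub>R Z t)"
          using Z by (simp add: integrable_restrict_space)
        from integrable_mult_indicator[OF _ this, of "{x<..<x+h}"]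
        have "integrable lebesgue (\<lambda>t. indicator {x<..<x+h} t *\<^sub>R indicator {0<..<T} t *\<^sub>R Z t)" by simp
        also have "(\<lambda>t. indicator {x<..<x+h} t *\<^sub>R indicator {0<..<T} t *\<^sub>R Z t) = (\<lambda>t. indicator {x<..<x+h} t *\<^sub>R Z t)"
          using x h by (auto simp: indicator_def fun_eq_iff)
        finally show ?thesis by (simp add: integrable_restrict_space)
      qed
    qed auto
    also have "\<dots> = (LINT t|time T. indicator {x<..<x+h} t * Z t)"
    proof -
      have *: "indicator {0<..<T} t * (indicator {x<..<x+h} t * Z t) = indicator {x<..<x+h} t * Z t" for t
        using x h by (auto simp: indicator_def)
      show ?thesis by (simp add: integral_restrict_space *)
    qed
    also have "\<dots> = 0" by (rule zero) (use x h in auto)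
    finally have "norm (- F x) < \<bar>Z x\<bar>" using d(2)[OF h(1,2)] by simp
    thus False using x by (simp add: F_def)
  qed
  moreover have "AE x in time T. x \<notin> N"
    using N AE_not_in[of N lebesgue] by (auto simp: AE_restrict_space_iff negligible_iff_null_sets)
  ultimately show ?thesis by (auto elim: eventually_mono)
qed


text \<open>An antiderivative that vanishes left of the support of \<open>\<rho>\<close> is constant
  right of it; the zero mean makes this constant zero, and the support stays compact in the
  interval.\<close>

lemma test_function_antiderivative:
  assumes \<rho>: "\<rho> \<in> test_functions T" and zero: "(LINT t|time T. \<rho> t) = 0"
  obtains \<phi> where "\<phi> \<in> test_functions T" "deriv \<phi> = \<rho>"
proof -
  obtain a b where ab: "0 < a" "a \<le> b" "b < T \<or> T \<le> 0" "\<And>x. x \<notin> {a..b} \<Longrightarrow> \<rho> x = 0"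
    using test_function_support[OF \<rho>] by metis
  have cont: "continuous_on A \<rho>" for A by (rule continuous_test_function[OF \<rho>])
  \<comment> \<open>The lower limit -1 lies strictly left of the support, so that every
    \<open>t \<ge> a\<close> is an interior point of the interval on which the integral is
    differentiated.\<close>
  define \<phi> where "\<phi> t = integral {-1..t} \<rho>" for t
  have \<phi>0: "\<phi> t = 0" if "t < a" for t
  proof -
    have "integral {-1..t} \<rho> = integral {-1..t} (\<lambda>_. 0)"
      by (rule Henstock_Kurzweil_Integration.integral_cong) (use ab(4) that in auto)
    thus ?thesis by (simp add: \<phi>_def)
  qed
  have D: "(\<phi> has_real_derivative \<rho> t) (at t)" for t
  proof (cases "t < a")
    case True
    have "((\<lambda>_. 0) has_real_derivative \<rho> t) (at t)" using ab(4)[of t] True by simp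
    thus ?thesis
      by (rule has_field_derivative_transform_within_open[where S = "{..<a}"]) (use True \<phi>0 in auto)
  next
    case False
    hence "t > -1" using ab by simp
    have "(\<phi> has_real_derivative \<rho> t) (at t within {-1..t + 1})"
      unfolding \<phi>_def by (rule integral_has_real_derivative[OF cont]) (use \<open>t > -1\<close> in auto)
    thus ?thesis using at_within_Icc_at[of "-1" t "t + 1"] \<open>t > -1\<close> by simp
  qed
  have d: "deriv \<phi> = \<rho>" by (rule deriv_eqI[OF D])
  have C: "\<forall>n. Cn n \<phi>"
  proof
    fix n show "Cn n \<phi>"
      using \<rho> D d by (cases n) (auto simp: test_functions_iff field_differentiable_def)
  qed
  have cm: "\<rho> \<in> borel_measurable borel" by (rule test_function_measurable[OF \<rho>])
  have \<phi>1: "\<phi> t = 0" if "b < t" for t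
  proof -
    have "0 = \<phi> t"
    proof (cases "T > 0")
      case True
      define M where "M = max t T"
      have sp: "indicator {0<..<M} x * \<rho> x = \<rho> x" for x
        using test_function_zero[OF \<rho>, of x] by (cases "x \<in> {0<..<T}") (auto simp: indicator_def M_def)
      have sp': "indicator {0<..<T} x * \<rho> x = \<rho> x" for x
        using test_function_zero[OF \<rho>, of x] by (cases "x \<in> {0<..<T}") (auto simp: indicator_def)
      have "\<phi> M - \<phi> 0 = (LINT x|time M. indicator {0<..<M} x * \<rho> x)"
        by (rule integral_time_FTC[symmetric]) (use True D cont in \<open>auto simp: M_def\<close>)
      also have "\<dots> = (LINT x|time T. \<rho> x)"
        by (simp add: integral_time_lborel[OF cm] sp sp')
      finally have "\<phi> M = 0" using zero \<phi>0[of 0] ab by simp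
      moreover have "\<phi> M = \<phi> t"
      proof (cases "t < T")
        case True
        have "(LINT x|time T. indicator {t<..<T} x * \<rho> x) = \<phi> T - \<phi> t"
          by (rule integral_time_FTC) (use True D cont \<open>b < t\<close> ab in auto)
        moreover have "indicator {t<..<T} x * \<rho> x = 0" for x
          using ab(4)[of x] \<open>b < t\<close> by (auto simp: indicator_def)
        ultimately show ?thesis using True by (simp add: M_def)
      qed (simp add: M_def)
      ultimately show ?thesis by simp
    next
      case False
      hence "\<rho> = (\<lambda>_. 0)" using test_function_zero[OF \<rho>] by force
      thus ?thesis by (simp add: \<phi>_def)
    qed
    thus ?thesis by simp
  qed
  have "closure {x. \<phi> x \<noteq> 0} \<subseteq> {a..b}"
    by (rule closure_minimal) (use \<phi>0 \<phi>1 in \<open>auto simp: not_less[symmetric]\<close>)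
  moreover have "\<phi> = (\<lambda>_. 0)" if "T \<le> 0" 
  proof -
    have "\<rho> = (\<lambda>_. 0)" using test_function_zero[OF \<rho>] that by force
    thus ?thesis by (intro ext) (simp add: \<phi>_def)
  qed
  ultimately have "\<phi> \<in> test_functions T"
    unfolding test_functions_iff using C ab by (cases "T \<le> 0") auto
  thus ?thesis by (rule that[OF _ d])
qed

text \<open>Integration by parts for a primitive of a function that is only integrable: exchange the
  order of integration on the triangle s < t; the inner integral of \<open>deriv \<phi>\<close> from
  s to T is \<open>- \<phi> s\<close>, since \<open>\<phi> T = 0\<close>.\<close>

lemma integral_time_triangle:
  assumes \<phi>: "\<phi> \<in> test_functions T" and g: "integrable (time T) g"
  shows "(LINT t|time T. deriv \<phi> t * (LINT s|time T. indicator {0<..<t} s * g s)) = - (LINT t|time T. \<phi> t * g t)"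
proof -
  have [measurable]: "g \<in> borel_measurable (time T)" using g by auto
  have [measurable]: "deriv \<phi> \<in> borel_measurable (time T)"
    by (rule borel_measurable_time[OF test_function_measurable[OF deriv_test_function[OF \<phi>]]])
  have [measurable]: "(\<lambda>t. t) \<in> borel_measurable (time T)" by (rule borel_measurable_time) simp
  obtain K where K: "K > 0" "\<And>x. \<bar>deriv \<phi> x\<bar> \<le> K"
    using test_function_bounded[OF deriv_test_function[OF \<phi>]] by metis
  define k where "k t s = deriv \<phi> t * (indicator {0<..<t} s * g s)" for t s
  have [measurable]: "(\<lambda>(t, s). k t s) \<in> borel_measurable (time T \<Otimes>\<^sub>M time T)"
    unfolding k_def indicator_def of_bool_def greaterThanLessThan_iff by measurable
  have "integrable (time T \<Otimes>\<^sub>M time T) (\<lambda>(t, s). K * g s)"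
  proof (rule time.Fubini_integrable)
    show "AE t in time T. integrable (time T) (\<lambda>s. case (t, s) of (t, s) \<Rightarrow> K * g s)" using g by simp
  qed simp_all
  hence "integrable (time T \<Otimes>\<^sub>M time T) (\<lambda>(t, s). k t s)"
    by (rule Bochner_Integration.integrable_bound)
      (use K in \<open>auto simp: k_def abs_mult indicator_def intro!: mult_right_mono AE_I2\<close>)
  from time.Fubini_integral[OF this]
  have "(LINT t|time T. LINT s|time T. k t s) = (LINT s|time T. LINT t|time T. k t s)" by simp
  also have "\<dots> = (LINT s|time T. - (\<phi> s * g s))"
  proof (rule Bochner_Integration.integral_cong)
    fix s assume "s \<in> space (time T)"
    hence s: "0 < s" "s < T" by auto
    have "(LINT t|time T. k t s) = (LINT t|time T. (indicator {s<..<T} t * deriv \<phi> t) * g s)"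
      by (rule Bochner_Integration.integral_cong) (use s in \<open>auto simp: k_def indicator_def\<close>)
    also have "\<dots> = (LINT t|time T. indicator {s<..<T} t * deriv \<phi> t) * g s" by simp
    also have "(LINT t|time T. indicator {s<..<T} t * deriv \<phi> t) = \<phi> T - \<phi> s"
      by (rule integral_time_FTC)
        (use s in \<open>auto intro: test_function_deriv[OF \<phi>] continuous_test_function[OF deriv_test_function[OF \<phi>]]\<close>)
    finally show "(LINT t|time T. k t s) = - (\<phi> s * g s)"
      using test_function_zero[OF \<phi>, of T] by simp
  qed simp
  finally show ?thesis by (simp add: k_def)
qed

text \<open>The difference \<open>E\<close> of \<open>F\<close> and the primitive of
  \<open>g\<close> is orthogonal to all derivatives of test functions. Subtracting from a test
  function its integral times a fixed normalized bump gives mean zero, hence such a derivative; so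
  \<open>E\<close> minus a constant is orthogonal to all test functions.\<close>

lemma du_Bois_Reymond:
  assumes F: "integrable (time T) F" and g: "integrable (time T) g" and "T > 0"
    and weak: "\<And>\<phi>. \<phi> \<in> test_functions T \<Longrightarrow> (LINT t|time T. deriv \<phi> t * F t) = - (LINT t|time T. \<phi> t * g t)"
  obtains c where "AE t in time T. F t = c + (LINT s|time T. indicator {0<..<t} s * g s)"
proof -
  define G where "G t = (LINT s|time T. indicator {0<..<t} s * g s)" for t
  have [measurable]: "g \<in> borel_measurable (time T)" using g by auto
  have [measurable]: "(\<lambda>t. t) \<in> borel_measurable (time T)" by (rule borel_measurable_time) simp
  have [measurable]: "G \<in> borel_measurable (time T)"
    unfolding G_def indicator_def of_bool_def greaterThanLessThan_iff by measurable
  have G: "integrable (time T) G"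
  proof (rule time.integrable_const_bound[where B = "LINT s|time T. \<bar>g s\<bar>"])
    show "AE t in time T. norm (G t) \<le> (LINT s|time T. \<bar>g s\<bar>)"
    proof (rule AE_I2)
      fix t
      have "norm (G t) \<le> (LINT s|time T. norm (indicator {0<..<t} s * g s))"
        unfolding G_def by (rule integral_norm_bound)
      also have "\<dots> \<le> (LINT s|time T. \<bar>g s\<bar>)"
        by (rule integral_mono') (use g in \<open>auto simp: indicator_def\<close>)
      finally show "norm (G t) \<le> (LINT s|time T. \<bar>g s\<bar>)" .
    qed
  qed simp
  define E where "E t = F t - G t" for t
  have E: "integrable (time T) E" unfolding E_def by (intro Bochner_Integration.integrable_diff F G)
  have mult: "integrable (time T) (\<lambda>t. \<phi> t * Z t)" if tst: "\<phi> \<in> test_functions T" "integrable (time T) Z" for \<phi> Z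
  proof -
    obtain K where K: "K > 0" "\<And>x. \<bar>\<phi> x\<bar> \<le> K" using test_function_bounded[OF tst(1)] by metis
    have "integrable (time T) (\<lambda>t. K * Z t)" using that(2) by simp
    thus ?thesis
    proof (rule Bochner_Integration.integrable_bound)
      show "(\<lambda>t. \<phi> t * Z t) \<in> borel_measurable (time T)"
        by (rule borel_measurable_times[OF borel_measurable_time[OF test_function_measurable[OF that(1)]]])
          (use that in auto)
      show "AE t in time T. norm (\<phi> t * Z t) \<le> norm (K * Z t)"
        using K by (auto simp: abs_mult intro!: mult_right_mono)
    qed
  qed
  have E0: "(LINT t|time T. deriv \<phi> t * E t) = 0" if "\<phi> \<in> test_functions T" for \<phi>
    using weak[OF that] integral_time_triangle[OF that g]
      mult[OF deriv_test_function[OF that] F] mult[OF deriv_test_function[OF that] G]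
    by (simp add: E_def G_def[symmetric] right_diff_distrib)
  have int\<phi>: "integrable (time T) \<phi>" if "\<phi> \<in> test_functions T" for \<phi>
    using mult[OF that, of "\<lambda>_. 1"] by simp
  define \<psi> where "\<psi> = bump (T/3) (2*T/3) 0"
  have \<psi>: "\<psi> \<in> test_functions T" unfolding \<psi>_def by (rule bump_test_function) (use \<open>T > 0\<close> in auto)
  have "(LINT t|time T. \<psi> t) \<noteq> 0"
  proof
    assume "(LINT t|time T. \<psi> t) = 0"
    hence "AE t in time T. \<psi> t = 0"
      using integral_nonneg_eq_0_iff_AE[OF int\<phi>[OF \<psi>]] bump_bounds by (simp add: \<psi>_def)
    hence "AE t in time T. t \<notin> {T/3<..<2*T/3}"
      by eventually_elim (use bump_nonzero[of "T/3" "2*T/3" 0] in \<open>auto simp: \<psi>_def\<close>)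
    hence "{T/3<..<2*T/3} \<in> null_sets (time T)"
      using \<open>T > 0\<close> by (subst AE_iff_null_sets) (auto simp: sets_restrict_space intro!: image_eqI[of _ _ "{T/3<..<2*T/3}"])
    thus False using \<open>T > 0\<close> open_not_negligible[of "{T/3<..<2*T/3}"]
      by (simp add: null_sets_restrict_space negligible_iff_null_sets[symmetric])
  qed
  define m where "m = (LINT t|time T. \<psi> t)"
  define c where "c = (LINT t|time T. \<psi> t * E t) / m"
  have "AE t in time T. E t - c = 0"
  proof (rule fundamental_lemma)
    show "integrable (time T) (\<lambda>t. E t - c)" using E by simp
    fix \<phi> assume \<phi>: "\<phi> \<in> test_functions T"
    define \<rho> where "\<rho> t = \<phi> t + (- (LINT t|time T. \<phi> t) / m) * \<psi> t" for t
    have \<rho>: "\<rho> \<in> test_functions T" unfolding \<rho>_def by (rule test_function_lincomb[OF \<phi> \<psi>])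
    have "(LINT t|time T. \<rho> t) = (LINT t|time T. \<phi> t) + (- (LINT t|time T. \<phi> t) / m) * m"
      unfolding \<rho>_def using int\<phi>[OF \<phi>] int\<phi>[OF \<psi>] by (simp add: m_def)
    hence "(LINT t|time T. \<rho> t) = 0" using \<open>(LINT t|time T. \<psi> t) \<noteq> 0\<close> by (simp add: m_def)
    then obtain \<theta> where "\<theta> \<in> test_functions T" "deriv \<theta> = \<rho>"
      using test_function_antiderivative[OF \<rho>] by blast
    hence "0 = (LINT t|time T. \<rho> t * E t)" using E0[of \<theta>] by simp
    also have "\<dots> = (LINT t|time T. \<phi> t * E t + (- (LINT t|time T. \<phi> t) / m) * (\<psi> t * E t))"
      by (simp add: \<rho>_def algebra_simps)
    also have "\<dots> = (LINT t|time T. \<phi> t * E t) + (- (LINT t|time T. \<phi> t) / m) * (LINT t|time T. \<psi> t * E t)"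
      using mult[OF \<phi> E] mult[OF \<psi> E] by simp
    also have "\<dots> = (LINT t|time T. \<phi> t * (E t - c))"
      using mult[OF \<phi> E] int\<phi>[OF \<phi>] by (simp add: right_diff_distrib c_def)
    finally show "(LINT t|time T. \<phi> t * (E t - c)) = 0" by simp
  qed
  hence "AE t in time T. F t = c + (LINT s|time T. indicator {0<..<t} s * g s)"
    by eventually_elim (simp add: E_def G_def)
  thus ?thesis by (rule that)
qed

section \<open>Translations of square integrable functions\<close>

lemma lborel_integral_shift:
  fixes f :: "real \<Rightarrow> 'a::{banach, second_countable_topology}"
  shows "(LINT t|lborel. f (t + h)) = (LINT t|lborel. f t)"
  using lborel_integral_real_affine[of 1 f h] by (simp add: add.commute)

lemma lborel_integrable_shift:
  fixes f :: "real \<Rightarrow> 'a::{banach, second_countable_topology}"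
  shows "integrable lborel (\<lambda>t. f (t + h)) \<longleftrightarrow> integrable lborel f"
  using lborel_integrable_real_affine_iff[of 1 f h] by (simp add: add.commute)

lemma AE_lborel_shift:
  fixes h :: real
  assumes "AE t in lborel. P t" shows "AE t in lborel. P (t + h)"
proof -
  have "AE t in distr lborel borel ((+) h). P t" using assms by (simp only: lborel_distr_plus)
  hence "AE t in lborel. P (h + t)" by (rule AE_distrD[rotated]) simp
  thus ?thesis by (simp add: add.commute)
qed


definition translation_L1 :: "(real \<Rightarrow> 'a::{banach, second_countable_topology}) \<Rightarrow> bool" where
  "translation_L1 f \<longleftrightarrow> (\<forall>h. h \<longlonglongrightarrow> 0 \<longrightarrow> (\<lambda>n. LINT t|lborel. norm (f (t + h n) - f t)) \<longlonglongrightarrow> 0)"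

text \<open>Translations are isometries of the L1 norm, so the distance to an approximating
  \<open>g\<close> is paid twice, independently of the shift.\<close>

lemma translation_L1_approx:
  fixes f :: "real \<Rightarrow> 'a::{banach, second_countable_topology}"
  assumes f: "integrable lborel f"
    and approx: "\<And>e. e > 0 \<Longrightarrow> \<exists>g. integrable lborel g \<and> translation_L1 g \<and> (LINT t|lborel. norm (f t - g t)) < e"
  shows "translation_L1 f"
  unfolding translation_L1_def
proof (intro allI impI LIMSEQ_I)
  fix h :: "nat \<Rightarrow> real" and e :: real assume h: "h \<longlonglongrightarrow> 0" and e: "e > 0"
  obtain g where g: "integrable lborel g" "translation_L1 g" "(LINT t|lborel. norm (f t - g t)) < e / 4"
    using approx[of "e/4"] e by auto
  obtain N where N: "\<And>n. n \<ge> N \<Longrightarrow> (LINT t|lborel. norm (g (t + h n) - g t)) < e / 4"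
    using LIMSEQ_D[of "\<lambda>n. LINT t|lborel. norm (g (t + h n) - g t)" 0 "e/4"] g(2) h e
    unfolding translation_L1_def by auto
  have "(LINT t|lborel. norm (f (t + h n) - f t)) < e" if n: "n \<ge> N" for n
  proof -
    note i = lborel_integrable_shift[of f "h n", THEN iffD2, OF f] lborel_integrable_shift[of g "h n", THEN iffD2, OF g(1)] f g(1)
    have "(LINT t|lborel. norm (f (t + h n) - f t))
      \<le> (LINT t|lborel. norm (f (t + h n) - g (t + h n)) + (norm (g (t + h n) - g t) + norm (f t - g t)))"
    proof (rule integral_mono)
      show "norm (f (t + h n) - f t) \<le> norm (f (t + h n) - g (t + h n)) + (norm (g (t + h n) - g t) + norm (f t - g t))" for t
        using norm_triangle_ineq4[of "f (t + h n) - g (t + h n)" "f t - g t - (g (t + h n) - g t)"]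
          norm_triangle_ineq4[of "f t - g t" "g (t + h n) - g t"] by (simp add: algebra_simps)
    qed (use i in auto)
    also have "\<dots> = (LINT t|lborel. norm (f (t + h n) - g (t + h n))) + ((LINT t|lborel. norm (g (t + h n) - g t)) + (LINT t|lborel. norm (f t - g t)))"
      using i by simp
    also have "(LINT t|lborel. norm (f (t + h n) - g (t + h n))) = (LINT t|lborel. norm (f t - g t))"
      by (rule lborel_integral_shift[of "\<lambda>t. norm (f t - g t)"])
    finally show ?thesis using g(3) N[OF n] e by simp
  qed
  thus "\<exists>no. \<forall>n\<ge>no. norm ((LINT t|lborel. norm (f (t + h n) - f t)) - 0) < e" by auto
qed

text \<open>By translation invariance the L1 distance is twice the measure of the points of
  \<open>U\<close> that the shift moves out of \<open>U\<close>. A point of an open set stays inside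
  under small shifts, and the indicator of \<open>U\<close> dominates.\<close>

lemma translation_L1_indicator_open:
  assumes U: "open U" "emeasure lborel U < \<infinity>"
  shows "translation_L1 (indicator U :: real \<Rightarrow> real)"
  unfolding translation_L1_def
proof (intro allI impI)
  fix h :: "nat \<Rightarrow> real" assume h: "h \<longlonglongrightarrow> 0"
  let ?u = "indicator U :: real \<Rightarrow> real"
  have [measurable]: "U \<in> sets borel" using U by simp
  have iU: "integrable lborel ?u" using U by (simp add: integrable_indicator_iff)
  have iUh: "integrable lborel (\<lambda>t. ?u (t + h n))" for n by (simp add: lborel_integrable_shift iU)
  have ip: "integrable lborel (\<lambda>t. ?u t * ?u (t + h n))" for n
    by (rule Bochner_Integration.integrable_bound[OF iU]) (auto simp: indicator_def)
  have "(LINT t|lborel. norm (?u (t + h n) - ?u t)) = 2 * (LINT t|lborel. ?u t * (1 - ?u (t + h n)))" for n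
  proof -
    have "(LINT t|lborel. norm (?u (t + h n) - ?u t)) = (LINT t|lborel. ?u (t + h n) + ?u t - 2 * (?u t * ?u (t + h n)))"
      by (rule Bochner_Integration.integral_cong) (auto simp: indicator_def)
    also have "\<dots> = (LINT t|lborel. ?u (t + h n)) + (LINT t|lborel. ?u t) - 2 * (LINT t|lborel. ?u t * ?u (t + h n))"
      using iU iUh ip by simp
    also have "(LINT t|lborel. ?u (t + h n)) = (LINT t|lborel. ?u t)" by (rule lborel_integral_shift)
    finally show ?thesis using iU ip by (simp add: right_diff_distrib)
  qed
  moreover have "(\<lambda>n. LINT t|lborel. ?u t * (1 - ?u (t + h n))) \<longlonglongrightarrow> (LINT t|(lborel :: real measure). 0)"
  proof (rule integral_dominated_convergence[where w = ?u])
    show "AE t in lborel. (\<lambda>n. ?u t * (1 - ?u (t + h n))) \<longlonglongrightarrow> 0"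
    proof (rule AE_I2)
      fix t
      show "(\<lambda>n. ?u t * (1 - ?u (t + h n))) \<longlonglongrightarrow> 0"
      proof (cases "t \<in> U")
        case True
        have "(\<lambda>n. t + h n) \<longlonglongrightarrow> t" using tendsto_add[OF tendsto_const[of t] h] by simp
        hence "\<forall>\<^sub>F n in sequentially. t + h n \<in> U" using U(1) True by (rule topological_tendstoD)
        hence "\<forall>\<^sub>F n in sequentially. ?u t * (1 - ?u (t + h n)) = 0" by eventually_elim simp
        thus ?thesis by (rule tendsto_eventually)
      qed simp
    qed
  qed (use iU in \<open>auto simp: indicator_def\<close>)
  ultimately show "(\<lambda>n. LINT t|lborel. norm (?u (t + h n) - ?u t)) \<longlonglongrightarrow> 0"
    using tendsto_mult_left[of _ 0 sequentially 2] by simp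
qed

lemma translation_L1_scaleR_const:
  fixes u :: "real \<Rightarrow> real"
  assumes "translation_L1 u" shows "translation_L1 (\<lambda>t. u t *\<^sub>R c)"
  unfolding translation_L1_def
proof (intro allI impI)
  fix h :: "nat \<Rightarrow> real" assume "h \<longlonglongrightarrow> 0"
  hence "(\<lambda>n. (LINT t|lborel. norm (u (t + h n) - u t)) * norm c) \<longlonglongrightarrow> 0 * norm c"
    using assms unfolding translation_L1_def by (intro tendsto_mult_right) blast
  thus "(\<lambda>n. LINT t|lborel. norm (u (t + h n) *\<^sub>R c - u t *\<^sub>R c)) \<longlonglongrightarrow> 0"
    by (simp flip: scaleR_left_diff_distrib)
qed

text \<open>Induction over integrable functions. The base case reduces Borel sets of finite measure
  to open sets by outer regularity.\<close>

lemma translation_L1: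
  fixes f :: "real \<Rightarrow> 'a::{banach, second_countable_topology}"
  assumes "integrable lborel f" shows "translation_L1 f"
  using assms
proof (induction f rule: integrable_induct)
  case (base A c)
  hence A: "A \<in> sets borel" "emeasure lborel A < \<infinity>" by auto
  have iA: "integrable lborel (indicator A :: real \<Rightarrow> real)" using A by (simp add: integrable_indicator_iff)
  have "translation_L1 (indicator A :: real \<Rightarrow> real)"
  proof (rule translation_L1_approx[OF iA])
    fix e :: real assume "e > 0"
    obtain U where U: "open U" "A \<subseteq> U" "(U - A) \<in> lmeasurable" "emeasure lebesgue (U - A) < ennreal e"
      using sets_lebesgue_outer_open[of A e] A(1) \<open>e > 0\<close> by (metis sets_completionI_sets sets_lborel)
    have [measurable]: "U \<in> sets borel" using U by simp
    have UA: "emeasure lborel (U - A) < ennreal e" using U(4) A(1) by (simp add: emeasure_completion)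
    have "emeasure lborel U = emeasure lborel A + emeasure lborel (U - A)"
      using U(2) A(1) by (subst plus_emeasure) (auto intro: arg_cong)
    also have "\<dots> < \<infinity>" using A(2) UA by (auto simp: less_top[symmetric] intro: less_trans)
    finally have Uf: "emeasure lborel U < \<infinity>" .
    have "(LINT t|lborel. norm (indicator A t - indicator U t :: real)) = (LINT t|lborel. indicator (U - A) t)"
      by (rule Bochner_Integration.integral_cong) (use U(2) in \<open>auto simp: indicator_def\<close>)
    also have "\<dots> = measure lborel (U - A)" by simp
    also have "\<dots> < e"
    proof -
      have "emeasure lborel (U - A) \<noteq> top" using UA by (auto simp: top_unique)
      thus ?thesis
        using UA \<open>e > 0\<close> emeasure_eq_ennreal_measure[of lborel "U - A"] by (auto simp: ennreal_less_iff)
    qed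
    finally show "\<exists>g. integrable lborel g \<and> translation_L1 g \<and> (LINT t|lborel. norm (indicator A t - g t :: real)) < e"
      using translation_L1_indicator_open[OF U(1) Uf] Uf
      by (intro exI[of _ "indicator U"]) (auto simp: integrable_indicator_iff)
  qed
  thus ?case by (rule translation_L1_scaleR_const)
next
  case (add f g)
  show ?case unfolding translation_L1_def
  proof (intro allI impI)
    fix h :: "nat \<Rightarrow> real" assume h: "h \<longlonglongrightarrow> 0"
    have i: "integrable lborel (\<lambda>t. f (t + h n))" "integrable lborel (\<lambda>t. g (t + h n))" for n
      using add.hyps by (auto simp: lborel_integrable_shift[of f] lborel_integrable_shift[of g])
    show "(\<lambda>n. LINT t|lborel. norm (f (t + h n) + g (t + h n) - (f t + g t))) \<longlonglongrightarrow> 0"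
    proof (rule tendsto_sandwich[of "\<lambda>_. 0"])
      show "\<forall>\<^sub>F n in sequentially. (LINT t|lborel. norm (f (t + h n) + g (t + h n) - (f t + g t)))
          \<le> (LINT t|lborel. norm (f (t + h n) - f t)) + (LINT t|lborel. norm (g (t + h n) - g t))"
      proof (intro always_eventually allI)
        fix n
        have "(LINT t|lborel. norm (f (t + h n) + g (t + h n) - (f t + g t)))
          \<le> (LINT t|lborel. norm (f (t + h n) - f t) + norm (g (t + h n) - g t))"
        proof (rule integral_mono)
          show "norm (f (t + h n) + g (t + h n) - (f t + g t)) \<le> norm (f (t + h n) - f t) + norm (g (t + h n) - g t)" for t
            using norm_triangle_ineq[of "f (t + h n) - f t" "g (t + h n) - g t"] by (simp add: algebra_simps)
        qed (use i[of n] add.hyps in auto)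
        also have "\<dots> = (LINT t|lborel. norm (f (t + h n) - f t)) + (LINT t|lborel. norm (g (t + h n) - g t))"
          using i[of n] add.hyps by simp
        finally show "(LINT t|lborel. norm (f (t + h n) + g (t + h n) - (f t + g t)))
          \<le> (LINT t|lborel. norm (f (t + h n) - f t)) + (LINT t|lborel. norm (g (t + h n) - g t))" .
      qed
      show "(\<lambda>n. (LINT t|lborel. norm (f (t + h n) - f t)) + (LINT t|lborel. norm (g (t + h n) - g t))) \<longlonglongrightarrow> 0"
        using tendsto_add[of _ 0 _ _ 0] add.IH h unfolding translation_L1_def by fastforce
    qed auto
  qed
next
  case (lim f s)
  show ?case
  proof (rule translation_L1_approx[OF lim.hyps(4)])
    fix e :: real assume e: "e > 0"
    have "(\<lambda>i. LINT t|lborel. norm (f t - s i t)) \<longlonglongrightarrow> (LINT t|(lborel :: real measure). 0)"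
    proof (rule integral_dominated_convergence[where w = "\<lambda>t. 3 * norm (f t)"])
      show "AE t in lborel. (\<lambda>i. norm (f t - s i t)) \<longlonglongrightarrow> 0"
      proof (rule AE_I2)
        fix t :: real assume "t \<in> space lborel"
        from tendsto_norm[OF tendsto_diff[OF tendsto_const lim.hyps(2)[OF this]], of "f t"]
        show "(\<lambda>i. norm (f t - s i t)) \<longlonglongrightarrow> 0" by simp
      qed
      have "norm (f t - s i t) \<le> 3 * norm (f t)" for t i
        using lim.hyps(3)[of t i] norm_triangle_ineq4[of "f t" "s i t"] by simp
      thus "AE t in lborel. norm (norm (f t - s i t)) \<le> 3 * norm (f t)" for i by simp
      show "(\<lambda>t. norm (f t - s i t)) \<in> borel_measurable lborel" for i
        using lim.hyps(1)[of i] lim.hyps(4) by auto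
    qed (use lim.hyps(4) in auto)
    hence "\<forall>\<^sub>F i in sequentially. (LINT t|lborel. norm (f t - s i t)) < e"
      using e by (intro order_tendstoD(2)) auto
    then obtain i where "(LINT t|lborel. norm (f t - s i t)) < e" by (auto simp: eventually_sequentially)
    thus "\<exists>g. integrable lborel g \<and> translation_L1 g \<and> (LINT t|lborel. norm (f t - g t)) < e"
      using lim.hyps(1) lim.IH by blast
  qed
qed

lemma Lsq_shift:
  fixes f :: "real \<Rightarrow> 'a::{real_normed_vector, second_countable_topology}"
  assumes "f \<in> Lsq lborel"
  shows "(\<lambda>t. f (t + h)) \<in> Lsq lborel" "nsq lborel (\<lambda>t. f (t + h)) = nsq lborel f"
proof -
  have [measurable]: "f \<in> borel_measurable borel" using Lsq_measurable[OF assms] by simp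
  show "(\<lambda>t. f (t + h)) \<in> Lsq lborel"
    by (rule LsqI) (use lborel_integrable_shift[of "\<lambda>t. (norm (f t))\<^sup>2" h] Lsq_integrable[OF assms] in auto)
  show "nsq lborel (\<lambda>t. f (t + h)) = nsq lborel f"
    unfolding nsq_def by (rule lborel_integral_shift[of "\<lambda>t. (norm (f t))\<^sup>2"])
qed

text \<open>Truncation at height \<open>k\<close> changes \<open>f\<close> little in the square
  mean, and for a function bounded by \<open>k\<close> the squared L2 distance to a translate is at
  most \<open>2 * k\<close> times the L1 distance.\<close>

lemma translation_Lsq:
  fixes f :: "real \<Rightarrow> 'a::{banach, second_countable_topology}"
  assumes f: "f \<in> Lsq lborel" and f1: "integrable lborel f" and h: "h \<longlonglongrightarrow> 0"
  shows "(\<lambda>n. sqrt (nsq lborel (\<lambda>t. f (t + h n) - f t))) \<longlonglongrightarrow> 0"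
proof (rule LIMSEQ_I)
  fix e :: real assume e: "e > 0"
  have [measurable]: "f \<in> borel_measurable borel" using Lsq_measurable[OF f] by simp
  define F where "F k t = (if norm (f t) \<le> real k then f t else 0)" for k t
  have [measurable]: "F k \<in> borel_measurable borel" for k unfolding F_def by measurable
  have F: "F k \<in> Lsq lborel" for k by (rule Lsq_bound(1)[OF f, of _ 1]) (auto simp: F_def)
  have F1: "integrable lborel (F k)" for k
    by (rule Bochner_Integration.integrable_bound[OF f1]) (auto simp: F_def)
  have "(\<lambda>k. nsq lborel (\<lambda>t. f t - F k t)) \<longlonglongrightarrow> (LINT t|(lborel :: real measure). 0)"
    unfolding nsq_def
  proof (rule integral_dominated_convergence[where w = "\<lambda>t. (norm (f t))\<^sup>2"])
    show "AE t in lborel. (\<lambda>k. (norm (f t - F k t))\<^sup>2) \<longlonglongrightarrow> 0"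
    proof (rule AE_I2)
      fix t
      obtain K where "norm (f t) \<le> real K" using real_arch_simple by blast
      hence "\<forall>\<^sub>F k in sequentially. (norm (f t - F k t))\<^sup>2 = 0"
        by (intro eventually_sequentiallyI[of K]) (auto simp: F_def)
      thus "(\<lambda>k. (norm (f t - F k t))\<^sup>2) \<longlonglongrightarrow> 0" by (rule tendsto_eventually)
    qed
  qed (use Lsq_integrable[OF f] in \<open>auto simp: F_def\<close>)
  hence "(\<lambda>k. sqrt (nsq lborel (\<lambda>t. f t - F k t))) \<longlonglongrightarrow> 0" using tendsto_real_sqrt by fastforce
  hence "\<forall>\<^sub>F k in sequentially. sqrt (nsq lborel (\<lambda>t. f t - F k t)) < e / 4"
    using e by (intro order_tendstoD(2)) auto
  then obtain k where k: "sqrt (nsq lborel (\<lambda>t. f t - F k t)) < e / 4" by (auto simp: eventually_sequentially)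
  have "(\<lambda>n. 2 * real k * (LINT t|lborel. norm (F k (t + h n) - F k t))) \<longlonglongrightarrow> 2 * real k * 0"
    using translation_L1[OF F1[of k]] h unfolding translation_L1_def by (intro tendsto_mult_left) blast
  hence "\<forall>\<^sub>F n in sequentially. 2 * real k * (LINT t|lborel. norm (F k (t + h n) - F k t)) < (e / 4)\<^sup>2"
    using e by (intro order_tendstoD(2)) auto
  then obtain N where N: "\<And>n. n \<ge> N \<Longrightarrow> 2 * real k * (LINT t|lborel. norm (F k (t + h n) - F k t)) < (e / 4)\<^sup>2"
    by (auto simp: eventually_sequentially)
  have "sqrt (nsq lborel (\<lambda>t. f (t + h n) - f t)) < e" if n: "n \<ge> N" for n
  proof -
    have Fd: "(\<lambda>t. F k (t + h n) - F k t) \<in> Lsq lborel" by (intro Lsq_diff Lsq_shift F)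
    have d: "(\<lambda>t. f t - F k t) \<in> Lsq lborel" by (intro Lsq_diff f F)
    have "nsq lborel (\<lambda>t. F k (t + h n) - F k t) \<le> (LINT t|lborel. 2 * real k * norm (F k (t + h n) - F k t))"
      unfolding nsq_def
    proof (rule integral_mono)
      show "integrable lborel (\<lambda>t. 2 * real k * norm (F k (t + h n) - F k t))"
        using F1[of k] lborel_integrable_shift[of "F k" "h n"] by simp
      have "norm (F k t) \<le> real k" for t by (simp add: F_def)
      from add_mono[OF this this] have "norm (F k (t + h n) - F k t) \<le> 2 * real k" for t
        using norm_triangle_ineq4[of "F k (t + h n)" "F k t"] order_trans by fastforce
      thus "(norm (F k (t + h n) - F k t))\<^sup>2 \<le> 2 * real k * norm (F k (t + h n) - F k t)" for t
        by (simp add: power2_eq_square mult_right_mono)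
    qed (rule Lsq_integrable[OF Fd])
    also have "\<dots> < (e/4)\<^sup>2" using N[OF n] by simp
    finally have 1: "sqrt (nsq lborel (\<lambda>t. F k (t + h n) - F k t)) < e / 4"
      using e by (intro power2_less_imp_less[of _ "e / 4"]) auto
    have "(\<lambda>t. f (t + h n) - f t) = (\<lambda>t. (f (t + h n) - F k (t + h n)) + ((F k (t + h n) - F k t) + (-1) *\<^sub>R (f t - F k t)))"
      by (simp add: fun_eq_iff)
    hence "sqrt (nsq lborel (\<lambda>t. f (t + h n) - f t)) \<le> sqrt (nsq lborel (\<lambda>t. f (t + h n) - F k (t + h n)))
        + (sqrt (nsq lborel (\<lambda>t. F k (t + h n) - F k t)) + sqrt (nsq lborel (\<lambda>t. (-1) *\<^sub>R (f t - F k t))))"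
      using nsq_triangle[OF Lsq_shift(1)[OF d, of "h n"] Lsq_add[OF Fd Lsq_scaleR(1)[OF d, of "-1"]]]
        nsq_triangle[OF Fd Lsq_scaleR(1)[OF d, of "-1"]] by simp
    also have "\<dots> < e"
      using 1 k Lsq_shift(2)[OF d, of "h n"] Lsq_scaleR(2)[OF d, of "-1"] e by simp
    finally show ?thesis .
  qed
  thus "\<exists>no. \<forall>n\<ge>no. norm (sqrt (nsq lborel (\<lambda>t. f (t + h n) - f t)) - 0) < e" by auto
qed

section \<open>Borel representatives on the line\<close>

lemma integrable_completion_representative:
  fixes f :: "'t \<Rightarrow> 'a::{banach, second_countable_topology}"
  assumes "integrable (completion M) f"
  shows "\<exists>g\<in>borel_measurable M. AE t in M. f t = g t"
  using assms
proof (induction f rule: integrable_induct)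
  case (base A c)
  have "AE t in M. t \<in> A \<longleftrightarrow> t \<in> main_part M A"
  proof -
    obtain N where N: "N \<in> null_sets M" "null_part M A \<subseteq> N" using null_part[OF base(1)] by blast
    have "A = main_part M A \<union> null_part M A" using base(1) by simp
    thus ?thesis using AE_not_in[OF N(1)] N(2) by (auto elim!: eventually_mono)
  qed
  hence "AE t in M. indicator A t *\<^sub>R c = indicator (main_part M A) t *\<^sub>R c"
    by eventually_elim (simp add: indicator_def)
  moreover have "(\<lambda>t. indicator (main_part M A) t *\<^sub>R c) \<in> borel_measurable M" 
    using base(1) by (intro borel_measurable_scaleR borel_measurable_indicator) auto
  ultimately show ?case by (intro bexI)
next
  case (add f g)
  then obtain f' g' where "f' \<in> borel_measurable M" "g' \<in> borel_measurable M"
    "AE t in M. f t = f' t" "AE t in M. g t = g' t" by blast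
  thus ?case by (intro bexI[of _ "\<lambda>t. f' t + g' t"]) auto
next
  case (lim f s)
  then obtain s' where s': "\<And>i. s' i \<in> borel_measurable M" "\<And>i. AE t in M. s i t = s' i t" by metis
  have [measurable]: "s' i \<in> borel_measurable M" for i by (rule s')
  have "AE t in M. \<forall>i. s i t = s' i t" using s'(2) by (simp add: AE_all_countable)
  hence "AE t in M. f t = lim (\<lambda>i. s' i t)"
  proof (rule AE_mp, intro AE_I2 impI)
    fix t assume t: "t \<in> space M" "\<forall>i. s i t = s' i t"
    hence "(\<lambda>i. s' i t) \<longlonglongrightarrow> f t" using lim.hyps(2)[of t] by simp
    thus "f t = lim (\<lambda>i. s' i t)" by (simp add: limI)
  qed
  moreover have "(\<lambda>t. lim (\<lambda>i. s' i t)) \<in> borel_measurable M" by measurable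
  ultimately show ?case by (intro bexI)
qed

text \<open>Extension by zero to a Borel function on the line, to which shifts and affine
  substitutions apply. It is integrable as well because the interval is bounded.\<close>

lemma Lsq_time_representative:
  fixes f :: "real \<Rightarrow> 'a::{banach, second_countable_topology}"
  assumes f: "f \<in> Lsq (time T)"
  obtains F where "F \<in> Lsq lborel" "integrable lborel F" "\<And>t. t \<notin> {0<..<T} \<Longrightarrow> F t = 0"
    "AE t in lborel. t \<in> {0<..<T} \<longrightarrow> f t = F t"
proof -
  have "integrable lebesgue (\<lambda>t. indicator {0<..<T} t *\<^sub>R f t)"
    using time.Lsq_integrable1[OF f] by (simp add: integrable_restrict_space)
  from integrable_completion_representative[OF this]
  obtain g where [measurable]: "g \<in> borel_measurable borel" and g: "AE t in lborel. indicator {0<..<T} t *\<^sub>R f t = g t"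
    by auto
  define F where "F t = indicator {0<..<T} t *\<^sub>R g t" for t
  have [measurable]: "F \<in> borel_measurable borel" unfolding F_def by measurable
  have ae: "AE t in lborel. t \<in> {0<..<T} \<longrightarrow> f t = F t"
    using g by eventually_elim (auto simp: F_def indicator_def)
  have "AE t in lebesgue. t \<in> {0<..<T} \<longrightarrow> f t = F t" using ae by (rule AE_completion)
  hence aeT: "AE t in time T. F t = f t" by (auto simp: AE_restrict_space_iff elim: eventually_mono)
  have "F \<in> Lsq (time T)" by (rule Lsq_cong_AE(1)[OF borel_measurable_time f aeT]) simp
  note F = Lsq_integrable[OF this] time.Lsq_integrable1[OF this]
  have e: "indicator {0<..<T} t *\<^sub>R (norm (F t))\<^sup>2 = (norm (F t))\<^sup>2" "indicator {0<..<T} t *\<^sub>R F t = F t" for t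
    by (auto simp: F_def indicator_def)
  show ?thesis
  proof (rule that)
    show "F \<in> Lsq lborel"
      using F(1) by (intro LsqI) (simp_all add: integral_time_lborel(2) e[unfolded real_scaleR_def])
    show "integrable lborel F" using F(2) by (simp add: integral_time_lborel(2) e)
  qed (use ae in \<open>auto simp: F_def\<close>)
qed

section \<open>Continuous representatives and the energy identity\<close>

text \<open>The weak derivative with the functional replaced by its Riesz representer
  \<open>d\<close>. It is a relation and not a choice, so that a concrete candidate can be verified
  and compared with the chosen derivative afterwards.\<close>

definition vderiv ::
  "('v::real_inner \<Rightarrow>\<^sub>L 'h::real_inner) \<Rightarrow> real \<Rightarrow> 'v set \<Rightarrow> (real \<Rightarrow> 'v) \<Rightarrow> (real \<Rightarrow> 'v) \<Rightarrow> bool" where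
  "vderiv \<iota> T S y d \<longleftrightarrow> y \<in> Lsq (time T) \<and> d \<in> Lsq (time T) \<and>
     (\<forall>\<phi>\<in>test_functions T. \<forall>v\<in>S.
        (LINT t|time T. deriv \<phi> t * (\<iota> (y t) \<bullet> \<iota> v)) = - (LINT t|time T. \<phi> t * (d t \<bullet> v)))"

definition prim :: "real \<Rightarrow> (real \<Rightarrow> 'a::{banach, second_countable_topology}) \<Rightarrow> real \<Rightarrow> 'a" where
  "prim T d t = (LINT s|time T. indicator {0<..<t} s *\<^sub>R d s)"

lemma time_indicator_integrable:
  fixes d :: "real \<Rightarrow> 'a::{banach, second_countable_topology}"
  assumes "integrable (time T) d"
  shows "integrable (time T) (\<lambda>s. indicator {a<..<b} s *\<^sub>R d s)"
proof (rule Bochner_Integration.integrable_bound[OF assms])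
  show "(\<lambda>s. indicator {a<..<b} s *\<^sub>R d s) \<in> borel_measurable (time T)"
    by (intro borel_measurable_scaleR borel_measurable_time[of "indicator {a<..<b}"] borel_measurable_integrable[OF assms]) simp
qed (auto simp: indicator_def)

lemma AE_time_neq: "AE t in time T. t \<noteq> c"
  using AE_completion[OF AE_lborel_singleton[of c]] by (auto simp: AE_restrict_space_iff elim: eventually_mono)

lemma prim_diff:
  assumes d: "integrable (time T) d" and st: "0 \<le> s" "s \<le> t"
  shows "prim T d t - prim T d s = (LINT r|time T. indicator {s<..<t} r *\<^sub>R d r)"
proof -
  note i = time_indicator_integrable[OF d]
  have "prim T d t - prim T d s = (LINT r|time T. indicator {0<..<t} r *\<^sub>R d r - indicator {0<..<s} r *\<^sub>R d r)"
    unfolding prim_def using i by simp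
  also have "\<dots> = (LINT r|time T. indicator {s<..<t} r *\<^sub>R d r)"
  proof (rule integral_cong_AE)
    show "AE r in time T. indicator {0<..<t} r *\<^sub>R d r - indicator {0<..<s} r *\<^sub>R d r = indicator {s<..<t} r *\<^sub>R d r"
      using AE_time_neq[of s] by eventually_elim (use st in \<open>auto simp: indicator_def\<close>)
  qed (use i in \<open>auto intro: borel_measurable_integrable\<close>)
  finally show ?thesis .
qed

lemma continuous_on_prim:
  assumes d: "integrable (time T) d" shows "continuous_on A (prim T d)"
  unfolding continuous_on_sequentially
proof (intro allI ballI impI)
  fix x :: "nat \<Rightarrow> real" and a assume "a \<in> A" "(\<forall>n. x n \<in> A) \<and> x \<longlonglongrightarrow> a"
  hence x: "x \<longlonglongrightarrow> a" by simp
  show "(prim T d \<circ> x) \<longlonglongrightarrow> prim T d a"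
    unfolding prim_def o_def
  proof (rule integral_dominated_convergence[where w = "\<lambda>t. norm (d t)"])
    show "AE t in time T. (\<lambda>n. indicator {0<..<x n} t *\<^sub>R d t) \<longlonglongrightarrow> indicator {0<..<a} t *\<^sub>R d t"
      using AE_time_neq[of a]
    proof eventually_elim
      case (elim t)
      have "\<forall>\<^sub>F n in sequentially. indicator {0<..<x n} t = (indicator {0<..<a} t :: real)"
      proof (cases "t < a")
        case True
        hence "\<forall>\<^sub>F n in sequentially. t < x n" using x by (intro order_tendstoD) auto
        thus ?thesis by eventually_elim (use True in \<open>auto simp: indicator_def\<close>)
      next
        case False
        hence "\<forall>\<^sub>F n in sequentially. x n < t" using x elim by (intro order_tendstoD) auto
        thus ?thesis by eventually_elim (use False in \<open>auto simp: indicator_def\<close>)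
      qed
      thus ?case by (intro tendsto_eventually) (auto elim: eventually_mono)
    qed
  qed (use d time_indicator_integrable[OF d] in \<open>auto simp: indicator_def intro: borel_measurable_integrable\<close>)
qed

text \<open>Du Bois-Reymond applies to each \<open>v\<close> separately, with an exceptional null
  set depending on \<open>v\<close>; a countable dense set of test vectors gives a common set
  \<open>G\<close>. Taking differences removes the unknown constants, after which both sides are
  continuous in \<open>v\<close>.\<close>

lemma vderiv_increments:
  fixes y d :: "real \<Rightarrow> 'v::{real_inner, banach, second_countable_topology}"
    and \<iota> :: "'v \<Rightarrow>\<^sub>L 'h::{real_inner, banach, second_countable_topology}"
  assumes "T > 0" and y: "vderiv \<iota> T UNIV y d"
  obtains G where "G \<subseteq> {0<..<T}" "AE t in time T. t \<in> G"
    "\<And>s t v. s \<in> G \<Longrightarrow> t \<in> G \<Longrightarrow> (\<iota> (y t) - \<iota> (y s)) \<bullet> \<iota> v = (prim T d t - prim T d s) \<bullet> v"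
proof -
  have yL: "y \<in> Lsq (time T)" and dL: "d \<in> Lsq (time T)"
    and w: "\<And>\<phi> v. \<phi> \<in> test_functions T \<Longrightarrow>
      (LINT t|time T. deriv \<phi> t * (\<iota> (y t) \<bullet> \<iota> v)) = - (LINT t|time T. \<phi> t * (d t \<bullet> v))"
    using y by (auto simp: vderiv_def)
  have d1: "integrable (time T) d" by (rule time.Lsq_integrable1[OF dL])
  have iy: "integrable (time T) (\<lambda>t. \<iota> (y t))" by (rule time.Lsq_integrable1[OF Lsq_blinfun(1)[OF yL]])
  obtain D :: "'v set" where D: "countable D" "\<And>X. open X \<Longrightarrow> X \<noteq> {} \<Longrightarrow> \<exists>d\<in>D. d \<in> X"
    using countable_dense_setE by blast
  have "\<exists>c. AE t in time T. \<iota> (y t) \<bullet> \<iota> v = c + prim T d t \<bullet> v" for v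
  proof -
    obtain c where "AE t in time T. \<iota> (y t) \<bullet> \<iota> v = c + (LINT s|time T. indicator {0<..<t} s * (d s \<bullet> v))"
      by (rule du_Bois_Reymond[OF _ _ \<open>T > 0\<close> w[of _ v]]) (use iy d1 in auto)
    moreover have "(LINT s|time T. indicator {0<..<t} s * (d s \<bullet> v)) = prim T d t \<bullet> v" for t
      unfolding prim_def using time_indicator_integrable[OF d1, of 0 t]
      by (subst integral_inner_left[symmetric]) auto
    ultimately show ?thesis by auto
  qed
  then obtain c where "\<And>v. AE t in time T. \<iota> (y t) \<bullet> \<iota> v = c v + prim T d t \<bullet> v" by metis
  hence ae: "AE t in time T. \<forall>v\<in>D. \<iota> (y t) \<bullet> \<iota> v = c v + prim T d t \<bullet> v"
    using D(1) by (simp add: AE_ball_countable)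
  define G where "G = {t \<in> {0<..<T}. \<forall>v\<in>D. \<iota> (y t) \<bullet> \<iota> v = c v + prim T d t \<bullet> v}"
  show ?thesis
  proof (rule that[of G])
    show "AE t in time T. t \<in> G" using ae AE_space by eventually_elim (auto simp: G_def)
    fix s t v assume st: "s \<in> G" "t \<in> G"
    define E where "E = {v. (\<iota> (y t) - \<iota> (y s)) \<bullet> \<iota> v = (prim T d t - prim T d s) \<bullet> v}"
    have "closed E" unfolding E_def
      by (intro closed_Collect_eq continuous_intros linear_continuous_on blinfun.bounded_linear_right)
    moreover have "D \<subseteq> E" using st by (auto simp: E_def G_def inner_diff_left)
    moreover have "v \<in> closure D" using D(2) by (auto simp: closure_iff_nhds_not_empty)
    ultimately show "(\<iota> (y t) - \<iota> (y s)) \<bullet> \<iota> v = (prim T d t - prim T d s) \<bullet> v"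
      using closure_minimal[of D E] by (auto simp: E_def)
  qed (auto simp: G_def)
qed


lemma integral_weighted_inner:
  fixes X Z :: "'t \<Rightarrow> 'a::{real_inner, second_countable_topology}"
  assumes \<phi>: "\<phi> \<in> borel_measurable M" "\<And>t. \<bar>\<phi> t\<bar> \<le> K" and X: "X \<in> Lsq M" and Z: "Z \<in> Lsq M"
  shows "integrable M (\<lambda>t. \<phi> t * (X t \<bullet> Z t))"
    "\<bar>LINT t|M. \<phi> t * (X t \<bullet> Z t)\<bar> \<le> K * sqrt (nsq M X) * sqrt (nsq M Z)"
proof -
  have K: "K \<ge> 0" using \<phi>(2)[of undefined] by linarith
  have m: "(\<lambda>t. \<phi> t *\<^sub>R X t) \<in> borel_measurable M"
    by (intro borel_measurable_scaleR \<phi> Lsq_measurable[OF X])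
  have "AE t in M. norm (\<phi> t *\<^sub>R X t) \<le> K * norm (X t)"
    using \<phi>(2) by (auto intro!: mult_right_mono)
  note b = Lsq_bound[OF X m this]
  show "integrable M (\<lambda>t. \<phi> t * (X t \<bullet> Z t))"
    using integrable_inner_Lsq[OF b(1) Z] by simp
  have "\<bar>LINT t|M. \<phi> t * (X t \<bullet> Z t)\<bar> \<le> sqrt (nsq M (\<lambda>t. \<phi> t *\<^sub>R X t)) * sqrt (nsq M Z)"
    using integral_inner_Lsq_le[OF b(1) Z] by simp
  also have "sqrt (nsq M (\<lambda>t. \<phi> t *\<^sub>R X t)) \<le> K * sqrt (nsq M X)"
    using real_sqrt_le_mono[OF b(2)] K by (simp add: real_sqrt_mult)
  finally show "\<bar>LINT t|M. \<phi> t * (X t \<bullet> Z t)\<bar> \<le> K * sqrt (nsq M X) * sqrt (nsq M Z)"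
    by (simp add: mult_right_mono)
qed

text \<open>Difference quotients: test the increments \<open>y(t + h) - y(t)\<close> with \<open>y(t) + y(t + h)\<close> and let
  \<open>h\<close> tend to \<open>0\<close>; translations are continuous in the square mean.\<close>

lemma energy_weak_deriv:
  fixes y d :: "real \<Rightarrow> 'v::{real_inner, banach, second_countable_topology}"
    and \<iota> :: "'v \<Rightarrow>\<^sub>L 'h::{real_inner, banach, second_countable_topology}"
  assumes "T > 0" and y: "vderiv \<iota> T UNIV y d" and \<phi>: "\<phi> \<in> test_functions T"
  shows "(LINT t|time T. deriv \<phi> t * (\<iota> (y t) \<bullet> \<iota> (y t))) = - (LINT t|time T. \<phi> t * (2 * (d t \<bullet> y t)))"
proof -
  have yL: "y \<in> Lsq (time T)" and dL: "d \<in> Lsq (time T)" using y by (auto simp: vderiv_def)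
  have d1: "integrable (time T) d" by (rule time.Lsq_integrable1[OF dL])
  obtain G where G: "G \<subseteq> {0<..<T}" "AE t in time T. t \<in> G"
    and incr: "\<And>s t v. s \<in> G \<Longrightarrow> t \<in> G \<Longrightarrow> (\<iota> (y t) - \<iota> (y s)) \<bullet> \<iota> v = (prim T d t - prim T d s) \<bullet> v"
    using vderiv_increments[OF \<open>T > 0\<close> y] by metis
  \<comment> \<open>Shifted arguments may leave the interval; the zero extensions \<open>Y\<close>
    and \<open>D\<close> make all shifts meaningful.\<close>
  obtain Y where Y: "Y \<in> Lsq lborel" "integrable lborel Y" "\<And>t. t \<notin> {0<..<T} \<Longrightarrow> Y t = 0"
    and yY: "AE t in lborel. t \<in> {0<..<T} \<longrightarrow> y t = Y t" using Lsq_time_representative[OF yL] by metis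
  obtain D where D: "D \<in> Lsq lborel" "integrable lborel D" "\<And>t. t \<notin> {0<..<T} \<Longrightarrow> D t = 0"
    and dD: "AE t in lborel. t \<in> {0<..<T} \<longrightarrow> d t = D t" using Lsq_time_representative[OF dL] by metis
  have [measurable]: "Y \<in> borel_measurable borel" "D \<in> borel_measurable borel"
    using Y(1) D(1) by (auto dest: Lsq_measurable)
  have [measurable]: "\<phi> \<in> borel_measurable borel" "deriv \<phi> \<in> borel_measurable borel"
    using \<phi> by (auto intro: test_function_measurable deriv_test_function)
  have \<iota>m [measurable]: "blinfun_apply \<iota> \<in> borel_measurable borel"
    by (intro borel_measurable_continuous_onI linear_continuous_on blinfun.bounded_linear_right)
  obtain K where K: "K > 0" "\<And>x. \<bar>\<phi> x\<bar> \<le> K" using test_function_bounded[OF \<phi>] by metis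
  obtain K' where K': "K' > 0" "\<And>x. \<bar>deriv \<phi> x\<bar> \<le> K'"
    using test_function_bounded[OF deriv_test_function[OF \<phi>]] by metis
  obtain a b where ab: "0 < a" "a \<le> b" "b < T" "\<And>x. x \<notin> {a..b} \<Longrightarrow> \<phi> x = 0"
    using test_function_support[OF \<phi>] \<open>T > 0\<close> by (metis not_less)
  define f where "f t = \<iota> (Y t) \<bullet> \<iota> (Y t)" for t
  have [measurable]: "f \<in> borel_measurable borel" unfolding f_def by measurable
  have f1: "integrable lborel f" unfolding f_def
    by (intro integrable_inner_Lsq Lsq_blinfun(1) Y)
  have fG: "AE t in lborel. t \<in> {0<..<T} \<longrightarrow> t \<in> G \<and> y t = Y t"
  proof -
    have "AE t in lebesgue. t \<in> {0<..<T} \<longrightarrow> t \<in> G" using G(2) by (simp add: AE_restrict_space_iff)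
    hence "AE t in lborel. t \<in> {0<..<T} \<longrightarrow> t \<in> G" by (simp add: AE_completion_iff)
    with yY show ?thesis by eventually_elim auto
  qed
  have aeT: "AE t in time T. y t = Y t" "AE t in time T. d t = D t"
    using AE_completion[OF yY] AE_completion[OF dD] by (auto simp: AE_restrict_space_iff)
  define m where "m = (LINT t|lborel. \<phi> t * (D t \<bullet> Y t))"
  \<comment> \<open>Step sizes below \<open>T - b\<close>, so that \<open>t + h n\<close> stays in
    the interval for every \<open>t\<close> in the support of \<open>\<phi>\<close>.\<close>
  define h where "h n = (T - b) / real (n + 2)" for n
  have h: "h n > 0" "h n < T - b" for n
    using ab(3) divide_strict_left_mono[of 1 "real (n + 2)" "T - b"] by (auto simp: h_def)
  have h0: "h \<longlonglongrightarrow> 0"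
  proof -
    have "(\<lambda>n. (T - b) * (1 / real (Suc (Suc n)))) \<longlonglongrightarrow> (T - b) * 0"
      by (intro tendsto_mult_left LIMSEQ_Suc[OF LIMSEQ_Suc[OF lim_1_over_n]])
    thus ?thesis by (simp add: h_def[abs_def])
  qed
  define M where "M n s = (LINT t|lborel. \<phi> t * (D (t + h n * s) \<bullet> (Y t + Y (t + h n))))" for n s
  note sh = Lsq_shift[OF Y(1)] Lsq_shift[OF D(1)]
  \<comment> \<open>A difference of squares factors into the increment of \<open>\<iota> y\<close>
    and the sum \<open>Y t + Y (t + h n)\<close>. The increment, tested with an element of V, is an
    integral of \<open>D\<close> over (t, t + h n), which the substitution r = t + h s carries to
    the unit interval.\<close>
  have inc: "AE t in lborel. \<phi> t * (f (t + h n) - f t) =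
      h n * (LINT s|lborel. indicator {0<..<1} s * (\<phi> t * (D (t + h n * s) \<bullet> (Y t + Y (t + h n)))))" for n
    using fG AE_lborel_shift[OF fG, of "h n"]
  proof eventually_elim
    case (elim t)
    show ?case
    proof (cases "t \<in> {a..b}")
      case True
      hence t: "t \<in> {0<..<T}" "t + h n \<in> {0<..<T}" using ab h[of n] by auto
      hence g: "t \<in> G" "t + h n \<in> G" "y t = Y t" "y (t + h n) = Y (t + h n)" using elim by auto
      have "prim T d (t + h n) - prim T d t = (LINT r|time T. indicator {t<..<t + h n} r *\<^sub>R d r)"
        by (rule prim_diff[OF d1]) (use t h[of n] in auto)
      also have "\<dots> = (LINT r|time T. indicator {t<..<t + h n} r *\<^sub>R D r)"
        by (rule integral_cong_AE) (use aeT(2) borel_measurable_integrable[OF time_indicator_integrable[OF d1]]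
            borel_measurable_time[of "\<lambda>r. indicator {t<..<t + h n} r *\<^sub>R D r"] in auto)
      also have "\<dots> = (LINT r|lborel. indicator {0<..<T} r *\<^sub>R (indicator {t<..<t + h n} r *\<^sub>R D r))"
        by (rule integral_time_lborel) measurable
      also have "\<dots> = (LINT r|lborel. indicator {t<..<t + h n} r *\<^sub>R D r)"
        by (rule Bochner_Integration.integral_cong) (use t in \<open>auto simp: indicator_def\<close>)
      also have "\<dots> = h n *\<^sub>R (LINT s|lborel. indicator {t<..<t + h n} (t + h n * s) *\<^sub>R D (t + h n * s))"
        using lborel_integral_real_affine[of "h n" "\<lambda>r. indicator {t<..<t + h n} r *\<^sub>R D r" t] h[of n] by simp
      also have "(\<lambda>s. indicator {t<..<t + h n} (t + h n * s) :: real) = indicator {0<..<1}"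
        using h[of n] by (auto simp: indicator_def fun_eq_iff zero_less_mult_iff)
      finally have p: "prim T d (t + h n) - prim T d t = h n *\<^sub>R (LINT s|lborel. indicator {0<..<1} s *\<^sub>R D (t + h n * s))" .
      have iD: "integrable lborel (\<lambda>s. indicator {0<..<1} s *\<^sub>R D (t + h n * s))"
        using integrable_mult_indicator[of "{0<..<1}" lborel, OF _ lborel_integrable_real_affine[OF D(2), of "h n" t]] h[of n] by simp
      have "f (t + h n) - f t = (\<iota> (Y (t + h n)) - \<iota> (Y t)) \<bullet> \<iota> (Y t + Y (t + h n))"
        by (simp add: f_def blinfun.add_right inner_simps inner_commute)
      also have "\<dots> = h n * ((LINT s|lborel. indicator {0<..<1} s *\<^sub>R D (t + h n * s)) \<bullet> (Y t + Y (t + h n)))"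
        using incr[OF g(1,2), of "Y t + Y (t + h n)"] g(3,4) p by simp
      also have "(LINT s|lborel. indicator {0<..<1} s *\<^sub>R D (t + h n * s)) \<bullet> (Y t + Y (t + h n))
          = (LINT s|lborel. indicator {0<..<1} s * (D (t + h n * s) \<bullet> (Y t + Y (t + h n))))"
        using iD by (subst integral_inner_left[symmetric]) auto
      finally have "\<phi> t * (f (t + h n) - f t) =
        h n * (\<phi> t * (LINT s|lborel. indicator {0<..<1} s * (D (t + h n * s) \<bullet> (Y t + Y (t + h n)))))" by simp
      also have "\<phi> t * (LINT s|lborel. indicator {0<..<1} s * (D (t + h n * s) \<bullet> (Y t + Y (t + h n))))
        = (LINT s|lborel. \<phi> t * (indicator {0<..<1} s * (D (t + h n * s) \<bullet> (Y t + Y (t + h n)))))" by simp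
      finally show ?thesis by (simp add: mult.left_commute)
    qed (simp add: ab(4))
  qed
  have fub: "(LINT t|lborel. \<phi> t * (f (t + h n) - f t)) = h n * (LINT s|lborel. indicator {0<..<1} s * M n s)" for n
  proof -
    define k where "k t s = indicator {0<..<1} s * (\<phi> t * (D (t + h n * s) \<bullet> (Y t + Y (t + h n))))" for t s :: real
    have km [measurable]: "(\<lambda>(s, t). k t s) \<in> borel_measurable (lborel \<Otimes>\<^sub>M lborel)"
    proof -
      have 1: "(\<lambda>p. D (snd p + h n * fst p)) \<in> borel_measurable (lborel \<Otimes>\<^sub>M lborel)"
        by (rule measurable_compose[of "\<lambda>p. snd p + h n * fst p" _ borel]) measurable
      have 2: "(\<lambda>p. Y (snd p) + Y (snd p + h n)) \<in> borel_measurable (lborel \<Otimes>\<^sub>M (lborel :: real measure))"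
        by measurable
      have 3: "(\<lambda>p. \<phi> (snd p)) \<in> borel_measurable (lborel \<Otimes>\<^sub>M (lborel :: real measure))"
        by measurable
      have 4: "(\<lambda>p. indicator {0<..<1} (fst p) :: real) \<in> borel_measurable ((lborel :: real measure) \<Otimes>\<^sub>M (lborel :: real measure))"
        by measurable
      show ?thesis unfolding k_def case_prod_beta
        by (intro borel_measurable_times borel_measurable_inner 1 2 3 4)
    qed
    have YY: "(\<lambda>t. Y t + Y (t + h n)) \<in> Lsq lborel" by (intro Lsq_add Y sh)
    have nk: "norm (k t s) \<le> indicator {0<..<1} s * (K * (norm (D (t + h n * s)) * norm (Y t + Y (t + h n))))" for s t
      unfolding k_def by (auto simp: abs_mult intro!: mult_left_mono mult_mono K less_imp_le[OF K(1)] Cauchy_Schwarz_ineq2)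
    have int_t: "integrable lborel (\<lambda>t. k t s)" for s
      unfolding k_def using integral_weighted_inner(1)[OF _ K(2) sh(3)[of "h n * s"] YY] by simp
    have "integrable (lborel \<Otimes>\<^sub>M lborel) (\<lambda>(s, t). k t s)"
    proof (rule lborel_pair.Fubini_integrable)
      show "integrable lborel (\<lambda>s. LINT t|lborel. norm (case (s, t) of (s, t) \<Rightarrow> k t s))"
      proof (rule Bochner_Integration.integrable_bound)
        show "integrable lborel (\<lambda>s. indicator {0<..<1::real} s * (K * (sqrt (nsq lborel D) * sqrt (nsq lborel (\<lambda>t. Y t + Y (t + h n))))))"
          by simp
        have "(LINT t|lborel. norm (k t s)) \<le> indicator {0<..<1} s * (K * (sqrt (nsq lborel D) * sqrt (nsq lborel (\<lambda>t. Y t + Y (t + h n)))))" for s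
        proof -
          have "(LINT t|lborel. norm (k t s)) \<le> (LINT t|lborel. indicator {0<..<1} s * (K * (norm (D (t + h n * s)) * norm (Y t + Y (t + h n)))))"
            by (rule integral_mono) (use nk int_t[of s] integrable_norm_mult_Lsq[OF sh(3)[of "h n * s"] YY] in auto)
          also have "\<dots> = indicator {0<..<1} s * (K * (LINT t|lborel. norm (D (t + h n * s)) * norm (Y t + Y (t + h n))))" by simp
          also have "\<dots> \<le> indicator {0<..<1} s * (K * (sqrt (nsq lborel D) * sqrt (nsq lborel (\<lambda>t. Y t + Y (t + h n)))))"
            using integral_norm_mult_Lsq[OF sh(3)[of "h n * s"] YY] K(1) by (intro mult_left_mono) (auto simp: sh(4))
          finally show ?thesis .
        qed
        thus "AE s in lborel. norm (LINT t|lborel. norm (case (s, t) of (s, t) \<Rightarrow> k t s))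
          \<le> norm (indicator {0<..<1} s * (K * (sqrt (nsq lborel D) * sqrt (nsq lborel (\<lambda>t. Y t + Y (t + h n))))))"
          using K(1) by (auto simp: abs_mult)
      qed measurable
      show "AE s in lborel. integrable lborel (\<lambda>t. case (s, t) of (s, t) \<Rightarrow> k t s)" using int_t by simp
    qed (rule km)
    from lborel_pair.Fubini_integral[OF this]
    have sw: "(LINT t|lborel. LINT s|lborel. k t s) = (LINT s|lborel. LINT t|lborel. k t s)" by simp
    have "(LINT t|lborel. \<phi> t * (f (t + h n) - f t)) = (LINT t|lborel. h n * (LINT s|lborel. k t s))"
      by (rule integral_cong_AE) (use inc[of n] in \<open>auto simp: k_def\<close>)
    also have "\<dots> = h n * (LINT s|lborel. LINT t|lborel. k t s)" by (simp add: sw)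
    also have "(\<lambda>s. LINT t|lborel. k t s) = (\<lambda>s. indicator {0<..<1} s * M n s)"
      by (simp add: k_def M_def)
    finally show ?thesis .
  qed
  \<comment> \<open>The factor 2 arises because \<open>Y t + Y (t + h n)\<close> tends to
    \<open>2 *\<^sub>R Y t\<close> in the square mean, while the shifted \<open>D\<close> tends to
    \<open>D\<close>; Cauchy-Schwarz controls the product.\<close>
  have Mlim: "(\<lambda>n. M n s) \<longlonglongrightarrow> 2 * m" for s
  proof -
    have wi: "integrable lborel (\<lambda>t. \<phi> t * (X t \<bullet> Z t))" if "X \<in> Lsq lborel" "Z \<in> Lsq lborel" for X Z :: "real \<Rightarrow> 'v"
      by (rule integral_weighted_inner(1)[OF _ K(2) that]) simp
    have hs: "(\<lambda>n. h n * s) \<longlonglongrightarrow> 0" using tendsto_mult_right[OF h0, of s] by simp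
    have Dd: "(\<lambda>t. D (t + h n * s) - D t) \<in> Lsq lborel" for n by (intro Lsq_diff D sh)
    have Yd: "(\<lambda>t. Y (t + h n) - Y t) \<in> Lsq lborel" for n by (intro Lsq_diff Y sh)
    have YY: "(\<lambda>t. Y t + Y (t + h n)) \<in> Lsq lborel" for n by (intro Lsq_add Y sh)
    have e1: "M n s - 2 * m = (LINT t|lborel. \<phi> t * ((D (t + h n * s) - D t) \<bullet> (Y t + Y (t + h n))))
       + (LINT t|lborel. \<phi> t * (D t \<bullet> (Y (t + h n) - Y t)))" for n
      unfolding M_def m_def
      using wi[OF sh(3)[of "h n * s"] Y(1)] wi[OF sh(3)[of "h n * s"] sh(1)[of "h n"]]
        wi[OF D(1) Y(1)] wi[OF D(1) sh(1)[of "h n"]]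
      by (simp add: inner_diff_left inner_diff_right right_diff_distrib inner_add_right distrib_left)
    have e2: "\<bar>LINT t|lborel. \<phi> t * ((D (t + h n * s) - D t) \<bullet> (Y t + Y (t + h n)))\<bar>
       \<le> K * sqrt (nsq lborel (\<lambda>t. D (t + h n * s) - D t)) * (2 * sqrt (nsq lborel Y))" for n
    proof -
      have "sqrt (nsq lborel (\<lambda>t. Y t + Y (t + h n))) \<le> 2 * sqrt (nsq lborel Y)"
        using nsq_triangle[OF Y(1) sh(1)[of "h n"]] by (simp add: sh(2))
      hence "K * sqrt (nsq lborel (\<lambda>t. D (t + h n * s) - D t)) * sqrt (nsq lborel (\<lambda>t. Y t + Y (t + h n)))
          \<le> K * sqrt (nsq lborel (\<lambda>t. D (t + h n * s) - D t)) * (2 * sqrt (nsq lborel Y))"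
        by (rule mult_left_mono) (use K(1) in simp)
      with integral_weighted_inner(2)[of \<phi> lborel K, OF _ K(2) Dd[of n] YY[of n]]
      show ?thesis by simp
    qed
    have e3: "\<bar>LINT t|lborel. \<phi> t * (D t \<bullet> (Y (t + h n) - Y t))\<bar>
       \<le> K * sqrt (nsq lborel D) * sqrt (nsq lborel (\<lambda>t. Y (t + h n) - Y t))" for n
      by (rule integral_weighted_inner(2)[OF _ K(2) D(1) Yd]) simp
    define B where "B n = K * sqrt (nsq lborel (\<lambda>t. D (t + h n * s) - D t)) * (2 * sqrt (nsq lborel Y))
       + K * sqrt (nsq lborel D) * sqrt (nsq lborel (\<lambda>t. Y (t + h n) - Y t))" for n
    have bd: "norm (M n s - 2 * m) \<le> B n" for n
      unfolding e1 B_def real_norm_def by (rule order_trans[OF abs_triangle_ineq add_mono[OF e2 e3]])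
    have "B \<longlonglongrightarrow> K * 0 * (2 * sqrt (nsq lborel Y)) + K * sqrt (nsq lborel D) * 0"
      unfolding B_def by (intro tendsto_add tendsto_mult tendsto_const translation_Lsq D Y h0 hs)
    hence "B \<longlonglongrightarrow> 0" by simp
    from Lim_null_comparison[OF always_eventually[OF allI[OF bd]] this]
    have "(\<lambda>n. M n s - 2 * m) \<longlonglongrightarrow> 0" .
    thus ?thesis by (simp add: LIM_zero_iff)
  qed
  have "(\<lambda>n. LINT s|lborel. indicator {0<..<1} s * M n s) \<longlonglongrightarrow> (LINT s|lborel. indicator {0<..<1::real} s * (2 * m))"
  proof (rule integral_dominated_convergence[where w = "\<lambda>s. indicator {0<..<1} s * (K * sqrt (nsq lborel D) * (2 * sqrt (nsq lborel Y)))"])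
    show "AE s in lborel. (\<lambda>n. indicator {0<..<1} s * M n s) \<longlonglongrightarrow> indicator {0<..<1} s * (2 * m)"
      by (intro AE_I2 tendsto_mult_left Mlim)
    have "\<bar>M n s\<bar> \<le> K * sqrt (nsq lborel D) * (2 * sqrt (nsq lborel Y))" for n s
    proof -
      have "sqrt (nsq lborel (\<lambda>t. Y t + Y (t + h n))) \<le> 2 * sqrt (nsq lborel Y)"
        using nsq_triangle[OF Y(1) sh(1)[of "h n"]] by (simp add: sh(2))
      hence "K * sqrt (nsq lborel D) * sqrt (nsq lborel (\<lambda>t. Y t + Y (t + h n)))
          \<le> K * sqrt (nsq lborel D) * (2 * sqrt (nsq lborel Y))"
        by (rule mult_left_mono) (use K(1) in simp)
      with integral_weighted_inner(2)[of \<phi> lborel K, OF _ K(2) sh(3)[of "h n * s"] Lsq_add[OF Y(1) sh(1)[of "h n"]]]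
      show ?thesis unfolding M_def by (simp add: sh(4))
    qed
    thus "AE s in lborel. norm (indicator {0<..<1} s * M n s) \<le> indicator {0<..<1} s * (K * sqrt (nsq lborel D) * (2 * sqrt (nsq lborel Y)))" for n
      by (auto simp: indicator_def)
    show "(\<lambda>s. indicator {0<..<1} s * M n s) \<in> borel_measurable lborel" for n
      unfolding M_def by measurable
  qed auto
  hence lim1: "(\<lambda>n. (LINT t|lborel. \<phi> t * (f (t + h n) - f t)) / h n) \<longlonglongrightarrow> 2 * m"
    using h(1) by (simp add: fub less_imp_neq[THEN not_sym])
  \<comment> \<open>Translation invariance moves the difference quotient from \<open>f\<close>,
    where nothing is known about differentiability, to \<open>\<phi>\<close>.\<close>
  have "(LINT t|lborel. \<phi> t * (f (t + h n) - f t)) / h n = (LINT t|lborel. (\<phi> (t - h n) - \<phi> t) / h n * f t)" for n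
  proof -
    have i: "integrable lborel (\<lambda>t. \<phi> (t + c) * f t)" for c
    proof (rule Bochner_Integration.integrable_bound[of _ "\<lambda>t. K * f t"])
      show "AE t in lborel. norm (\<phi> (t + c) * f t) \<le> norm (K * f t)"
        using K by (auto simp: abs_mult intro!: mult_right_mono)
    qed (use f1 in auto)
    have sh': "(LINT t|lborel. \<phi> (t - h n) * f t) = (LINT t|lborel. \<phi> t * f (t + h n))"
      using lborel_integral_shift[of "\<lambda>t. \<phi> (t - h n) * f t" "h n"] by simp
    have i': "integrable lborel (\<lambda>t. \<phi> t * f (t + h n))"
      using lborel_integrable_shift[of "\<lambda>t. \<phi> (t + - h n) * f t" "h n"] i[of "- h n"] by simp
    have "(LINT t|lborel. (\<phi> (t - h n) - \<phi> t) / h n * f t) = (LINT t|lborel. (\<phi> (t - h n) * f t - \<phi> t * f t) / h n)"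
      by (simp add: left_diff_distrib)
    also have "\<dots> = ((LINT t|lborel. \<phi> t * f (t + h n)) - (LINT t|lborel. \<phi> t * f t)) / h n"
      using i[of "- h n"] i[of 0] by (simp add: sh')
    finally have "(LINT t|lborel. (\<phi> (t - h n) - \<phi> t) / h n * f t) = (LINT t|lborel. \<phi> t * (f (t + h n) - f t)) / h n"
      using i' i[of 0] by (simp add: right_diff_distrib)
    thus ?thesis by (rule sym)
  qed
  note eq1 = this
  have lim2: "(\<lambda>n. LINT t|lborel. (\<phi> (t - h n) - \<phi> t) / h n * f t) \<longlonglongrightarrow> (LINT t|lborel. - deriv \<phi> t * f t)"
  proof (rule integral_dominated_convergence[where w = "\<lambda>t. K' * f t"])
    show "AE t in lborel. (\<lambda>n. (\<phi> (t - h n) - \<phi> t) / h n * f t) \<longlonglongrightarrow> - deriv \<phi> t * f t"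
    proof (intro AE_I2 tendsto_mult_right)
      fix t
      have "filterlim (\<lambda>n. - h n) (at 0) sequentially"
        using tendsto_minus[OF h0] h(1) by (auto simp: filterlim_at less_imp_neq[THEN not_sym])
      from filterlim_compose[OF test_function_deriv[OF \<phi>, of t, unfolded DERIV_def] this]
      have "(\<lambda>n. - ((\<phi> (t + - h n) - \<phi> t) / - h n)) \<longlonglongrightarrow> - deriv \<phi> t" by (rule tendsto_minus)
      thus "(\<lambda>n. (\<phi> (t - h n) - \<phi> t) / h n) \<longlonglongrightarrow> - deriv \<phi> t" by simp
    qed
    show "AE t in lborel. norm ((\<phi> (t - h n) - \<phi> t) / h n * f t) \<le> K' * f t" for n
    proof (rule AE_I2)
      fix t
      have "norm (\<phi> (t - h n) - \<phi> t) \<le> K' * norm (t - h n - t)"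
        by (rule field_differentiable_bound[of UNIV \<phi> "deriv \<phi>"])
          (use test_function_deriv[OF \<phi>] K'(2) in auto)
      hence "\<bar>(\<phi> (t - h n) - \<phi> t) / h n\<bar> \<le> K'" using h(1)[of n] by (simp add: field_simps)
      moreover have "f t \<ge> 0" by (simp add: f_def)
      moreover have "norm (x * f t) \<le> K' * f t" if "\<bar>x\<bar> \<le> K'" "f t \<ge> 0" for x
        using that by (simp add: abs_mult mult_right_mono)
      ultimately show "norm ((\<phi> (t - h n) - \<phi> t) / h n * f t) \<le> K' * f t" by blast
    qed
  qed (use f1 in auto)
  have "2 * m = (LINT t|lborel. - deriv \<phi> t * f t)"
    by (rule LIMSEQ_unique[OF lim1[unfolded eq1] lim2])
  hence eq: "(LINT t|lborel. deriv \<phi> t * f t) = - (2 * m)" by simp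
  have 0: "indicator {0<..<T} t * (deriv \<phi> t * f t) = deriv \<phi> t * f t"
    "indicator {0<..<T} t * (\<phi> t * (2 * (D t \<bullet> Y t))) = \<phi> t * (2 * (D t \<bullet> Y t))" for t
    using Y(3)[of t] by (cases "t \<in> {0<..<T}", simp, simp add: f_def blinfun.zero_right)+
  have tm: "\<phi> \<in> borel_measurable (time T)" "deriv \<phi> \<in> borel_measurable (time T)"
    by (auto intro: borel_measurable_time)
  have "(LINT t|time T. deriv \<phi> t * (\<iota> (y t) \<bullet> \<iota> (y t))) = (LINT t|time T. deriv \<phi> t * f t)"
  proof (rule integral_cong_AE)
    show "(\<lambda>t. deriv \<phi> t * (\<iota> (y t) \<bullet> \<iota> (y t))) \<in> borel_measurable (time T)"
      by (intro borel_measurable_times borel_measurable_inner tm Lsq_measurable[OF Lsq_blinfun(1)[OF yL]])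
  qed (use aeT(1) in \<open>auto simp: f_def[abs_def] intro!: borel_measurable_time\<close>)
  also have "\<dots> = (LINT t|lborel. deriv \<phi> t * f t)"
    by (simp add: integral_time_lborel(1) 0)
  also have "\<dots> = - (LINT t|lborel. \<phi> t * (2 * (D t \<bullet> Y t)))"
    unfolding eq m_def by (subst integral_mult_right_zero[symmetric]) (simp add: mult.left_commute)
  also have "\<dots> = - (LINT t|time T. \<phi> t * (2 * (D t \<bullet> Y t)))"
    by (simp add: integral_time_lborel(1) 0)
  also have "(LINT t|time T. \<phi> t * (2 * (D t \<bullet> Y t))) = (LINT t|time T. \<phi> t * (2 * (d t \<bullet> y t)))"
  proof (rule integral_cong_AE)
    show "(\<lambda>t. \<phi> t * (2 * (d t \<bullet> y t))) \<in> borel_measurable (time T)"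
      by (intro borel_measurable_times borel_measurable_const borel_measurable_inner tm Lsq_measurable[OF yL] Lsq_measurable[OF dL])
    show "AE t in time T. \<phi> t * (2 * (D t \<bullet> Y t)) = \<phi> t * (2 * (d t \<bullet> y t))"
      using aeT by eventually_elim simp
  qed (auto intro!: borel_measurable_time)
  finally show ?thesis .
qed

text \<open>Du Bois-Reymond for the scalar function \<open>(norm (\<iota> (y t)))\<^sup>2\<close>;
  the set \<open>G\<close> is cut down to the times at which its primitive is valid too.\<close>

lemma vderiv_energy_increments:
  fixes y d :: "real \<Rightarrow> 'v::{real_inner, banach, second_countable_topology}"
    and \<iota> :: "'v \<Rightarrow>\<^sub>L 'h::{real_inner, banach, second_countable_topology}"
  assumes "T > 0" and y: "vderiv \<iota> T UNIV y d"
  obtains G where "G \<subseteq> {0<..<T}" "AE t in time T. t \<in> G"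
    "\<And>s t v. s \<in> G \<Longrightarrow> t \<in> G \<Longrightarrow> (\<iota> (y t) - \<iota> (y s)) \<bullet> \<iota> v = (prim T d t - prim T d s) \<bullet> v"
    "\<And>s t. s \<in> G \<Longrightarrow> t \<in> G \<Longrightarrow> (norm (\<iota> (y t)))\<^sup>2 - (norm (\<iota> (y s)))\<^sup>2
       = prim T (\<lambda>r. 2 * (d r \<bullet> y r)) t - prim T (\<lambda>r. 2 * (d r \<bullet> y r)) s"
proof -
  have yL: "y \<in> Lsq (time T)" and dL: "d \<in> Lsq (time T)" using y by (auto simp: vderiv_def)
  obtain G where G: "G \<subseteq> {0<..<T}" "AE t in time T. t \<in> G"
    and incr: "\<And>s t v. s \<in> G \<Longrightarrow> t \<in> G \<Longrightarrow> (\<iota> (y t) - \<iota> (y s)) \<bullet> \<iota> v = (prim T d t - prim T d s) \<bullet> v"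
    using vderiv_increments[OF \<open>T > 0\<close> y] by metis
  have "integrable (time T) (\<lambda>t. \<iota> (y t) \<bullet> \<iota> (y t))" "integrable (time T) (\<lambda>t. 2 * (d t \<bullet> y t))"
    by (auto intro!: integrable_inner_Lsq Lsq_blinfun yL dL)
  then obtain c where "AE t in time T. \<iota> (y t) \<bullet> \<iota> (y t) = c + (LINT s|time T. indicator {0<..<t} s * (2 * (d s \<bullet> y s)))"
    by (rule du_Bois_Reymond[OF _ _ \<open>T > 0\<close> energy_weak_deriv[OF \<open>T > 0\<close> y]])
  hence c: "AE t in time T. (norm (\<iota> (y t)))\<^sup>2 = c + prim T (\<lambda>r. 2 * (d r \<bullet> y r)) t"
    by (simp add: prim_def power2_norm_eq_inner)
  show ?thesis
  proof (rule that[of "{t \<in> G. (norm (\<iota> (y t)))\<^sup>2 = c + prim T (\<lambda>r. 2 * (d r \<bullet> y r)) t}"])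
    show "AE t in time T. t \<in> {t \<in> G. (norm (\<iota> (y t)))\<^sup>2 = c + prim T (\<lambda>r. 2 * (d r \<bullet> y r)) t}"
      using G(2) c by eventually_elim simp
  qed (use G(1) incr in auto)
qed

section \<open>Oscillation of the H-valued path and its continuous representative\<close>

lemma time_indicator_Lsq:
  fixes d :: "real \<Rightarrow> 'a::{real_normed_vector, second_countable_topology}"
  assumes "d \<in> Lsq (time T)"
  shows "(\<lambda>r. indicator {a<..<b} r *\<^sub>R d r) \<in> Lsq (time T)"
  by (rule Lsq_mult_bounded[OF assms borel_measurable_time[of "indicator {a<..<b}"], of 1]) (auto simp: indicator_def)

lemma time_const_Lsq: "(\<lambda>t. c) \<in> Lsq (time T)"
  by (rule time.Lsq_bounded[where K = "norm c"]) auto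

lemma nsq_time_indicator:
  fixes d :: "real \<Rightarrow> 'a::{real_normed_vector, second_countable_topology}"
  assumes "d \<in> Lsq (time T)" "0 \<le> a" "a \<le> b"
  shows "nsq (time T) (\<lambda>r. indicator {a<..<b} r *\<^sub>R d r) = prim T (\<lambda>r. (norm (d r))\<^sup>2) b - prim T (\<lambda>r. (norm (d r))\<^sup>2) a"
  unfolding prim_diff[OF Lsq_integrable[OF assms(1)] assms(2,3)] nsq_def
  by (rule Bochner_Integration.integral_cong) (auto simp: indicator_def)

lemma nsq_time_indicator_mono:
  fixes d :: "real \<Rightarrow> 'a::{real_normed_vector, second_countable_topology}"
  assumes "d \<in> Lsq (time T)" "a \<le> a'" "b' \<le> b"
  shows "nsq (time T) (\<lambda>r. indicator {a'<..<b'} r *\<^sub>R d r) \<le> nsq (time T) (\<lambda>r. indicator {a<..<b} r *\<^sub>R d r)"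
  unfolding nsq_def
  by (rule integral_mono) (use assms(2,3) Lsq_integrable[OF time_indicator_Lsq[OF assms(1)]] in \<open>auto simp: indicator_def\<close>)

lemma time_dense:
  assumes "AE t in time T. t \<in> G" "0 \<le> a" "a < b" "b \<le> T"
  shows "\<exists>t\<in>G. a < t \<and> t < b"
proof (rule ccontr)
  assume "\<not> ?thesis"
  hence "AE t in time T. t \<notin> {a<..<b}" using assms(1) by (auto elim: eventually_mono)
  hence "{a<..<b} \<in> null_sets (time T)"
    using assms by (subst AE_iff_null_sets) (auto simp: sets_restrict_space intro!: image_eqI[of _ _ "{a<..<b}"])
  thus False using assms open_not_negligible[of "{a<..<b}"]
    by (simp add: null_sets_restrict_space negligible_iff_null_sets[symmetric])
qed

text \<open>Compare with an intermediate time \<open>\<sigma>\<close> at which the \<open>V\<close>-norm is at most its mean square.\<close>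

lemma vderiv_oscillation:
  fixes y d :: "real \<Rightarrow> 'v::{real_inner, banach, second_countable_topology}"
    and \<iota> :: "'v \<Rightarrow>\<^sub>L 'h::{real_inner, banach, second_countable_topology}"
  assumes yL: "y \<in> Lsq (time T)" and dL: "d \<in> Lsq (time T)" and G: "G \<subseteq> {0<..<T}" "AE t in time T. t \<in> G"
    and incr: "\<And>s t v. s \<in> G \<Longrightarrow> t \<in> G \<Longrightarrow> (\<iota> (y t) - \<iota> (y s)) \<bullet> \<iota> v = (prim T d t - prim T d s) \<bullet> v"
    and energy: "\<And>s t. s \<in> G \<Longrightarrow> t \<in> G \<Longrightarrow> (norm (\<iota> (y t)))\<^sup>2 - (norm (\<iota> (y s)))\<^sup>2
       = prim T (\<lambda>r. 2 * (d r \<bullet> y r)) t - prim T (\<lambda>r. 2 * (d r \<bullet> y r)) s"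
    and ab: "0 \<le> a" "a < b" "b \<le> T"
  obtains \<sigma> where "\<sigma> \<in> G" "(norm (y \<sigma>))\<^sup>2 * (b - a) \<le> nsq (time T) (\<lambda>r. indicator {a<..<b} r *\<^sub>R y r)"
    "\<And>t. t \<in> G \<Longrightarrow> a < t \<Longrightarrow> t < b \<Longrightarrow> norm (\<iota> (y t) - \<iota> (y \<sigma>)) \<le>
      2 * sqrt (sqrt (nsq (time T) (\<lambda>r. indicator {a<..<b} r *\<^sub>R d r)) * sqrt (nsq (time T) (\<lambda>r. indicator {a<..<b} r *\<^sub>R y r)))"
proof -
  define yI where "yI = nsq (time T) (\<lambda>r. indicator {a<..<b} r *\<^sub>R y r)"
  define dI where "dI = nsq (time T) (\<lambda>r. indicator {a<..<b} r *\<^sub>R d r)"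
  have d1: "integrable (time T) d" by (rule time.Lsq_integrable1[OF dL])
  have len: "(LINT r|time T. indicator {a<..<b} r) = b - a"
    using integral_time_FTC[of a b T "\<lambda>x. x" "\<lambda>_. 1"] ab by (auto intro!: derivative_eq_intros)
  have iI: "integrable (time T) (\<lambda>r. indicator {a<..<b} r :: real)"
    using time_indicator_integrable[of T "\<lambda>_. 1::real" a b] by simp
  have "\<exists>\<sigma>\<in>G. a < \<sigma> \<and> \<sigma> < b \<and> (norm (y \<sigma>))\<^sup>2 * (b - a) \<le> yI"
  proof (rule ccontr)
    assume no: "\<not> ?thesis"
    \<comment> \<open>If every time of \<open>G\<close> in (a, b) failed, \<open>q\<close> would be
      strictly positive there, although its integral over (a, b) is zero.\<close>
    define q where "q r = indicator {a<..<b} r * ((norm (y r))\<^sup>2 * (b - a) - yI)" for r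
    have iy: "integrable (time T) (\<lambda>r. indicator {a<..<b} r * (norm (y r))\<^sup>2)"
      using time_indicator_integrable[OF Lsq_integrable[OF yL], of a b] by simp
    have q: "q = (\<lambda>r. (b - a) * (indicator {a<..<b} r * (norm (y r))\<^sup>2) - yI * indicator {a<..<b} r)"
      by (auto simp: q_def fun_eq_iff algebra_simps)
    have iq: "integrable (time T) q" unfolding q using iy iI by simp
    have yI': "yI = (LINT r|time T. indicator {a<..<b} r * (norm (y r))\<^sup>2)"
      unfolding yI_def nsq_def by (rule Bochner_Integration.integral_cong) (auto simp: indicator_def)
    have "(LINT r|time T. q r) = (b - a) * (LINT r|time T. indicator {a<..<b} r * (norm (y r))\<^sup>2)
        - yI * (LINT r|time T. indicator {a<..<b} r)"
      unfolding q using iy iI by simp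
    also have "\<dots> = 0" unfolding len yI'[symmetric] by simp
    finally have "(LINT r|time T. q r) = 0" .
    moreover have "0 \<le> q r" if "r \<in> G" for r
      using no that by (cases "r \<in> {a<..<b}") (force simp: q_def)+
    hence "AE r in time T. 0 \<le> q r" using G(2) by (auto elim: eventually_mono)
    ultimately have "AE r in time T. q r = 0" using integral_nonneg_eq_0_iff_AE[OF iq] by simp
    with G(2) have "AE r in time T. r \<in> {r\<in>G. q r = 0}" by eventually_elim simp
    from time_dense[OF this ab] obtain r where "r \<in> G" "q r = 0" "a < r" "r < b" by auto
    thus False using no by (force simp: q_def)
  qed
  then obtain \<sigma> where \<sigma>: "\<sigma> \<in> G" "a < \<sigma>" "\<sigma> < b" "(norm (y \<sigma>))\<^sup>2 * (b - a) \<le> yI" by blast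
  have est: "norm (\<iota> (y t) - \<iota> (y \<sigma>)) \<le> 2 * sqrt (sqrt dI * sqrt yI)" if t: "t \<in> G" "a < t" "t < b" for t
  proof -
    define lo hi where "lo = min t \<sigma>" and "hi = max t \<sigma>"
    have lh: "0 \<le> lo" "lo \<le> hi" "a \<le> lo" "hi \<le> b" using t \<sigma> ab by (auto simp: lo_def hi_def)
    define I where "I = (LINT r|time T. indicator {lo<..<hi} r * (2 * (d r \<bullet> (y r - y \<sigma>))))"
    have dy: "integrable (time T) (\<lambda>r. 2 * (d r \<bullet> y r))" by (auto intro: integrable_inner_Lsq yL dL)
    have i1: "integrable (time T) (\<lambda>r. indicator {lo<..<hi} r * (2 * (d r \<bullet> y r)))"
      using time_indicator_integrable[OF dy, of lo hi] by simp
    have i2: "integrable (time T) (\<lambda>r. indicator {lo<..<hi} r *\<^sub>R d r)" by (rule time_indicator_integrable[OF d1])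
    have "(prim T (\<lambda>r. 2 * (d r \<bullet> y r)) hi - prim T (\<lambda>r. 2 * (d r \<bullet> y r)) lo) - 2 * ((prim T d hi - prim T d lo) \<bullet> y \<sigma>)
      = (LINT r|time T. indicator {lo<..<hi} r * (2 * (d r \<bullet> y r))) - 2 * (LINT r|time T. (indicator {lo<..<hi} r *\<^sub>R d r) \<bullet> y \<sigma>)"
      unfolding prim_diff[OF dy lh(1,2)] prim_diff[OF d1 lh(1,2)] using i2 by (subst integral_inner_left) auto
    also have "\<dots> = (LINT r|time T. indicator {lo<..<hi} r * (2 * (d r \<bullet> y r)) - 2 * ((indicator {lo<..<hi} r *\<^sub>R d r) \<bullet> y \<sigma>))"
      by (subst Bochner_Integration.integral_diff[OF i1]) (use integrable_inner_left[OF i2, of "y \<sigma>"] in auto)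
    also have "\<dots> = I" unfolding I_def
      by (rule Bochner_Integration.integral_cong) (simp_all add: inner_diff_right algebra_simps)
    finally have I: "I = (prim T (\<lambda>r. 2 * (d r \<bullet> y r)) hi - prim T (\<lambda>r. 2 * (d r \<bullet> y r)) lo) - 2 * ((prim T d hi - prim T d lo) \<bullet> y \<sigma>)" ..
    \<comment> \<open>Written so that the difference is tested with \<open>y \<sigma>\<close>, an
      element of V. The energy increment and the tested increment then merge, up to sign, into the
      single integral \<open>I\<close> of
      \<open>2 * (d r \<bullet> (y r - y \<sigma>))\<close>.\<close>
    have "(norm (\<iota> (y t) - \<iota> (y \<sigma>)))\<^sup>2 = (norm (\<iota> (y t)))\<^sup>2 - (norm (\<iota> (y \<sigma>)))\<^sup>2 - 2 * ((\<iota> (y t) - \<iota> (y \<sigma>)) \<bullet> \<iota> (y \<sigma>))"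
      by (simp add: power2_norm_eq_inner inner_diff_left inner_diff_right inner_commute)
    also have "\<dots> = (prim T (\<lambda>r. 2 * (d r \<bullet> y r)) t - prim T (\<lambda>r. 2 * (d r \<bullet> y r)) \<sigma>) - 2 * ((prim T d t - prim T d \<sigma>) \<bullet> y \<sigma>)"
      by (simp add: energy[OF \<sigma>(1) t(1)] incr[OF \<sigma>(1) t(1)])
    also have "\<dots> \<le> \<bar>I\<bar>"
    proof (cases "t \<le> \<sigma>")
      case True
      hence *: "lo = t" "hi = \<sigma>" by (auto simp: lo_def hi_def)
      have "x - z - 2 * (u - v) \<le> \<bar>z - x - 2 * (v - u)\<bar>" for x z u v :: real
        using abs_ge_minus_self[of "z - x - 2 * (v - u)"] by (simp add: algebra_simps)
      thus ?thesis unfolding I * inner_diff_left .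
    next
      case False
      hence *: "lo = \<sigma>" "hi = t" by (auto simp: lo_def hi_def)
      show ?thesis unfolding I * by linarith
    qed
    also have "\<bar>I\<bar> = \<bar>LINT r|time T. (indicator {lo<..<hi} r *\<^sub>R d r) \<bullet> (2 *\<^sub>R (indicator {a<..<b} r *\<^sub>R y r + indicator {a<..<b} r *\<^sub>R (- y \<sigma>)))\<bar>"
      unfolding I_def by (rule arg_cong[where f = abs], rule Bochner_Integration.integral_cong)
        (use lh in \<open>auto simp: indicator_def inner_diff_right\<close>)
    also have "\<dots> \<le> sqrt (nsq (time T) (\<lambda>r. indicator {lo<..<hi} r *\<^sub>R d r))
        * sqrt (nsq (time T) (\<lambda>r. 2 *\<^sub>R (indicator {a<..<b} r *\<^sub>R y r + indicator {a<..<b} r *\<^sub>R (- y \<sigma>))))"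
      by (intro integral_inner_Lsq_le time_indicator_Lsq dL Lsq_scaleR Lsq_add yL time_const_Lsq)
    also have "\<dots> \<le> sqrt dI * (2 * (2 * sqrt yI))"
    proof (rule mult_mono)
      show "sqrt (nsq (time T) (\<lambda>r. indicator {lo<..<hi} r *\<^sub>R d r)) \<le> sqrt dI"
        unfolding dI_def using nsq_time_indicator_mono[OF dL lh(3,4)] by simp
      have c: "(\<lambda>r. indicator {a<..<b} r *\<^sub>R (- y \<sigma>)) \<in> Lsq (time T)"
        by (intro time_indicator_Lsq time_const_Lsq)
      \<comment> \<open>By the choice of \<open>\<sigma>\<close> the constant path
        \<open>y \<sigma>\<close> has at most the mean square of \<open>y\<close> on the
        interval.\<close>
      have "nsq (time T) (\<lambda>r. indicator {a<..<b} r *\<^sub>R (- y \<sigma>)) = (LINT r|time T. (norm (y \<sigma>))\<^sup>2 * indicator {a<..<b} r)"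
        unfolding nsq_def by (rule Bochner_Integration.integral_cong) (auto simp: indicator_def)
      also have "\<dots> \<le> yI" using \<sigma>(4) len by simp
      finally have "sqrt (nsq (time T) (\<lambda>r. indicator {a<..<b} r *\<^sub>R (- y \<sigma>))) \<le> sqrt yI" by simp
      with nsq_triangle[OF time_indicator_Lsq[OF yL, of a b] c]
      have "sqrt (nsq (time T) (\<lambda>r. indicator {a<..<b} r *\<^sub>R y r + indicator {a<..<b} r *\<^sub>R (- y \<sigma>))) \<le> 2 * sqrt yI"
        unfolding yI_def by linarith
      thus "sqrt (nsq (time T) (\<lambda>r. 2 *\<^sub>R (indicator {a<..<b} r *\<^sub>R y r + indicator {a<..<b} r *\<^sub>R (- y \<sigma>)))) \<le> 2 * (2 * sqrt yI)"
        by (subst Lsq_scaleR(2)[OF Lsq_add[OF time_indicator_Lsq[OF yL] c]]) (simp add: real_sqrt_mult)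
    qed (auto simp: dI_def)
    finally have "(norm (\<iota> (y t) - \<iota> (y \<sigma>)))\<^sup>2 \<le> (2 * sqrt (sqrt dI * sqrt yI))\<^sup>2"
      by (simp add: power_mult_distrib dI_def yI_def)
    thus ?thesis by (rule power2_le_imp_le) (simp add: dI_def yI_def)
  qed
  show ?thesis by (rule that[OF \<sigma>(1)]) (use \<sigma>(4) est in \<open>simp_all add: yI_def dI_def\<close>)
qed

text \<open>The oscillation bound contains the integral of \<open>(norm (d r))\<^sup>2\<close> over
  the interval, which is uniformly small on short intervals. So \<open>\<iota> y\<close> is
  uniformly continuous on a set of full measure and extends to its closure. On the whole interval
  the same bound controls the point values by the norm of W(0,T).\<close>

theorem vderiv_continuous_representative:
  fixes y d :: "real \<Rightarrow> 'v::{real_inner, banach, second_countable_topology}"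
    and \<iota> :: "'v \<Rightarrow>\<^sub>L 'h::{real_inner, banach, second_countable_topology}"
  assumes "T > 0" and y: "vderiv \<iota> T UNIV y d"
  obtains g where "continuous_on {0..T} g" "AE t in time T. g t = \<iota> (y t)"
    "(norm (g T))\<^sup>2 - (norm (g 0))\<^sup>2 = 2 * (LINT t|time T. d t \<bullet> y t)"
    "\<And>t. t \<in> {0..T} \<Longrightarrow> norm (g t) \<le> (norm \<iota> / sqrt T + 1) * (sqrt (nsq (time T) y) + sqrt (nsq (time T) d))"
proof -
  have yL: "y \<in> Lsq (time T)" and dL: "d \<in> Lsq (time T)" using y by (auto simp: vderiv_def)
  obtain G where G: "G \<subseteq> {0<..<T}" "AE t in time T. t \<in> G"
    and incr: "\<And>s t v. s \<in> G \<Longrightarrow> t \<in> G \<Longrightarrow> (\<iota> (y t) - \<iota> (y s)) \<bullet> \<iota> v = (prim T d t - prim T d s) \<bullet> v"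
    and energy: "\<And>s t. s \<in> G \<Longrightarrow> t \<in> G \<Longrightarrow> (norm (\<iota> (y t)))\<^sup>2 - (norm (\<iota> (y s)))\<^sup>2
       = prim T (\<lambda>r. 2 * (d r \<bullet> y r)) t - prim T (\<lambda>r. 2 * (d r \<bullet> y r)) s"
    by (rule vderiv_energy_increments[OF \<open>T > 0\<close> y]) (rule that)
  have osc: "\<exists>\<sigma>\<in>G. (norm (y \<sigma>))\<^sup>2 * (b - a) \<le> nsq (time T) (\<lambda>r. indicator {a<..<b} r *\<^sub>R y r) \<and>
      (\<forall>t\<in>G. a < t \<longrightarrow> t < b \<longrightarrow> norm (\<iota> (y t) - \<iota> (y \<sigma>)) \<le>
      2 * sqrt (sqrt (nsq (time T) (\<lambda>r. indicator {a<..<b} r *\<^sub>R d r)) * sqrt (nsq (time T) (\<lambda>r. indicator {a<..<b} r *\<^sub>R y r))))"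
    if "0 \<le> a" "a < b" "b \<le> T" for a b
    by (rule vderiv_oscillation[OF yL dL G _ _ that]) ((rule incr; assumption) | (rule energy; assumption) | blast)+
  have clG: "closure G = {0..T}"
  proof
    show "closure G \<subseteq> {0..T}" using closure_mono[OF G(1)] closure_greaterThanLessThan[OF \<open>T > 0\<close>] by simp
    show "{0..T} \<subseteq> closure G"
    proof
      fix t assume t: "t \<in> {0..T}"
      show "t \<in> closure G" unfolding closure_approachable
      proof (intro allI impI)
        fix e :: real assume "e > 0"
        have "max 0 (t - e) < min T (t + e)" using t \<open>e > 0\<close> \<open>T > 0\<close> by auto
        from time_dense[OF G(2) _ this] obtain s where "s \<in> G" "max 0 (t - e) < s" "s < min T (t + e)" by auto
        thus "\<exists>s\<in>G. dist s t < e" by (intro bexI[of _ s]) (auto simp: dist_real_def)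
      qed
    qed
  qed
  have nI: "nsq (time T) (\<lambda>r. indicator {a<..<b} r *\<^sub>R f r) \<le> nsq (time T) f" if "f \<in> Lsq (time T)" for a b and f :: "real \<Rightarrow> 'v"
    unfolding nsq_def
    by (rule integral_mono) (use that Lsq_integrable[OF time_indicator_Lsq[OF that]] Lsq_integrable[OF that] in \<open>auto simp: indicator_def\<close>)
  have "uniformly_continuous_on G (\<lambda>t. \<iota> (y t))"
    unfolding uniformly_continuous_on_def
  proof (intro allI impI)
    fix e :: real assume e: "e > 0"
    define Y where "Y = sqrt (nsq (time T) y) + 1"
    have Y: "Y > 0" "sqrt (nsq (time T) y) \<le> Y" by (auto simp: Y_def add_nonneg_pos)
    \<comment> \<open>Chosen so that \<open>2 * sqrt (sqrt \<epsilon> * Y)\<close> equals 2e/5; two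
      deviations from the common time \<open>\<sigma>\<close> then add up to less than e.\<close>
    define \<epsilon> where "\<epsilon> = ((e / 5)\<^sup>2 / Y)\<^sup>2"
    have \<epsilon>: "\<epsilon> > 0" using e Y by (simp add: \<epsilon>_def)
    have "uniformly_continuous_on {0..T} (prim T (\<lambda>r. (norm (d r))\<^sup>2))"
      by (rule compact_uniformly_continuous[OF continuous_on_prim[OF Lsq_integrable[OF dL]]]) simp
    then obtain \<delta> where \<delta>: "\<delta> > 0" "\<And>a b. a \<in> {0..T} \<Longrightarrow> b \<in> {0..T} \<Longrightarrow> dist a b < \<delta> \<Longrightarrow>
        dist (prim T (\<lambda>r. (norm (d r))\<^sup>2) a) (prim T (\<lambda>r. (norm (d r))\<^sup>2) b) < \<epsilon>"
      unfolding uniformly_continuous_on_def using \<epsilon> by metis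
    have "dist (\<iota> (y t)) (\<iota> (y s)) < e" if st: "s \<in> G" "t \<in> G" "dist t s < \<delta> / 4" for s t
    proof -
      \<comment> \<open>A subinterval of [0, T] that contains both times in its interior and is
        still shorter than \<open>\<delta>\<close>.\<close>
      define a b where "a = max 0 (min s t - \<delta> / 4)" and "b = min T (max s t + \<delta> / 4)"
      have st': "s \<in> {0<..<T}" "t \<in> {0<..<T}" using st G by auto
      have ab: "0 \<le> a" "a < b" "b \<le> T" "a < s" "s < b" "a < t" "t < b" "b - a < \<delta>"
        using st' st(3) \<delta>(1) by (auto simp: a_def b_def dist_real_def min_def max_def)
      define dI where "dI = nsq (time T) (\<lambda>r. indicator {a<..<b} r *\<^sub>R d r)"
      define yI where "yI = nsq (time T) (\<lambda>r. indicator {a<..<b} r *\<^sub>R y r)"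
      obtain \<sigma> where "\<sigma> \<in> G" "(norm (y \<sigma>))\<^sup>2 * (b - a) \<le> yI"
        and \<sigma>: "\<And>t. t \<in> G \<Longrightarrow> a < t \<Longrightarrow> t < b \<Longrightarrow> norm (\<iota> (y t) - \<iota> (y \<sigma>)) \<le> 2 * sqrt (sqrt dI * sqrt yI)"
        using osc[OF ab(1-3)] unfolding dI_def yI_def by blast
      have "dI < \<epsilon>" unfolding dI_def nsq_time_indicator[OF dL ab(1) less_imp_le[OF ab(2)]]
        using \<delta>(2)[of b a] ab by (auto simp: dist_real_def)
      hence "sqrt dI < (e/5)\<^sup>2 / Y"
        using real_sqrt_less_mono[of dI \<epsilon>] Y e by (simp add: \<epsilon>_def del: power_divide)
      moreover have "sqrt yI \<le> Y" unfolding yI_def using nI[OF yL, of a b] Y(2) real_sqrt_le_mono order_trans by blast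
      ultimately have "sqrt dI * sqrt yI \<le> (e/5)\<^sup>2 / Y * Y"
        using Y e by (intro mult_mono) (auto simp: yI_def dI_def)
      hence "sqrt (sqrt dI * sqrt yI) \<le> e / 5" using Y e by (intro real_le_lsqrt) (auto simp: yI_def dI_def)
      hence "norm (\<iota> (y t) - \<iota> (y \<sigma>)) + norm (\<iota> (y s) - \<iota> (y \<sigma>)) < e"
        using \<sigma>[OF st(1) ab(4,5)] \<sigma>[OF st(2) ab(6,7)] e by linarith
      thus ?thesis using norm_triangle_ineq4[of "\<iota> (y t) - \<iota> (y \<sigma>)" "\<iota> (y s) - \<iota> (y \<sigma>)"] by (simp add: dist_norm)
    qed
    thus "\<exists>\<delta>>0. \<forall>s\<in>G. \<forall>t\<in>G. dist t s < \<delta> \<longrightarrow> dist (\<iota> (y t)) (\<iota> (y s)) < e"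
      using \<delta>(1) by (intro exI[of _ "\<delta> / 4"]) auto
  qed
  then obtain g where g: "uniformly_continuous_on (closure G) g" and gy: "\<And>t. t \<in> G \<Longrightarrow> \<iota> (y t) = g t"
    by (rule uniformly_continuous_on_extension_on_closure) blast
  have cg: "continuous_on {0..T} g" using uniformly_continuous_imp_continuous[OF g] clG by simp
  have dy: "integrable (time T) (\<lambda>r. 2 * (d r \<bullet> y r))" by (auto intro: integrable_inner_Lsq yL dL)
  \<comment> \<open>Constant on \<open>G\<close> by the energy increments, hence on [0, T] by
    continuity; its values at the end points give the energy identity.\<close>
  define E where "E t = (norm (g t))\<^sup>2 - prim T (\<lambda>r. 2 * (d r \<bullet> y r)) t" for t
  have cE: "continuous_on (closure G) E" unfolding E_def clG
    by (intro continuous_intros cg continuous_on_prim dy)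
  obtain s where s: "s \<in> G" using time_dense[OF G(2), of 0 T] \<open>T > 0\<close> by auto
  have Ec: "E t = E s" if "t \<in> {0..T}" for t
  proof (rule continuous_constant_on_closure[OF cE])
    show "E x = E s" if "x \<in> G" for x using energy[OF s that] gy s that by (simp add: E_def)
  qed (use that clG in simp)
  have "prim T (\<lambda>r. 2 * (d r \<bullet> y r)) T - prim T (\<lambda>r. 2 * (d r \<bullet> y r)) 0 = (LINT t|time T. 2 * (d t \<bullet> y t))"
    unfolding prim_diff[OF dy order_refl less_imp_le[OF \<open>T > 0\<close>]]
    by (rule Bochner_Integration.integral_cong) auto
  hence en: "(norm (g T))\<^sup>2 - (norm (g 0))\<^sup>2 = 2 * (LINT t|time T. d t \<bullet> y t)"
    using Ec[of 0] Ec[of T] \<open>T > 0\<close> by (simp add: E_def)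
  obtain \<sigma> where \<sigma>: "\<sigma> \<in> G" "(norm (y \<sigma>))\<^sup>2 * (T - 0) \<le> nsq (time T) (\<lambda>r. indicator {0<..<T} r *\<^sub>R y r)"
    "\<And>t. t \<in> G \<Longrightarrow> 0 < t \<Longrightarrow> t < T \<Longrightarrow> norm (\<iota> (y t) - \<iota> (y \<sigma>)) \<le>
      2 * sqrt (sqrt (nsq (time T) (\<lambda>r. indicator {0<..<T} r *\<^sub>R d r)) * sqrt (nsq (time T) (\<lambda>r. indicator {0<..<T} r *\<^sub>R y r)))"
    using osc[OF order_refl \<open>T > 0\<close> order_refl] by blast
  define a b where "a = sqrt (nsq (time T) y)" and "b = sqrt (nsq (time T) d)"
  have ab: "a \<ge> 0" "b \<ge> 0" by (auto simp: a_def b_def)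
  \<comment> \<open>At \<open>\<sigma>\<close> the V-norm is at most \<open>a / sqrt T\<close>, and
    the oscillation over (0, T) is at most \<open>2 * sqrt (b * a) \<le> a + b\<close>.\<close>
  have bound: "norm (g t) \<le> (norm \<iota> / sqrt T + 1) * (a + b)" if t: "t \<in> G" for t
  proof -
    have "(norm (y \<sigma>))\<^sup>2 * T \<le> a\<^sup>2" using \<sigma>(2) nI[OF yL, of 0 T] by (simp add: a_def)
    hence "(norm (y \<sigma>))\<^sup>2 \<le> (a / sqrt T)\<^sup>2" using \<open>T > 0\<close> by (simp add: power_divide field_simps)
    hence "norm (y \<sigma>) \<le> a / sqrt T" by (rule power2_le_imp_le) (use ab \<open>T > 0\<close> in simp)
    hence "norm (\<iota> (y \<sigma>)) \<le> norm \<iota> * (a / sqrt T)"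
      using norm_blinfun[of \<iota> "y \<sigma>"] mult_left_mono[of "norm (y \<sigma>)" "a / sqrt T" "norm \<iota>"] by simp
    moreover have "2 * sqrt (sqrt (nsq (time T) (\<lambda>r. indicator {0<..<T} r *\<^sub>R d r)) * sqrt (nsq (time T) (\<lambda>r. indicator {0<..<T} r *\<^sub>R y r))) \<le> 2 * sqrt (b * a)"
      using nI[OF yL, of 0 T] nI[OF dL, of 0 T] by (simp add: a_def b_def mult_mono)
    moreover have "2 * sqrt (b * a) \<le> a + b" using arith_geo_mean_sqrt[OF ab(2,1)] by simp
    moreover have "norm (g t) \<le> norm (\<iota> (y t) - \<iota> (y \<sigma>)) + norm (\<iota> (y \<sigma>))"
      using norm_triangle_ineq[of "\<iota> (y t) - \<iota> (y \<sigma>)" "\<iota> (y \<sigma>)"] gy[OF t] by simp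
    moreover have "norm (\<iota> (y t) - \<iota> (y \<sigma>)) \<le> 2 * sqrt (sqrt (nsq (time T) (\<lambda>r. indicator {0<..<T} r *\<^sub>R d r)) * sqrt (nsq (time T) (\<lambda>r. indicator {0<..<T} r *\<^sub>R y r)))"
      by (rule \<sigma>(3)) (use t G in auto)
    moreover have "norm \<iota> * (a / sqrt T) + (a + b) \<le> (norm \<iota> / sqrt T + 1) * (a + b)"
      using mult_nonneg_nonneg[of "norm \<iota> / sqrt T" b] ab \<open>T > 0\<close> by (simp add: distrib_left distrib_right)
    ultimately show ?thesis by linarith
  qed
  have "norm (g t) \<le> (norm \<iota> / sqrt T + 1) * (a + b)" if "t \<in> {0..T}" for t
    by (rule continuous_le_on_closure[of G "\<lambda>t. norm (g t)"])
      (use bound that clG cg in \<open>auto intro!: continuous_intros\<close>)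
  thus ?thesis using G(2) gy en by (intro that[OF cg]) (auto simp: a_def b_def elim: eventually_mono)
qed

section \<open>The solution spaces\<close>

lemma Lsq_bounded_linear:
  assumes "bounded_linear F" "f \<in> Lsq M" shows "(\<lambda>t. F (f t)) \<in> Lsq M"
  using Lsq_blinfun(1)[OF assms(2), of "Blinfun F"] by (simp add: bounded_linear_Blinfun_apply[OF assms(1)])

lemma pivot_apply [simp]: "pivot \<iota> h v = h \<bullet> \<iota> v"
  by (simp add: pivot_def)

lemma bounded_linear_pivot: "bounded_linear (pivot \<iota>)"
  unfolding pivot_def
  by (rule bounded_linear_compose[OF bounded_bilinear.bounded_linear_left[OF bounded_bilinear_blinfun_compose]
      bounded_linear_blinfun_inner_right])

lemma L2_rz_iff:
  fixes w :: "real \<Rightarrow> ('v::{real_inner, banach} \<Rightarrow>\<^sub>L real)"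
  shows "w \<in> L2 T \<longleftrightarrow> (\<lambda>t. rz (w t)) \<in> Lsq (time T)"
  using Lsq_bounded_linear[OF bounded_linear_rz, of w "time T"]
    Lsq_bounded_linear[OF bounded_linear_blinfun_inner_right, of "\<lambda>t. rz (w t)" "time T"]
  by (auto simp: L2_Lsq)

lemma has_weak_deriv_iff:
  fixes w :: "real \<Rightarrow> ('v::{real_inner, banach} \<Rightarrow>\<^sub>L real)"
  assumes "y \<in> Lsq (time T)"
  shows "w \<in> L2 T \<and> has_weak_deriv T S (\<lambda>t. pivot \<iota> (\<iota> (y t))) w \<longleftrightarrow> vderiv \<iota> T S y (\<lambda>t. rz (w t))"
  using assms by (auto simp: has_weak_deriv_def vderiv_def L2_rz_iff)

lemma W_iff:
  fixes y :: "real \<Rightarrow> 'v::{real_inner, banach}"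
  shows "y \<in> W \<iota> T S \<longleftrightarrow> y \<in> Lsq (time T) \<and> (AE t in time T. y t \<in> S) \<and> (\<exists>d. vderiv \<iota> T S y d)"
proof -
  have "(\<exists>w. w \<in> L2 T \<and> has_weak_deriv T S (\<lambda>t. pivot \<iota> (\<iota> (y t))) w) \<longleftrightarrow> (\<exists>d. vderiv \<iota> T S y d)"
    if y: "y \<in> Lsq (time T)"
  proof
    assume "\<exists>w. w \<in> L2 T \<and> has_weak_deriv T S (\<lambda>t. pivot \<iota> (\<iota> (y t))) w"
    thus "\<exists>d. vderiv \<iota> T S y d" using has_weak_deriv_iff[OF y] by blast
  next
    assume "\<exists>d. vderiv \<iota> T S y d"
    then obtain d where "vderiv \<iota> T S y (\<lambda>t. rz (riesz (d t)))" by auto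
    thus "\<exists>w. w \<in> L2 T \<and> has_weak_deriv T S (\<lambda>t. pivot \<iota> (\<iota> (y t))) w"
      using has_weak_deriv_iff[OF y, of "\<lambda>t. riesz (d t)" S \<iota>] by blast
  qed
  moreover have "(\<lambda>t. pivot \<iota> (\<iota> (y t))) \<in> L2 T" if "y \<in> Lsq (time T)"
    unfolding L2_Lsq by (rule Lsq_bounded_linear[OF bounded_linear_pivot Lsq_blinfun(1)[OF that]])
  ultimately show ?thesis unfolding W_def H1_dual_def L2_in_def L2_Lsq by blast
qed

definition dt where "dt \<iota> T S y t = rz (time_deriv \<iota> T S y t)"

lemma inner_dt [simp]: "dt \<iota> T S y t \<bullet> v = time_deriv \<iota> T S y t v"
  by (simp add: dt_def)

lemma W_D:
  fixes y :: "real \<Rightarrow> 'v::{real_inner, banach}"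
  assumes "y \<in> W \<iota> T S"
  shows "y \<in> Lsq (time T)" "AE t in time T. y t \<in> S" "vderiv \<iota> T S y (dt \<iota> T S y)" "dt \<iota> T S y \<in> Lsq (time T)"
proof -
  show y: "y \<in> Lsq (time T)" "AE t in time T. y t \<in> S" using assms by (auto simp: W_iff)
  have "\<exists>w. w \<in> L2 T \<and> has_weak_deriv T S (\<lambda>t. pivot \<iota> (\<iota> (y t))) w"
    using assms by (auto simp: W_def H1_dual_def)
  from someI_ex[OF this] show d: "vderiv \<iota> T S y (dt \<iota> T S y)"
    unfolding dt_def[abs_def] time_deriv_def[symmetric] has_weak_deriv_iff[OF y(1), symmetric] .
  thus "dt \<iota> T S y \<in> Lsq (time T)" by (simp add: vderiv_def)
qed

lemma vderiv_lincomb: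
  fixes y z :: "real \<Rightarrow> 'v::{real_inner, banach, second_countable_topology}"
    and \<iota> :: "'v \<Rightarrow>\<^sub>L 'h::{real_inner, banach, second_countable_topology}"
  assumes "vderiv \<iota> T S y d" "vderiv \<iota> T S z e"
  shows "vderiv \<iota> T S (\<lambda>t. y t + c *\<^sub>R z t) (\<lambda>t. d t + c *\<^sub>R e t)"
  unfolding vderiv_def
proof (intro conjI ballI)
  have L: "y \<in> Lsq (time T)" "d \<in> Lsq (time T)" "z \<in> Lsq (time T)" "e \<in> Lsq (time T)"
    using assms by (auto simp: vderiv_def)
  show "(\<lambda>t. y t + c *\<^sub>R z t) \<in> Lsq (time T)" "(\<lambda>t. d t + c *\<^sub>R e t) \<in> Lsq (time T)"
    by (intro Lsq_add Lsq_scaleR L)+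
  fix \<phi> v assume \<phi>: "\<phi> \<in> test_functions T" and v: "v \<in> S"
  have i: "integrable (time T) (\<lambda>t. \<psi> t * (f t \<bullet> w))"
    if "\<psi> \<in> test_functions T" and f: "f \<in> Lsq (time T)" for \<psi> and f :: "real \<Rightarrow> 'b::{real_inner, second_countable_topology}" and w
  proof -
    obtain K where "\<And>t. \<bar>\<psi> t\<bar> \<le> K" using test_function_bounded[OF \<open>\<psi> \<in> test_functions T\<close>] by metis
    thus ?thesis
      by (rule integral_weighted_inner(1)[OF borel_measurable_time[OF test_function_measurable[OF \<open>\<psi> \<in> test_functions T\<close>]] _ f time_const_Lsq])
  qed
  note i' = i[OF deriv_test_function[OF \<phi>] Lsq_blinfun(1)] i[OF \<phi>]
  have "(LINT t|time T. deriv \<phi> t * (\<iota> (y t + c *\<^sub>R z t) \<bullet> \<iota> v))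
      = (LINT t|time T. deriv \<phi> t * (\<iota> (y t) \<bullet> \<iota> v)) + c * (LINT t|time T. deriv \<phi> t * (\<iota> (z t) \<bullet> \<iota> v))"
    using i'(1)[OF L(1), of \<iota> "\<iota> v"] i'(1)[OF L(3), of \<iota> "\<iota> v"]
    by (simp add: blinfun.add_right blinfun.scaleR_right inner_add_left distrib_left mult.left_commute[of _ c])
  also have "\<dots> = - ((LINT t|time T. \<phi> t * (d t \<bullet> v)) + c * (LINT t|time T. \<phi> t * (e t \<bullet> v)))"
    using assms \<phi> v by (simp add: vderiv_def)
  also have "(LINT t|time T. \<phi> t * (d t \<bullet> v)) + c * (LINT t|time T. \<phi> t * (e t \<bullet> v))
      = (LINT t|time T. \<phi> t * ((d t + c *\<^sub>R e t) \<bullet> v))"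
    using i'(2)[OF L(2), of v] i'(2)[OF L(4), of v]
    by (simp add: inner_add_left distrib_left mult.left_commute[of _ c])
  finally show "(LINT t|time T. deriv \<phi> t * (\<iota> (y t + c *\<^sub>R z t) \<bullet> \<iota> v)) = - (LINT t|time T. \<phi> t * ((d t + c *\<^sub>R e t) \<bullet> v))" .
qed

text \<open>Writing \<open>S\<close> as the range of an operator turns test vectors in
  \<open>S\<close> into arbitrary vectors, for which a countable dense set reduces the claim to
  countably many null sets.\<close>

lemma vderiv_unique:
  fixes y d e :: "real \<Rightarrow> 'v::{real_inner, banach, second_countable_topology}"
    and \<pi> :: "'v \<Rightarrow>\<^sub>L 'v"
  assumes "vderiv \<iota> T S y d" "vderiv \<iota> T S y e" and S: "S = range \<pi>"
  shows "AE t in time T. \<forall>v\<in>S. d t \<bullet> v = e t \<bullet> v"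
proof -
  have L: "d \<in> Lsq (time T)" "e \<in> Lsq (time T)" using assms by (auto simp: vderiv_def)
  obtain D :: "'v set" where D: "countable D" "\<And>X. open X \<Longrightarrow> X \<noteq> {} \<Longrightarrow> \<exists>d\<in>D. d \<in> X"
    using countable_dense_setE by blast
  have "AE t in time T. (d t - e t) \<bullet> \<pi> v = 0" for v
  proof (rule fundamental_lemma)
    note de = time.Lsq_integrable1[OF Lsq_diff[OF L]]
    show "integrable (time T) (\<lambda>t. (d t - e t) \<bullet> \<pi> v)" by (intro integrable_inner_left de)
    fix \<phi> assume \<phi>: "\<phi> \<in> test_functions T"
    obtain K where K: "\<And>t. \<bar>\<phi> t\<bar> \<le> K" using test_function_bounded[OF \<phi>] by metis
    have i: "integrable (time T) (\<lambda>t. \<phi> t * (f t \<bullet> w))" if f: "f \<in> Lsq (time T)" for f :: "real \<Rightarrow> 'v" and w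
      by (rule integral_weighted_inner(1)[OF borel_measurable_time[OF test_function_measurable[OF \<phi>]] K f time_const_Lsq])
    have "(LINT t|time T. \<phi> t * (d t \<bullet> \<pi> v)) = (LINT t|time T. \<phi> t * (e t \<bullet> \<pi> v))"
      using assms \<phi> by (fastforce simp: vderiv_def)
    thus "(LINT t|time T. \<phi> t * ((d t - e t) \<bullet> \<pi> v)) = 0"
      using i[OF L(1)] i[OF L(2)] by (simp add: inner_diff_left right_diff_distrib)
  qed
  hence "AE t in time T. \<forall>v\<in>D. (d t - e t) \<bullet> \<pi> v = 0" using D(1) by (simp add: AE_ball_countable)
  thus ?thesis
  proof eventually_elim
    case (elim t)
    have "(d t - e t) \<bullet> \<pi> v = 0" for v
    proof -
      have "closed {v. (d t - e t) \<bullet> \<pi> v = 0}"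
        by (intro closed_Collect_eq continuous_intros linear_continuous_on blinfun.bounded_linear_right)
      moreover have "v \<in> closure D" using D(2) by (auto simp: closure_iff_nhds_not_empty)
      ultimately show ?thesis using closure_minimal[of D "{v. (d t - e t) \<bullet> \<pi> v = 0}"] elim by auto
    qed
    thus ?case by (auto simp: S inner_diff_left)
  qed
qed

lemma vderiv_UNIV_unique:
  fixes y d e :: "real \<Rightarrow> 'v::{real_inner, banach, second_countable_topology}"
  assumes "vderiv \<iota> T UNIV y d" "vderiv \<iota> T UNIV y e"
  shows "AE t in time T. d t = e t"
proof -
  have "AE t in time T. \<forall>v\<in>UNIV. d t \<bullet> v = e t \<bullet> v"
    by (rule vderiv_unique[OF assms, of id_blinfun]) simp
  thus ?thesis
  proof eventually_elim
    case (elim t)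
    hence "(d t - e t) \<bullet> (d t - e t) = 0" by (simp add: inner_diff_left)
    thus ?case by simp
  qed
qed

lemma dt_unique:
  fixes y :: "real \<Rightarrow> 'v::{real_inner, banach, second_countable_topology}"
  assumes "vderiv \<iota> T UNIV y d"
  shows "y \<in> W \<iota> T UNIV" "AE t in time T. dt \<iota> T UNIV y t = d t"
proof -
  show y: "y \<in> W \<iota> T UNIV" using assms by (auto simp: W_iff vderiv_def)
  show "AE t in time T. dt \<iota> T UNIV y t = d t" by (rule vderiv_UNIV_unique[OF W_D(3)[OF y] assms])
qed

lemma W_lincomb:
  fixes y z :: "real \<Rightarrow> 'v::{real_inner, banach, second_countable_topology}"
    and \<iota> :: "'v \<Rightarrow>\<^sub>L 'h::{real_inner, banach, second_countable_topology}"
  assumes "y \<in> W \<iota> T S" "z \<in> W \<iota> T S" "subspace S"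
  shows "(\<lambda>t. y t + c *\<^sub>R z t) \<in> W \<iota> T S"
proof -
  have "AE t in time T. y t + c *\<^sub>R z t \<in> S"
    using W_D(2)[OF assms(1)] W_D(2)[OF assms(2)]
    by eventually_elim (intro subspace_add[OF assms(3)] subspace_scale[OF assms(3)])
  thus ?thesis
    using vderiv_lincomb[OF W_D(3)[OF assms(1)] W_D(3)[OF assms(2)], of c] by (auto simp: W_iff vderiv_def)
qed

lemma W_zero: "(\<lambda>t. 0) \<in> W \<iota> T S" if "0 \<in> S" for \<iota> :: "'v::{real_inner, banach} \<Rightarrow>\<^sub>L 'h::real_inner"
  using that by (auto simp: W_iff vderiv_def blinfun.zero_right time_const_Lsq intro!: exI[of _ "\<lambda>_. 0"])

lemma dt_lincomb:
  fixes y z :: "real \<Rightarrow> 'v::{real_inner, banach, second_countable_topology}"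
    and \<iota> :: "'v \<Rightarrow>\<^sub>L 'h::{real_inner, banach, second_countable_topology}"
  assumes "y \<in> W \<iota> T UNIV" "z \<in> W \<iota> T UNIV"
  shows "AE t in time T. dt \<iota> T UNIV (\<lambda>t. y t + c *\<^sub>R z t) t = dt \<iota> T UNIV y t + c *\<^sub>R dt \<iota> T UNIV z t"
  by (rule dt_unique(2)[OF vderiv_lincomb[OF W_D(3)[OF assms(1)] W_D(3)[OF assms(2)]]])

section \<open>Point values and integration by parts\<close>

lemma continuous_AE_eq:
  fixes f g :: "real \<Rightarrow> 'a::metric_space"
  assumes "continuous_on {0..T} f" "continuous_on {0..T} g" "AE t in time T. f t = g t" "T > 0" "s \<in> {0..T}"
  shows "f s = g s"
proof -
  define G where "G = {t \<in> {0<..<T}. f t = g t}"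
  have G: "AE t in time T. t \<in> G" using assms(3) AE_space by eventually_elim (auto simp: G_def)
  have sG: "s \<in> closure G" unfolding closure_approachable
  proof (intro allI impI)
    fix e :: real assume "e > 0"
    have "max 0 (s - e) < min T (s + e)" using assms(4,5) \<open>e > 0\<close> by auto
    from time_dense[OF G _ this] obtain t where "t \<in> G" "max 0 (s - e) < t" "t < min T (s + e)" by auto
    thus "\<exists>t\<in>G. dist t s < e" by (intro bexI[of _ t]) (auto simp: dist_real_def)
  qed
  have "G \<subseteq> {0<..<T}" by (auto simp: G_def)
  hence cl: "closure G \<subseteq> {0..T}"
    using closure_mono closure_greaterThanLessThan[OF assms(4)] by metis
  have "continuous_on (closure G) (\<lambda>t. dist (f t) (g t))"
    by (intro continuous_intros continuous_on_subset[OF assms(1) cl] continuous_on_subset[OF assms(2) cl])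
  from continuous_constant_on_closure[OF this _ sG, of 0] show ?thesis by (simp add: G_def)
qed

lemma point_value_eq:
  fixes \<iota> :: "'v::real_normed_vector \<Rightarrow>\<^sub>L 'h::real_inner"
  assumes "T > 0" "continuous_on {0..T} g" "AE t in time T. g t = \<iota> (y t)" "s \<in> {0..T}"
  shows "point_value \<iota> T y s = g s"
  unfolding point_value_def
proof (rule the_equality)
  show "\<exists>g'. continuous_on {0..T} g' \<and> (AE t in time T. g' t = \<iota> (y t)) \<and> g s = g' s" using assms by blast
  fix h assume "\<exists>g'. continuous_on {0..T} g' \<and> (AE t in time T. g' t = \<iota> (y t)) \<and> h = g' s"
  then obtain g' where g': "continuous_on {0..T} g'" "AE t in time T. g' t = \<iota> (y t)" "h = g' s" by blast
  have "AE t in time T. g' t = g t" using g'(2) assms(3) by eventually_elim simp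
  from continuous_AE_eq[OF g'(1) assms(2) this assms(1,4)] show "h = g s" by (simp add: g'(3))
qed

lemma point_value_W:
  fixes y :: "real \<Rightarrow> 'v::{real_inner, banach, second_countable_topology}"
    and \<iota> :: "'v \<Rightarrow>\<^sub>L 'h::{real_inner, banach, second_countable_topology}"
  assumes "T > 0" and y: "y \<in> W \<iota> T UNIV"
  shows "continuous_on {0..T} (point_value \<iota> T y)" "AE t in time T. point_value \<iota> T y t = \<iota> (y t)"
    "(norm (point_value \<iota> T y T))\<^sup>2 - (norm (point_value \<iota> T y 0))\<^sup>2 = 2 * (LINT t|time T. dt \<iota> T UNIV y t \<bullet> y t)"
    "\<And>t. t \<in> {0..T} \<Longrightarrow> norm (point_value \<iota> T y t)
      \<le> (norm \<iota> / sqrt T + 1) * (sqrt (nsq (time T) y) + sqrt (nsq (time T) (dt \<iota> T UNIV y)))"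
proof -
  obtain g where g: "continuous_on {0..T} g" "AE t in time T. g t = \<iota> (y t)"
    "(norm (g T))\<^sup>2 - (norm (g 0))\<^sup>2 = 2 * (LINT t|time T. dt \<iota> T UNIV y t \<bullet> y t)"
    "\<And>t. t \<in> {0..T} \<Longrightarrow> norm (g t) \<le> (norm \<iota> / sqrt T + 1) * (sqrt (nsq (time T) y) + sqrt (nsq (time T) (dt \<iota> T UNIV y)))"
    using vderiv_continuous_representative[OF \<open>T > 0\<close> W_D(3)[OF y]] by blast
  note pv = point_value_eq[OF \<open>T > 0\<close> g(1,2)]
  show "continuous_on {0..T} (point_value \<iota> T y)" 
    by (rule continuous_on_eq[OF g(1) pv[symmetric]])
  show "AE t in time T. point_value \<iota> T y t = \<iota> (y t)"
    using g(2) AE_space by eventually_elim (simp add: pv)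
  show "(norm (point_value \<iota> T y T))\<^sup>2 - (norm (point_value \<iota> T y 0))\<^sup>2 = 2 * (LINT t|time T. dt \<iota> T UNIV y t \<bullet> y t)"
    using g(3) pv \<open>T > 0\<close> by simp
  show "norm (point_value \<iota> T y t)
      \<le> (norm \<iota> / sqrt T + 1) * (sqrt (nsq (time T) y) + sqrt (nsq (time T) (dt \<iota> T UNIV y)))" if "t \<in> {0..T}" for t
    using g(4) pv that by simp
qed

lemma point_value_lincomb:
  fixes y z :: "real \<Rightarrow> 'v::{real_inner, banach, second_countable_topology}"
    and \<iota> :: "'v \<Rightarrow>\<^sub>L 'h::{real_inner, banach, second_countable_topology}"
  assumes "T > 0" and y: "y \<in> W \<iota> T UNIV" and z: "z \<in> W \<iota> T UNIV" and s: "s \<in> {0..T}"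
  shows "point_value \<iota> T (\<lambda>t. y t + c *\<^sub>R z t) s = point_value \<iota> T y s + c *\<^sub>R point_value \<iota> T z s"
proof (rule point_value_eq[OF \<open>T > 0\<close> _ _ s])
  show "continuous_on {0..T} (\<lambda>s. point_value \<iota> T y s + c *\<^sub>R point_value \<iota> T z s)"
    by (intro continuous_intros point_value_W[OF \<open>T > 0\<close>] y z)
  show "AE t in time T. point_value \<iota> T y t + c *\<^sub>R point_value \<iota> T z t = \<iota> (y t + c *\<^sub>R z t)"
    using point_value_W(2)[OF \<open>T > 0\<close> y] point_value_W(2)[OF \<open>T > 0\<close> z]
    by eventually_elim (simp add: blinfun.add_right blinfun.scaleR_right)
qed

text \<open>Polarization: the energy identity for \<open>y + z\<close> minus those for
  \<open>y\<close> and \<open>z\<close>.\<close>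

lemma integration_by_parts:
  fixes y z :: "real \<Rightarrow> 'v::{real_inner, banach, second_countable_topology}"
    and \<iota> :: "'v \<Rightarrow>\<^sub>L 'h::{real_inner, banach, second_countable_topology}"
  assumes T: "T > 0" and y: "y \<in> W \<iota> T UNIV" and z: "z \<in> W \<iota> T UNIV"
  shows "(LINT t|time T. dt \<iota> T UNIV y t \<bullet> z t) + (LINT t|time T. dt \<iota> T UNIV z t \<bullet> y t)
    = point_value \<iota> T y T \<bullet> point_value \<iota> T z T - point_value \<iota> T y 0 \<bullet> point_value \<iota> T z 0"
proof -
  define w where "w = (\<lambda>t. y t + z t)"
  have w1: "w = (\<lambda>t. y t + 1 *\<^sub>R z t)" by (simp add: w_def)
  have w: "w \<in> W \<iota> T UNIV" unfolding w1 by (rule W_lincomb[OF y z]) simp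
  let ?d = "dt \<iota> T UNIV" and ?p = "point_value \<iota> T"
  have i: "integrable (time T) (\<lambda>t. ?d a t \<bullet> b t)" if "a \<in> W \<iota> T UNIV" "b \<in> W \<iota> T UNIV" for a b
    by (rule integrable_inner_Lsq[OF W_D(4)[OF that(1)] W_D(1)[OF that(2)]])
  have "(LINT t|time T. ?d w t \<bullet> w t) = (LINT t|time T. ?d y t \<bullet> y t + ?d z t \<bullet> z t + (?d y t \<bullet> z t + ?d z t \<bullet> y t))"
  proof (rule integral_cong_AE)
    show "AE t in time T. ?d w t \<bullet> w t = ?d y t \<bullet> y t + ?d z t \<bullet> z t + (?d y t \<bullet> z t + ?d z t \<bullet> y t)"
      using dt_lincomb[OF y z, of 1, folded w1]
    proof eventually_elim
      case (elim t)
      show ?case unfolding elim by (simp add: w_def inner_add_left inner_add_right del: inner_dt)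
    qed
  qed (use i[OF w w] i[OF y y] i[OF z z] i[OF y z] i[OF z y] in auto)
  also have "\<dots> = (LINT t|time T. ?d y t \<bullet> y t) + (LINT t|time T. ?d z t \<bullet> z t)
     + ((LINT t|time T. ?d y t \<bullet> z t) + (LINT t|time T. ?d z t \<bullet> y t))"
    using i[OF y y] i[OF z z] i[OF y z] i[OF z y] by simp
  finally have e: "(LINT t|time T. ?d w t \<bullet> w t) = \<dots>" .
  have p: "?p w s = ?p y s + ?p z s" if "s \<in> {0..T}" for s
    using point_value_lincomb[OF T y z that, of 1, folded w1] by simp
  have "0 \<in> {0..T}" "T \<in> {0..T}" using T by auto
  note p' = p[OF this(1)] p[OF this(2)]
  show ?thesis
    using point_value_W(3)[OF T w] point_value_W(3)[OF T y] point_value_W(3)[OF T z] e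
    unfolding p' power2_norm_eq_inner inner_add_left inner_add_right inner_commute[of "?p z _" "?p y _"]
    by argo
qed

section \<open>Parabolic equations tested on a subspace\<close>

text \<open>The subspace \<open>S\<close> is the whole space or \<open>V\<^sub>r\<close>; \<open>\<pi>\<close> is the \<open>V\<close>-orthogonal projection onto \<open>S\<close>,
  and \<open>q\<close> is the \<open>H\<close>-orthogonal projection onto the image of \<open>S\<close>, restricted to \<open>V\<close>. The latter turns weak
  derivatives tested on \<open>S\<close> into weak derivatives tested on all of \<open>V\<close>.\<close>

locale galerkin_space =
  fixes \<iota> :: "'v::{real_inner, banach, second_countable_topology}
      \<Rightarrow>\<^sub>L 'h::{real_inner, banach, second_countable_topology}"
    and T :: real and S :: "'v set" and \<pi> q :: "'v \<Rightarrow>\<^sub>L 'v"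
  assumes T: "T > 0"
    and S_range: "S = range \<pi>"
    and \<pi>_id: "s \<in> S \<Longrightarrow> \<pi> s = s"
    and \<pi>_adj: "\<pi> x \<bullet> y = x \<bullet> \<pi> y"
    and q_S: "q v \<in> S"
    and q_id: "s \<in> S \<Longrightarrow> q s = s"
    and q_adj: "\<iota> (q v) \<bullet> \<iota> w = \<iota> v \<bullet> \<iota> (q w)"
begin

abbreviation "ddt \<equiv> dt \<iota> T UNIV"
abbreviation "pv \<equiv> point_value \<iota> T"

lemma \<pi>_S: "\<pi> v \<in> S"
  by (simp add: S_range)

lemma subspace_S: "subspace S"
  unfolding S_range
  by (rule linear_subspace_image[OF _ subspace_UNIV]) (simp add: bounded_linear.linear blinfun.bounded_linear_right)

lemma W_sub:
  assumes y: "y \<in> W \<iota> T S"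
  shows "y \<in> W \<iota> T UNIV" "AE t in time T. \<forall>v\<in>S. dt \<iota> T S y t \<bullet> v = ddt y t \<bullet> v"
proof -
  \<comment> \<open>The V-adjoint of \<open>q\<close>: testing \<open>Q (dt \<iota> T S y t)\<close>
    with \<open>v\<close> amounts to testing the derivative on \<open>S\<close> with
    \<open>q v\<close>. Since \<open>y\<close> has values in \<open>S\<close>, the same replacement
    of \<open>v\<close> by \<open>q v\<close> is harmless for \<open>\<iota> (y t)\<close>.\<close>
  define Q where "Q x = rz (riesz x o\<^sub>L q)" for x :: 'v
  have Q: "Q x \<bullet> v = x \<bullet> q v" for x v by (simp add: Q_def)
  have Qb: "bounded_linear Q" unfolding Q_def
    by (rule bounded_linear_compose[OF bounded_linear_rz bounded_linear_compose[OF
        bounded_bilinear.bounded_linear_left[OF bounded_bilinear_blinfun_compose] bounded_linear_blinfun_inner_right]])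
  note D = W_D[OF y]
  have "vderiv \<iota> T UNIV y (\<lambda>t. Q (dt \<iota> T S y t))"
    unfolding vderiv_def
  proof (intro conjI ballI D(1) Lsq_bounded_linear[OF Qb D(4)])
    fix \<phi> v assume \<phi>: "\<phi> \<in> test_functions T"
    have "(LINT t|time T. deriv \<phi> t * (\<iota> (y t) \<bullet> \<iota> v)) = (LINT t|time T. deriv \<phi> t * (\<iota> (y t) \<bullet> \<iota> (q v)))"
    proof (rule integral_cong_AE)
      show "AE t in time T. deriv \<phi> t * (\<iota> (y t) \<bullet> \<iota> v) = deriv \<phi> t * (\<iota> (y t) \<bullet> \<iota> (q v))"
        using D(2) by eventually_elim (simp add: q_id flip: q_adj)
      have "(\<lambda>t. deriv \<phi> t * (\<iota> (y t) \<bullet> w)) \<in> borel_measurable (time T)" for w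
        by (intro borel_measurable_times borel_measurable_inner borel_measurable_const
            borel_measurable_time[OF test_function_measurable[OF deriv_test_function[OF \<phi>]]]
            Lsq_measurable[OF Lsq_blinfun(1)[OF D(1)]])
      thus "(\<lambda>t. deriv \<phi> t * (\<iota> (y t) \<bullet> \<iota> v)) \<in> borel_measurable (time T)"
        "(\<lambda>t. deriv \<phi> t * (\<iota> (y t) \<bullet> \<iota> (q v))) \<in> borel_measurable (time T)" by blast+
    qed
    also have "\<dots> = - (LINT t|time T. \<phi> t * (dt \<iota> T S y t \<bullet> q v))"
      using D(3) \<phi> q_S unfolding vderiv_def by blast
    finally show "(LINT t|time T. deriv \<phi> t * (\<iota> (y t) \<bullet> \<iota> v)) = - (LINT t|time T. \<phi> t * (Q (dt \<iota> T S y t) \<bullet> v))"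
      unfolding Q .
  qed
  from dt_unique[OF this] show "y \<in> W \<iota> T UNIV" and ae: "AE t in time T. \<forall>v\<in>S. dt \<iota> T S y t \<bullet> v = ddt y t \<bullet> v"
    by (auto simp: Q q_id simp del: inner_dt elim!: eventually_mono)
qed

text \<open>A point value is only a limit of elements of the image of \<open>S\<close>, which need
  not be closed in H. Orthogonality is what passes to the limit.\<close>

lemma pv_orthogonal:
  assumes y: "y \<in> W \<iota> T S" and x: "\<And>s. s \<in> S \<Longrightarrow> x \<bullet> \<iota> s = 0" and t: "t \<in> {0..T}"
  shows "x \<bullet> pv y t = 0"
proof (rule continuous_AE_eq[OF _ _ _ T t])
  note P = point_value_W[OF T W_sub(1)[OF y]]
  show "continuous_on {0..T} (\<lambda>t. x \<bullet> pv y t)" by (intro continuous_intros P)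
  show "AE t in time T. x \<bullet> pv y t = 0"
    using P(2) W_D(2)[OF y] by eventually_elim (simp add: x)
qed simp

text \<open>The previous lemma with the initial value itself as \<open>x\<close>: it is orthogonal
  to itself.\<close>

lemma pv_eq_0:
  assumes y: "y \<in> W \<iota> T S" and x: "\<And>s. s \<in> S \<Longrightarrow> pv y 0 \<bullet> \<iota> s = 0"
  shows "pv y 0 = 0"
  using pv_orthogonal[OF y x, of 0] T by simp

end

locale parabolic = galerkin_space \<iota> T S \<pi> q
  for \<iota> :: "'v::{real_inner, banach, second_countable_topology}
      \<Rightarrow>\<^sub>L 'h::{real_inner, banach, second_countable_topology}"
    and T S \<pi> q +
  fixes A :: "real \<Rightarrow> ('v \<Rightarrow>\<^sub>L ('v \<Rightarrow>\<^sub>L real))" and \<eta> :: real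
  assumes A_meas: "\<And>z w. (\<lambda>t. A t z w) \<in> borel_measurable (time T)"
    and A_bounded: "\<exists>K. AE t in time T. norm (A t) \<le> K"
    and \<eta>: "\<eta> > 0"
    and A_coercive: "\<And>t z. t \<in> {0<..<T} \<Longrightarrow> A t z z \<ge> \<eta> * (norm z)\<^sup>2"
begin

lemma A_Lsq:
  assumes "y \<in> Lsq (time T)"
  shows "(\<lambda>t. rz (A t (y t))) \<in> Lsq (time T)" "(\<lambda>t. rz (dual_op (A t) (y t))) \<in> Lsq (time T)"
proof -
  obtain K where K: "AE t in time T. norm (A t) \<le> K" using A_bounded by blast
  note m = borel_measurable_dual_opD[OF A_meas Lsq_measurable[OF assms]]
  show "(\<lambda>t. rz (A t (y t))) \<in> Lsq (time T)"
  proof (rule Lsq_bound(1)[OF assms m(1), of K])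
    show "AE t in time T. norm (rz (A t (y t))) \<le> K * norm (y t)" using K
    proof eventually_elim
      case (elim t)
      have "norm (A t (y t)) \<le> norm (A t) * norm (y t)" by (rule norm_blinfun)
      also have "\<dots> \<le> K * norm (y t)" using elim by (intro mult_right_mono) auto
      finally show ?case by (simp add: norm_rz)
    qed
  qed
  show "(\<lambda>t. rz (dual_op (A t) (y t))) \<in> Lsq (time T)"
  proof (rule Lsq_bound(1)[OF assms m(2), of K])
    show "AE t in time T. norm (rz (dual_op (A t) (y t))) \<le> K * norm (y t)" using K
    proof eventually_elim
      case (elim t)
      have "norm (dual_op (A t) (y t)) \<le> K * norm (y t)"
      proof (rule norm_blinfun_bound)
        have "0 \<le> K" using elim norm_ge_zero order_trans by blast
        thus "0 \<le> K * norm (y t)" by simp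
        fix x
        have "norm (A t x (y t)) \<le> norm (A t x) * norm (y t)" by (rule norm_blinfun)
        also have "\<dots> \<le> norm (A t) * norm x * norm (y t)" by (intro mult_right_mono norm_blinfun) simp
        also have "\<dots> \<le> K * norm x * norm (y t)" using elim by (intro mult_right_mono) auto
        finally show "norm (dual_op (A t) (y t) x) \<le> K * norm (y t) * norm x" by (simp add: mult_ac)
      qed
      thus ?case by (simp add: norm_rz)
    qed
  qed
qed

lemma A_integrable:
  assumes "y \<in> Lsq (time T)" "z \<in> Lsq (time T)"
  shows "integrable (time T) (\<lambda>t. A t (y t) (z t))"
  using integrable_inner_Lsq[OF A_Lsq(1)[OF assms(1)] assms(2)] by simp

text \<open>\<open>F\<close> represents the source. The derivative tested on V is used although the
  equation is tested on \<open>S\<close>; by \<open>W_sub\<close> the two agree there.\<close>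

definition solves :: "(real \<Rightarrow> 'v) \<Rightarrow> (real \<Rightarrow> 'v) \<Rightarrow> bool" where
  "solves F y \<longleftrightarrow> y \<in> W \<iota> T S \<and> (AE t in time T. \<forall>v\<in>S. ddt y t \<bullet> v + A t (y t) v = F t \<bullet> v)"

lemma solves_lincomb:
  assumes "solves F y" "solves G z"
  shows "solves (\<lambda>t. F t + c *\<^sub>R G t) (\<lambda>t. y t + c *\<^sub>R z t)"
  unfolding solves_def
proof
  have W: "y \<in> W \<iota> T S" "z \<in> W \<iota> T S" using assms by (auto simp: solves_def)
  show "(\<lambda>t. y t + c *\<^sub>R z t) \<in> W \<iota> T S" by (rule W_lincomb[OF W subspace_S])
  have "AE t in time T. \<forall>v\<in>S. ddt y t \<bullet> v + A t (y t) v = F t \<bullet> v" "AE t in time T. \<forall>v\<in>S. ddt z t \<bullet> v + A t (z t) v = G t \<bullet> v"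
    using assms by (auto simp: solves_def)
  thus "AE t in time T. \<forall>v\<in>S. ddt (\<lambda>t. y t + c *\<^sub>R z t) t \<bullet> v + A t (y t + c *\<^sub>R z t) v = (F t + c *\<^sub>R G t) \<bullet> v"
    using dt_lincomb[OF W_sub(1)[OF W(1)] W_sub(1)[OF W(2)], of c]
  proof eventually_elim
    case (elim t)
    show ?case unfolding elim(3)
    proof
      fix v assume "v \<in> S"
      hence "ddt y t \<bullet> v + A t (y t) v = F t \<bullet> v" "ddt z t \<bullet> v + A t (z t) v = G t \<bullet> v" using elim(1,2) by auto
      thus "(ddt y t + c *\<^sub>R ddt z t) \<bullet> v + A t (y t + c *\<^sub>R z t) v = (F t + c *\<^sub>R G t) \<bullet> v"
        unfolding inner_add_left inner_scaleR_left blinfun.add_right blinfun.scaleR_right blinfun.add_left blinfun.scaleR_left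
        by (simp flip: distrib_left del: inner_dt add: algebra_simps)
    qed
  qed
qed

text \<open>Testing with \<open>z\<close> itself, the energy identity and coercivity give
  \<open>0 \<le> - 2 * \<eta> * nsq (time T) z\<close>.\<close>

lemma solves_zero_unique:
  assumes "solves (\<lambda>t. 0) z" "pv z 0 = 0"
  shows "AE t in time T. z t = 0"
proof -
  have W: "z \<in> W \<iota> T S" using assms(1) by (simp add: solves_def)
  note L = W_D(1)[OF W] note U = W_sub(1)[OF W]
  have eq: "AE t in time T. ddt z t \<bullet> z t = - A t (z t) (z t)"
    using assms(1)[unfolded solves_def, THEN conjunct2] W_D(2)[OF W]
  proof eventually_elim
    case (elim t)
    hence "ddt z t \<bullet> z t + A t (z t) (z t) = 0" by fastforce
    thus ?case by linarith
  qed
  have "(norm (pv z T))\<^sup>2 = 2 * (LINT t|time T. ddt z t \<bullet> z t)"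
    using point_value_W(3)[OF T U] assms(2) by simp
  also have "(LINT t|time T. ddt z t \<bullet> z t) = (LINT t|time T. - A t (z t) (z t))"
    by (rule integral_cong_AE[OF _ _ eq])
      (use integrable_inner_Lsq[OF W_D(4)[OF U] L] A_integrable[OF L L] in auto)
  also have "\<dots> \<le> (LINT t|time T. - \<eta> * (norm (z t))\<^sup>2)"
    by (rule integral_mono) (use A_integrable[OF L L] Lsq_integrable[OF L] A_coercive in auto)
  also have "\<dots> = - \<eta> * nsq (time T) z" by (simp add: nsq_def)
  finally have "0 \<le> 2 * (- \<eta> * nsq (time T) z)" by (intro order_trans[OF zero_le_power2]) simp
  hence "\<eta> * nsq (time T) z \<le> 0" by simp
  hence "nsq (time T) z = 0" using \<eta> nsq_nonneg[of "time T" z] by (simp add: mult_le_0_iff)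
  from Lsq_eq_0_AE[OF L this] show ?thesis .
qed

lemma pv_point: "0 \<in> {0..T}" "T \<in> {0..T}"
  using T by auto

lemma solves_unique:
  assumes y: "solves F y" "\<And>s. s \<in> S \<Longrightarrow> (pv y 0 - h) \<bullet> \<iota> s = 0"
    and z: "solves F z" "\<And>s. s \<in> S \<Longrightarrow> (pv z 0 - h) \<bullet> \<iota> s = 0"
  shows "AE t in time T. y t = z t"
proof -
  define w where "w t = y t + (-1) *\<^sub>R z t" for t
  have w: "solves (\<lambda>t. 0) w" using solves_lincomb[OF y(1) z(1), of "-1"] by (simp add: w_def[abs_def])
  hence W: "w \<in> W \<iota> T S" by (simp add: solves_def)
  have "pv w 0 = 0"
  proof (rule pv_eq_0[OF W])
    fix s assume "s \<in> S"
    have "pv w 0 = pv y 0 + (-1) *\<^sub>R pv z 0" unfolding w_def[abs_def]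
      by (rule point_value_lincomb[OF T _ _ pv_point(1)]) (use y z W_sub(1) in \<open>auto simp: solves_def\<close>)
    thus "pv w 0 \<bullet> \<iota> s = 0" using y(2)[OF \<open>s \<in> S\<close>] z(2)[OF \<open>s \<in> S\<close>] by (simp add: inner_diff_left)
  qed
  from solves_zero_unique[OF w this] show ?thesis by eventually_elim (simp add: w_def)
qed

text \<open>Continuously differentiable paths in \<open>S\<close> that vanish at T, paired with
  their derivatives so that linear combinations act componentwise. Nothing is prescribed at time 0:
  this encodes the zero initial value in the weak equation.\<close>

definition test_pairs :: "((real \<Rightarrow> 'v) \<times> (real \<Rightarrow> 'v)) set" where
  "test_pairs = {(\<phi>, \<phi>'). (\<forall>t. (\<phi> has_vector_derivative \<phi>' t) (at t)) \<and> continuous_on UNIV \<phi>' \<and>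
     (\<forall>t. \<phi> t \<in> S) \<and> \<phi> T = 0}"

text \<open>The representer of the formal adjoint of the parabolic operator, - d/dt + A', applied to
  a test path.\<close>

definition adj_op :: "(real \<Rightarrow> 'v) \<times> (real \<Rightarrow> 'v) \<Rightarrow> real \<Rightarrow> 'v" where
  "adj_op p t = rz (dual_op (A t) (fst p t)) - rz (pivot \<iota> (\<iota> (snd p t)))"

lemma inner_adj_op: "adj_op (\<phi>, \<phi>') t \<bullet> v = A t v (\<phi> t) - \<iota> (\<phi>' t) \<bullet> \<iota> v"
  by (simp add: adj_op_def inner_diff_left)

lemma continuous_Lsq_time:
  fixes \<phi> :: "real \<Rightarrow> 'a::real_normed_vector"
  assumes "continuous_on UNIV \<phi>" shows "\<phi> \<in> Lsq (time T)"
proof -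
  have "bounded (\<phi> ` {0..T})"
    by (intro compact_imp_bounded compact_continuous_image continuous_on_subset[OF assms]) auto
  then obtain K where "\<forall>t\<in>{0..T}. norm (\<phi> t) \<le> K" by (auto simp: bounded_iff)
  thus ?thesis
    by (intro time.Lsq_bounded[where K = K] borel_measurable_time borel_measurable_continuous_onI assms) auto
qed

text \<open>The last estimate tests the adjoint operator with \<open>\<phi>\<close>. As
  \<open>\<phi> T = 0\<close>, the time derivative contributes half of the squared H-norm of
  \<open>\<phi> 0\<close>, which is nonnegative, and coercivity gives the factor
  \<open>\<eta>\<close>.\<close>

lemma test_pairs_D:
  assumes "(\<phi>, \<phi>') \<in> test_pairs"
  shows "\<phi> \<in> Lsq (time T)" "\<phi>' \<in> Lsq (time T)" "adj_op (\<phi>, \<phi>') \<in> Lsq (time T)"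
    "\<eta> * sqrt (nsq (time T) \<phi>) \<le> sqrt (nsq (time T) (\<lambda>t. \<pi> (adj_op (\<phi>, \<phi>') t)))"
proof -
  have D: "\<And>t. (\<phi> has_vector_derivative \<phi>' t) (at t)" "continuous_on UNIV \<phi>'" "\<And>t. \<phi> t \<in> S" "\<phi> T = 0"
    using assms by (auto simp: test_pairs_def)
  have c: "continuous_on UNIV \<phi>"
    using D(1) by (meson continuous_at_imp_continuous_on has_vector_derivative_continuous)
  show L: "\<phi> \<in> Lsq (time T)" "\<phi>' \<in> Lsq (time T)" by (intro continuous_Lsq_time c D)+
  show k: "adj_op (\<phi>, \<phi>') \<in> Lsq (time T)"
    unfolding adj_op_def[abs_def] fst_conv snd_conv
    by (intro Lsq_diff A_Lsq L Lsq_bounded_linear[OF bounded_linear_rz] Lsq_bounded_linear[OF bounded_linear_pivot] Lsq_blinfun)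
  have kp: "(\<lambda>t. \<pi> (adj_op (\<phi>, \<phi>') t)) \<in> Lsq (time T)" by (rule Lsq_blinfun(1)[OF k])
  have \<iota>D: "((\<lambda>t. \<iota> (\<phi> t)) has_vector_derivative \<iota> (\<phi>' t)) (at t)" for t
    by (rule bounded_linear.has_vector_derivative[OF blinfun.bounded_linear_right D(1)])
  have F: "((\<lambda>t. \<iota> (\<phi> t) \<bullet> \<iota> (\<phi> t) / 2) has_real_derivative \<iota> (\<phi>' t) \<bullet> \<iota> (\<phi> t)) (at t)" for t
    using bounded_bilinear.has_vector_derivative[OF bounded_bilinear_inner \<iota>D[of t] \<iota>D[of t]]
    unfolding has_real_derivative_iff_has_vector_derivative[symmetric]
    by (auto intro!: derivative_eq_intros simp: inner_commute)
  have "(LINT t|time T. \<iota> (\<phi>' t) \<bullet> \<iota> (\<phi> t)) = (LINT t|time T. indicator {0<..<T} t * (\<iota> (\<phi>' t) \<bullet> \<iota> (\<phi> t)))"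
    by (rule Bochner_Integration.integral_cong) auto
  also have "\<dots> = \<iota> (\<phi> T) \<bullet> \<iota> (\<phi> T) / 2 - \<iota> (\<phi> 0) \<bullet> \<iota> (\<phi> 0) / 2"
    by (rule integral_time_FTC[OF _ _ _ F])
      (use T in \<open>auto intro!: continuous_intros continuous_on_compose2[OF linear_continuous_on[OF blinfun.bounded_linear_right]] c D\<close>)
  also have "\<dots> \<le> 0" by (simp add: D(4) blinfun.zero_right)
  finally have neg: "(LINT t|time T. \<iota> (\<phi>' t) \<bullet> \<iota> (\<phi> t)) \<le> 0" .
  have i: "integrable (time T) (\<lambda>t. \<iota> (\<phi>' t) \<bullet> \<iota> (\<phi> t))" by (intro integrable_inner_Lsq Lsq_blinfun L)
  define a where "a = sqrt (nsq (time T) \<phi>)"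
  have "\<eta> * a\<^sup>2 = (LINT t|time T. \<eta> * (norm (\<phi> t))\<^sup>2)" by (simp add: a_def nsq_def)
  also have "\<dots> \<le> (LINT t|time T. A t (\<phi> t) (\<phi> t))"
    by (rule integral_mono) (use A_integrable[OF L(1) L(1)] Lsq_integrable[OF L(1)] A_coercive in auto)
  also have "\<dots> \<le> (LINT t|time T. A t (\<phi> t) (\<phi> t)) - (LINT t|time T. \<iota> (\<phi>' t) \<bullet> \<iota> (\<phi> t))" using neg by simp
  also have "\<dots> = (LINT t|time T. A t (\<phi> t) (\<phi> t) - \<iota> (\<phi>' t) \<bullet> \<iota> (\<phi> t))"
    using A_integrable[OF L(1) L(1)] i by simp
  also have "\<dots> = (LINT t|time T. \<pi> (adj_op (\<phi>, \<phi>') t) \<bullet> \<phi> t)"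
    by (simp add: \<pi>_adj \<pi>_id[OF D(3)] inner_adj_op)
  also have "\<dots> \<le> sqrt (nsq (time T) (\<lambda>t. \<pi> (adj_op (\<phi>, \<phi>') t))) * a"
    using integral_inner_Lsq_le[OF kp L(1)] by (simp add: a_def)
  finally have "a * (\<eta> * a) \<le> a * sqrt (nsq (time T) (\<lambda>t. \<pi> (adj_op (\<phi>, \<phi>') t)))"
    by (simp add: power2_eq_square mult_ac)
  note le = this
  have "\<eta> * a \<le> sqrt (nsq (time T) (\<lambda>t. \<pi> (adj_op (\<phi>, \<phi>') t)))"
  proof (cases "a = 0")
    case False
    hence "a > 0" using nsq_nonneg[of "time T" \<phi>] by (simp add: a_def less_le)
    from mult_left_le_imp_le[OF le this] show ?thesis .
  qed simp
  thus "\<eta> * sqrt (nsq (time T) \<phi>) \<le> sqrt (nsq (time T) (\<lambda>t. \<pi> (adj_op (\<phi>, \<phi>') t)))"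
    by (simp only: a_def)
qed

text \<open>Lions' projection argument: the functional \<open>\<phi> \<mapsto> \<integral> F \<bullet> \<phi>\<close> is bounded by the norm of the adjoint
  operator applied to \<open>\<phi>\<close>, so it is represented by a limit in the square mean.\<close>

lemma weak_solution_exists:
  assumes F: "F \<in> Lsq (time T)"
  obtains z where "z \<in> Lsq (time T)" "\<And>t. z t \<in> S"
    "\<And>\<phi> \<phi>'. (\<phi>, \<phi>') \<in> test_pairs \<Longrightarrow> (LINT t|time T. A t (z t) (\<phi> t) - \<iota> (\<phi>' t) \<bullet> \<iota> (z t)) = (LINT t|time T. F t \<bullet> \<phi> t)"
proof -
  define comb where "comb p c r = ((\<lambda>t. fst p t + c *\<^sub>R fst r t), (\<lambda>t. snd p t + c *\<^sub>R snd r t))"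
    for p r :: "(real \<Rightarrow> 'v) \<times> (real \<Rightarrow> 'v)" and c :: real
  define k where "k p t = \<pi> (adj_op p t)" for p t
  define b where "b p r = (LINT t|time T. k p t \<bullet> k r t)" for p r
  define l where "l p = (LINT t|time T. F t \<bullet> fst p t)" for p :: "(real \<Rightarrow> 'v) \<times> (real \<Rightarrow> 'v)"
  have kL: "k p \<in> Lsq (time T)" if "p \<in> test_pairs" for p
    unfolding k_def[abs_def] using test_pairs_D(3)[of "fst p" "snd p"] that by (intro Lsq_blinfun(1)) simp
  have \<phi>L: "fst p \<in> Lsq (time T)" if "p \<in> test_pairs" for p
    using test_pairs_D(1)[of "fst p" "snd p"] that by simp
  have k_comb: "k (comb p c r) = (\<lambda>t. k p t + c *\<^sub>R k r t)" for p c r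
    unfolding k_def[abs_def] adj_op_def comb_def fst_conv snd_conv
      blinfun.add_right blinfun.scaleR_right bounded_linear.linear[OF bounded_linear_pivot, THEN linear_add]
      bounded_linear.linear[OF bounded_linear_pivot, THEN linear_scale] rz_add rz_scaleR blinfun.diff_right
    by (simp add: fun_eq_iff algebra_simps)
  have b_comb: "b (comb x c y) z = b x z + c * b y z" if "x \<in> test_pairs" "y \<in> test_pairs" "z \<in> test_pairs" for x c y z
    unfolding b_def k_comb inner_add_left inner_scaleR_left
    using integrable_inner_Lsq[OF kL[OF that(1)] kL[OF that(3)]] integrable_inner_Lsq[OF kL[OF that(2)] kL[OF that(3)]]
    by simp
  have ex: "\<exists>s. (\<forall>n. s n \<in> test_pairs) \<and>
     (\<forall>e>0. \<exists>N. \<forall>m\<ge>N. \<forall>n\<ge>N. b (comb (s m) (-1) (s n)) (comb (s m) (-1) (s n)) < e) \<and>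
     (\<forall>x\<in>test_pairs. (\<lambda>n. b (s n) x) \<longlonglongrightarrow> l x)"
  \<comment> \<open>The constant comes from the coercivity estimate: the norm of a test path is at
    most that of \<open>k\<close> divided by \<open>\<eta>\<close>.\<close>
  proof (rule minimizing_sequence[of test_pairs comb b l "nsq (time T) F / \<eta>\<^sup>2"], goal_cases)
    case 1
    have "(\<lambda>t. 0, \<lambda>t. 0) \<in> test_pairs"
      using subspace_0[OF subspace_S] by (auto simp: test_pairs_def)
    thus ?case by blast
  next
    case (2 x c y)
    thus ?case unfolding comb_def test_pairs_def
      by (auto intro!: has_vector_derivative_add bounded_linear.has_vector_derivative[OF bounded_linear_scaleR_right]
          continuous_intros subspace_add[OF subspace_S] subspace_scale[OF subspace_S])
  next
    case (3 x c y z)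
    thus ?case by (rule b_comb)
  next
    case (4 x y)
    show ?case by (simp add: b_def inner_commute)
  next
    case (5 x)
    show ?case unfolding b_def nsq_inner[symmetric] by simp
  next
    case (6 x c y)
    show ?case unfolding l_def comb_def fst_conv inner_add_right inner_scaleR_right
      using integrable_inner_Lsq[OF F \<phi>L[OF 6(1)]] integrable_inner_Lsq[OF F \<phi>L[OF 6(2)]] by simp
  next
    case (7 x)
    have "\<eta> * sqrt (nsq (time T) (fst x)) \<le> sqrt (nsq (time T) (k x))"
      using test_pairs_D(4)[of "fst x" "snd x"] 7 by (simp add: k_def[abs_def])
    hence "sqrt (nsq (time T) (fst x)) \<le> sqrt (nsq (time T) (k x)) / \<eta>" using \<eta> by (simp add: field_simps)
    hence "\<bar>l x\<bar> \<le> sqrt (nsq (time T) F) * (sqrt (nsq (time T) (k x)) / \<eta>)"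
      unfolding l_def using integral_inner_Lsq_le[OF F \<phi>L[OF 7]]
      by (meson mult_left_mono nsq_nonneg order_trans real_sqrt_ge_zero)
    from power_mono[OF this, of 2] show ?case
      by (simp add: b_def power_mult_distrib power_divide flip: nsq_inner)
  next
    case (8 s)
    thus ?case by blast
  qed
  then obtain s where s: "\<And>n. s n \<in> test_pairs"
    and cau: "\<And>e. e > 0 \<Longrightarrow> \<exists>N. \<forall>m\<ge>N. \<forall>n\<ge>N. b (comb (s m) (-1) (s n)) (comb (s m) (-1) (s n)) < e"
    and lim: "\<And>x. x \<in> test_pairs \<Longrightarrow> (\<lambda>n. b (s n) x) \<longlonglongrightarrow> l x" by blast
  have "b (comb (s m) (-1) (s n)) (comb (s m) (-1) (s n)) = nsq (time T) (\<lambda>t. k (s m) t - k (s n) t)" for m n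
    unfolding b_def k_comb nsq_inner by simp
  with cau have "\<And>e. e > 0 \<Longrightarrow> \<exists>N. \<forall>m\<ge>N. \<forall>n\<ge>N. nsq (time T) (\<lambda>t. k (s m) t - k (s n) t) < e" by simp
  then obtain u where u: "u \<in> Lsq (time T)" "(\<lambda>n. nsq (time T) (\<lambda>t. k (s n) t - u t)) \<longlonglongrightarrow> 0"
    using Lsq_complete[of "\<lambda>n. k (s n)" "time T"] kL[OF s] by blast
  have eq: "(LINT t|time T. u t \<bullet> k p t) = l p" if p: "p \<in> test_pairs" for p
  proof (rule LIMSEQ_unique[OF _ lim[OF p]])
    have "norm (b (s n) p - (LINT t|time T. u t \<bullet> k p t)) \<le> sqrt (nsq (time T) (\<lambda>t. k (s n) t - u t)) * sqrt (nsq (time T) (k p))" for n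
    proof -
      have "b (s n) p - (LINT t|time T. u t \<bullet> k p t) = (LINT t|time T. (k (s n) t - u t) \<bullet> k p t)"
        unfolding b_def inner_diff_left using integrable_inner_Lsq[OF kL[OF s[of n]] kL[OF p]] integrable_inner_Lsq[OF u(1) kL[OF p]]
        by simp
      thus ?thesis using integral_inner_Lsq_le[OF Lsq_diff[OF kL[OF s[of n]] u(1)] kL[OF p]] by simp
    qed
    moreover have "(\<lambda>n. sqrt (nsq (time T) (\<lambda>t. k (s n) t - u t)) * sqrt (nsq (time T) (k p))) \<longlonglongrightarrow> sqrt 0 * sqrt (nsq (time T) (k p))"
      by (intro tendsto_mult tendsto_real_sqrt u tendsto_const)
    ultimately have "(\<lambda>n. b (s n) p - (LINT t|time T. u t \<bullet> k p t)) \<longlonglongrightarrow> 0"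
      using Lim_null_comparison[OF always_eventually] by (metis (no_types, lifting) mult_zero_left real_sqrt_zero)
    thus "(\<lambda>n. b (s n) p) \<longlonglongrightarrow> (LINT t|time T. u t \<bullet> k p t)" by (simp add: LIM_zero_iff)
  qed
  show ?thesis
  \<comment> \<open>The equation sees \<open>u\<close> only through its inner products with
    \<open>\<pi> (adj_op p t)\<close>. The symmetric projection moves onto \<open>u\<close>, which
    yields a solution with values in \<open>S\<close>.\<close>
  proof (rule that[of "\<lambda>t. \<pi> (u t)"])
    show "(\<lambda>t. \<pi> (u t)) \<in> Lsq (time T)" by (rule Lsq_blinfun(1)[OF u(1)])
    show "\<pi> (u t) \<in> S" for t by (rule \<pi>_S)
    fix \<phi> \<phi>' assume p: "(\<phi>, \<phi>') \<in> test_pairs"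
    have "A t (\<pi> (u t)) (\<phi> t) - \<iota> (\<phi>' t) \<bullet> \<iota> (\<pi> (u t)) = u t \<bullet> k (\<phi>, \<phi>') t" for t
      unfolding k_def \<pi>_adj[symmetric] by (simp add: inner_commute[of "\<pi> _"] inner_adj_op)
    thus "(LINT t|time T. A t (\<pi> (u t)) (\<phi> t) - \<iota> (\<phi>' t) \<bullet> \<iota> (\<pi> (u t))) = (LINT t|time T. F t \<bullet> \<phi> t)"
      using eq[OF p] by (simp add: l_def)
  qed
qed


text \<open>This path vanishes at T and has the value \<open>T *\<^sub>R s\<close> at 0, so testing
  with it reads off the initial value of a weak solution.\<close>

lemma affine_path_W:
  "vderiv \<iota> T UNIV (\<lambda>t. (T - t) *\<^sub>R s) (\<lambda>t. - rz (pivot \<iota> (\<iota> s)))"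
  unfolding vderiv_def
proof (intro conjI ballI)
  show "(\<lambda>t. (T - t) *\<^sub>R s) \<in> Lsq (time T)" by (intro continuous_Lsq_time continuous_intros)
  show "(\<lambda>t. - rz (pivot \<iota> (\<iota> s))) \<in> Lsq (time T)" by (rule time_const_Lsq)
  fix \<phi> v assume \<phi>: "\<phi> \<in> test_functions T"
  define f where "f t = deriv \<phi> t * (T - t) - \<phi> t" for t
  have "(LINT t|time T. indicator {0<..<T} t * f t) = \<phi> T * (T - T) - \<phi> 0 * (T - 0)"
    by (rule integral_time_FTC[of 0 T T "\<lambda>t. \<phi> t * (T - t)"])
      (use T in \<open>auto intro!: derivative_eq_intros test_function_deriv[OF \<phi>] continuous_intros
        continuous_test_function[OF \<phi>] continuous_test_function[OF deriv_test_function[OF \<phi>]] simp: f_def\<close>)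
  hence f0: "(LINT t|time T. indicator {0<..<T} t * f t) = 0" using test_function_zero[OF \<phi>, of 0] by simp
  have "(LINT t|time T. indicator {0<..<T} t * f t) = (LINT t|time T. f t)"
    by (rule Bochner_Integration.integral_cong) auto
  with f0 have 0: "(LINT t|time T. f t) = 0" by simp
  have i: "integrable (time T) (\<lambda>t. deriv \<phi> t * (T - t))" "integrable (time T) \<phi>"
    by (intro time.Lsq_integrable1 continuous_Lsq_time continuous_intros continuous_test_function[OF \<phi>]
        continuous_test_function[OF deriv_test_function[OF \<phi>]])+
  have "(LINT t|time T. deriv \<phi> t * (\<iota> ((T - t) *\<^sub>R s) \<bullet> \<iota> v)) = (LINT t|time T. deriv \<phi> t * (T - t) * (\<iota> s \<bullet> \<iota> v))"
    by (simp add: blinfun.scaleR_right mult.assoc)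
  also have "\<dots> = (LINT t|time T. deriv \<phi> t * (T - t)) * (\<iota> s \<bullet> \<iota> v)" by simp
  also have "(LINT t|time T. deriv \<phi> t * (T - t)) = (LINT t|time T. \<phi> t)"
    using 0 i by (simp add: f_def)
  finally show "(LINT t|time T. deriv \<phi> t * (\<iota> ((T - t) *\<^sub>R s) \<bullet> \<iota> v)) = - (LINT t|time T. \<phi> t * (- rz (pivot \<iota> (\<iota> s)) \<bullet> v))"
    by simp
qed

text \<open>Paths \<open>\<phi> t *\<^sub>R v\<close> with a scalar test function
  \<open>\<phi>\<close> turn the weak equation into the statement that \<open>z\<close> has a weak
  derivative and satisfies the equation; paths that do not vanish at 0 then yield the initial
  condition.\<close>

theorem solution_exists:
  assumes F: "F \<in> Lsq (time T)"
  obtains z where "solves F z" "pv z 0 = 0"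
proof -
  obtain z where z: "z \<in> Lsq (time T)" "\<And>t. z t \<in> S"
    and weak: "\<And>\<phi> \<phi>'. (\<phi>, \<phi>') \<in> test_pairs \<Longrightarrow>
      (LINT t|time T. A t (z t) (\<phi> t) - \<iota> (\<phi>' t) \<bullet> \<iota> (z t)) = (LINT t|time T. F t \<bullet> \<phi> t)"
    by (rule weak_solution_exists[OF F]) (rule that)
  \<comment> \<open>The derivative that the equation prescribes.\<close>
  define d where "d t = F t - rz (A t (z t))" for t
  have d: "d \<in> Lsq (time T)" unfolding d_def[abs_def] by (intro Lsq_diff F A_Lsq z)
  have weak': "(LINT t|time T. \<iota> (\<phi>' t) \<bullet> \<iota> (z t)) = - (LINT t|time T. d t \<bullet> \<phi> t)" if p: "(\<phi>, \<phi>') \<in> test_pairs" for \<phi> \<phi>'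
  proof -
    note L = test_pairs_D(1,2)[OF p]
    have i: "integrable (time T) (\<lambda>t. A t (z t) (\<phi> t))" "integrable (time T) (\<lambda>t. \<iota> (\<phi>' t) \<bullet> \<iota> (z t))"
      "integrable (time T) (\<lambda>t. F t \<bullet> \<phi> t)"
      by (intro A_integrable integrable_inner_Lsq Lsq_blinfun L z F)+
    show ?thesis using weak[OF p] i by (simp add: d_def inner_diff_left)
  qed
  have zd: "vderiv \<iota> T S z d"
    unfolding vderiv_def
  proof (intro conjI ballI z d)
    fix \<phi> v assume \<phi>: "\<phi> \<in> test_functions T" and v: "v \<in> S"
    have "(\<lambda>t. \<phi> t *\<^sub>R v, \<lambda>t. deriv \<phi> t *\<^sub>R v) \<in> test_pairs"
      unfolding test_pairs_def using test_function_zero[OF \<phi>, of T] test_function_deriv[OF \<phi>]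
        subspace_scale[OF subspace_S v]
      by (auto intro!: derivative_eq_intros continuous_intros continuous_test_function[OF deriv_test_function[OF \<phi>]]
          simp: has_real_derivative_iff_has_vector_derivative)
    from weak'[OF this]
    show "(LINT t|time T. deriv \<phi> t * (\<iota> (z t) \<bullet> \<iota> v)) = - (LINT t|time T. \<phi> t * (d t \<bullet> v))"
      by (simp add: blinfun.scaleR_right inner_commute[of "\<iota> v"])
  qed
  have W: "z \<in> W \<iota> T S" using z zd by (auto simp: W_iff)
  note U = W_sub[OF W]
  have ddt: "AE t in time T. \<forall>v\<in>S. ddt z t \<bullet> v = d t \<bullet> v"
    using vderiv_unique[OF W_D(3)[OF W] zd S_range] U(2) by eventually_elim metis
  have sol: "solves F z" unfolding solves_def
  proof (intro conjI W)
    show "AE t in time T. \<forall>v\<in>S. ddt z t \<bullet> v + A t (z t) v = F t \<bullet> v"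
      using ddt
    proof eventually_elim
      case (elim t)
      show ?case
      proof
        fix v assume "v \<in> S"
        hence "ddt z t \<bullet> v = F t \<bullet> v - A t (z t) v" using elim by (simp add: d_def inner_diff_left)
        thus "ddt z t \<bullet> v + A t (z t) v = F t \<bullet> v" by linarith
      qed
    qed
  qed
  \<comment> \<open>The weak equation has no term at time 0, whereas integration by parts against
    the affine path produces \<open>T * (pv z 0 \<bullet> \<iota> s)\<close>; comparing the two
    makes this term vanish.\<close>
  have "pv z 0 \<bullet> \<iota> s = 0" if s: "s \<in> S" for s
  proof -
    define p where "p t = (T - t) *\<^sub>R s" for t
    note pd = affine_path_W[of s, folded p_def[abs_def]]
    note P = dt_unique[OF pd]
    have pv: "pv p t = (T - t) *\<^sub>R \<iota> s" if "t \<in> {0..T}" for t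
      by (rule point_value_eq[OF T _ _ that]) (auto intro!: continuous_intros simp: p_def blinfun.scaleR_right)
    have tp: "(p, \<lambda>t. - s) \<in> test_pairs" unfolding test_pairs_def p_def
      using subspace_scale[OF subspace_S s] by (auto intro!: derivative_eq_intros continuous_intros)
    have "(LINT t|time T. ddt z t \<bullet> p t) = (LINT t|time T. d t \<bullet> p t)"
    proof (rule integral_cong_AE)
      show "AE t in time T. ddt z t \<bullet> p t = d t \<bullet> p t"
        using ddt by eventually_elim (use s in \<open>auto simp: p_def simp del: inner_dt\<close>)
    qed (use integrable_inner_Lsq[OF W_D(4)[OF U(1)] W_D(1)[OF P(1)]] integrable_inner_Lsq[OF d W_D(1)[OF P(1)]] in auto)
    moreover have "(LINT t|time T. ddt p t \<bullet> z t) = (LINT t|time T. \<iota> (- s) \<bullet> \<iota> (z t))"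
    proof (rule integral_cong_AE)
      show "AE t in time T. ddt p t \<bullet> z t = \<iota> (- s) \<bullet> \<iota> (z t)"
        using P(2) by eventually_elim (simp add: blinfun.minus_right del: inner_dt)
    qed (use integrable_inner_Lsq[OF W_D(4)[OF P(1)] z(1)] integrable_inner_Lsq[OF time_const_Lsq Lsq_blinfun(1)[OF z(1)]] in auto)
    moreover note integration_by_parts[OF T U(1) P(1)] weak'[OF tp] pv[OF pv_point(1)] pv[OF pv_point(2)]
    ultimately have "T * (pv z 0 \<bullet> \<iota> s) = 0" by simp
    thus ?thesis using T by simp
  qed
  hence "pv z 0 = 0" by (rule pv_eq_0[OF W])
  with sol show ?thesis by (rule that)
qed

end

section \<open>Optimality conditions\<close>

lemma linear_perturbation_eq_0:
  fixes L M :: real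
  assumes "\<And>s. 0 \<le> s * L + s\<^sup>2 * M"
  shows "L = 0"
proof (rule ccontr)
  assume L: "L \<noteq> 0"
  \<comment> \<open>The nonzero root of \<open>s * L + s\<^sup>2 * (\<bar>M\<bar> + 1)\<close>; as
    \<open>M\<close> is strictly smaller than the coefficient used here, the original expression is
    negative at it.\<close>
  define s where "s = - L / (\<bar>M\<bar> + 1)"
  have "\<bar>M\<bar> + 1 \<noteq> 0" by linarith
  hence sm: "s * (\<bar>M\<bar> + 1) = - L" by (simp add: s_def)
  have "s\<^sup>2 * M \<le> s\<^sup>2 * \<bar>M\<bar>" by (intro mult_left_mono) auto
  also have "\<dots> < s\<^sup>2 * (\<bar>M\<bar> + 1)" using L by (simp add: s_def add_nonneg_eq_0_iff)
  also have "\<dots> = - (s * L)" unfolding power2_eq_square mult.assoc sm by simp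
  finally show False using assms[of s] by simp
qed

definition resid where "resid \<iota> C y\<^sub>d y t = blinfun_apply (C t) (blinfun_apply \<iota> (y t)) - y\<^sub>d t"

locale control = parabolic \<iota> T S \<pi> q A \<eta>
  for \<iota> :: "'v::{real_inner, banach, second_countable_topology}
      \<Rightarrow>\<^sub>L 'h::{real_inner, banach, second_countable_topology}"
    and T S \<pi> q A \<eta> +
  fixes B :: "'u::{real_inner, banach, second_countable_topology} \<Rightarrow>\<^sub>L ('v \<Rightarrow>\<^sub>L real)"
    and C :: "real \<Rightarrow> ('h \<Rightarrow>\<^sub>L 'h)" and \<beta> :: real and y\<^sub>d :: "real \<Rightarrow> 'h"
  assumes C_meas: "\<And>h k. (\<lambda>t. C t h \<bullet> k) \<in> borel_measurable (time T)"
    and C_bounded: "\<exists>K. AE t in time T. norm (C t) \<le> K"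
    and \<beta>: "\<beta> > 0"
    and yd: "y\<^sub>d \<in> Lsq (time T)"
begin

lemma C_Lsq_bound: "\<exists>K. \<forall>x\<in>Lsq (time T). (\<lambda>t. C t (x t)) \<in> Lsq (time T) \<and> nsq (time T) (\<lambda>t. C t (x t)) \<le> K\<^sup>2 * nsq (time T) x"
proof -
  obtain K where K: "AE t in time T. norm (C t) \<le> K" using C_bounded by blast
  show ?thesis
  proof (intro exI[of _ K] ballI)
    fix x :: "real \<Rightarrow> 'h" assume x: "x \<in> Lsq (time T)"
    have "AE t in time T. norm (C t (x t)) \<le> K * norm (x t)" using K
    proof eventually_elim
      case (elim t)
      have "norm (C t (x t)) \<le> norm (C t) * norm (x t)" by (rule norm_blinfun)
      also have "\<dots> \<le> K * norm (x t)" using elim by (intro mult_right_mono) auto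
      finally show ?case .
    qed
    from Lsq_bound[OF x borel_measurable_blinfun_apply_weak[OF C_meas Lsq_measurable[OF x]] this]
    show "(\<lambda>t. C t (x t)) \<in> Lsq (time T) \<and> nsq (time T) (\<lambda>t. C t (x t)) \<le> K\<^sup>2 * nsq (time T) x" by blast
  qed
qed

lemma C_Lsq: "x \<in> Lsq (time T) \<Longrightarrow> (\<lambda>t. C t (x t)) \<in> Lsq (time T)"
  using C_Lsq_bound by blast

lemma Ci_Lsq: "y \<in> Lsq (time T) \<Longrightarrow> (\<lambda>t. C t (\<iota> (y t))) \<in> Lsq (time T)"
  by (intro C_Lsq Lsq_blinfun(1))

abbreviation "e \<equiv> resid \<iota> C y\<^sub>d"

lemma resid_Lsq: "y \<in> Lsq (time T) \<Longrightarrow> e y \<in> Lsq (time T)"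
  unfolding resid_def[abs_def] by (intro Lsq_diff Ci_Lsq yd)

lemma B_Lsq: "u \<in> Lsq (time T) \<Longrightarrow> (\<lambda>t. rz (B (u t))) \<in> Lsq (time T)"
  by (intro Lsq_bounded_linear[OF bounded_linear_rz] Lsq_blinfun(1))

lemma dual_B_Lsq: "p \<in> Lsq (time T) \<Longrightarrow> (\<lambda>t. rz (dual_op B (p t))) \<in> Lsq (time T)"
  by (intro Lsq_bounded_linear[OF bounded_linear_rz] Lsq_blinfun(1))

lemma B_integrable:
  assumes "u \<in> Lsq (time T)" "p \<in> Lsq (time T)" shows "integrable (time T) (\<lambda>t. B (u t) (p t))"
  using integrable_inner_Lsq[OF B_Lsq[OF assms(1)] assms(2)] by simp

lemma ddt_integrable:
  assumes "y \<in> W \<iota> T UNIV" "p \<in> Lsq (time T)"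
  shows "integrable (time T) (\<lambda>t. time_deriv \<iota> T UNIV y t (p t))"
  using integrable_inner_Lsq[OF W_D(4)[OF assms(1)] assms(2)] by simp

abbreviation "J y u \<equiv> cost T C \<beta> y\<^sub>d (\<lambda>t. \<iota> (y t)) u"

lemma cost_eq:
  fixes u :: "real \<Rightarrow> 'u"
  assumes "y \<in> Lsq (time T)" "u \<in> Lsq (time T)"
  shows "J y u = nsq (time T) (e y) / 2 + \<beta> / 2 * nsq (time T) u"
  unfolding cost_def nsq_def resid_def[symmetric]
  using Lsq_integrable[OF resid_Lsq[OF assms(1)]] Lsq_integrable[OF assms(2)] by simp

text \<open>Testing the initial condition against the image of \<open>S\<close> covers both
  problems. With S = V and a dense embedding it means equality with \<open>y\<^sub>0\<close>; with S
  = V_r it means that the initial value is the H-projection of \<open>y\<^sub>0\<close>.\<close>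

definition state :: "'h \<Rightarrow> (real \<Rightarrow> 'u) \<Rightarrow> (real \<Rightarrow> 'v) \<Rightarrow> bool" where
  "state y\<^sub>0 u y \<longleftrightarrow> solves (\<lambda>t. rz (B (u t))) y \<and> (\<forall>s\<in>S. (pv y 0 - y\<^sub>0) \<bullet> \<iota> s = 0)"

lemma state_iff:
  "state y\<^sub>0 u y \<longleftrightarrow> y \<in> W \<iota> T S \<and>
     (AE t in time T. \<forall>v\<in>S. (time_deriv \<iota> T S y t + A t (y t)) v = B (u t) v) \<and>
     (\<forall>s\<in>S. (pv y 0 - y\<^sub>0) \<bullet> \<iota> s = 0)"
proof -
  have "(AE t in time T. \<forall>v\<in>S. (time_deriv \<iota> T S y t + A t (y t)) v = B (u t) v) \<longleftrightarrow>
      (AE t in time T. \<forall>v\<in>S. ddt y t \<bullet> v + A t (y t) v = rz (B (u t)) \<bullet> v)" if "y \<in> W \<iota> T S"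
  proof -
    have "AE t in time T. \<forall>v\<in>S. time_deriv \<iota> T S y t v = time_deriv \<iota> T UNIV y t v"
      using W_sub(2)[OF that] by simp
    hence "AE t in time T. (\<forall>v\<in>S. (time_deriv \<iota> T S y t + A t (y t)) v = B (u t) v) \<longleftrightarrow>
      (\<forall>v\<in>S. ddt y t \<bullet> v + A t (y t) v = rz (B (u t)) \<bullet> v)"
      by eventually_elim (simp add: blinfun.add_left)
    thus ?thesis by (rule eventually_subst)
  qed
  thus ?thesis unfolding state_def solves_def by blast
qed

definition adjoint_state :: "(real \<Rightarrow> 'v) \<Rightarrow> (real \<Rightarrow> 'v) \<Rightarrow> bool" where
  "adjoint_state y p \<longleftrightarrow> p \<in> W \<iota> T S \<and>
     (AE t in time T. \<forall>v\<in>S. - (ddt p t \<bullet> v) + A t v (p t) = e y t \<bullet> C t (\<iota> v)) \<and> pv p T = 0"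

lemma adjoint_state_iff:
  "adjoint_state y p \<longleftrightarrow> p \<in> W \<iota> T S \<and>
     (AE t in time T. \<forall>v\<in>S. (- time_deriv \<iota> T S p t + dual_op (A t) (p t)) v
        = pivot \<iota> (adjoint (C t) (C t (\<iota> (y t)) - y\<^sub>d t)) v) \<and> pv p T = 0"
proof -
  have "(AE t in time T. \<forall>v\<in>S. (- time_deriv \<iota> T S p t + dual_op (A t) (p t)) v
        = pivot \<iota> (adjoint (C t) (C t (\<iota> (y t)) - y\<^sub>d t)) v) \<longleftrightarrow>
     (AE t in time T. \<forall>v\<in>S. - (ddt p t \<bullet> v) + A t v (p t) = e y t \<bullet> C t (\<iota> v))" if "p \<in> W \<iota> T S"
  proof -
    have "AE t in time T. \<forall>v\<in>S. time_deriv \<iota> T S p t v = time_deriv \<iota> T UNIV p t v"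
      using W_sub(2)[OF that] by simp
    hence "AE t in time T. (\<forall>v\<in>S. (- time_deriv \<iota> T S p t + dual_op (A t) (p t)) v
        = pivot \<iota> (adjoint (C t) (C t (\<iota> (y t)) - y\<^sub>d t)) v) \<longleftrightarrow>
      (\<forall>v\<in>S. - (ddt p t \<bullet> v) + A t v (p t) = e y t \<bullet> C t (\<iota> v))"
    proof eventually_elim
      case (elim t)
      have "adjoint (C t) x \<bullet> z = x \<bullet> C t z" for x z
        using inner_adjoint_blinfun[of "C t" z x] by (simp only: inner_commute)
      thus ?case using elim by (simp add: blinfun.add_left blinfun.diff_left blinfun.minus_left resid_def)
    qed
    thus ?thesis by (rule eventually_subst)
  qed
  thus ?thesis unfolding adjoint_state_def by blast
qed

lemma state_tested:
  assumes "state y\<^sub>0 u y" and u: "u \<in> Lsq (time T)" and k: "k \<in> Lsq (time T)" "AE t in time T. k t \<in> S"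
  shows "(LINT t|time T. time_deriv \<iota> T UNIV y t (k t)) + (LINT t|time T. A t (y t) (k t)) = (LINT t|time T. B (u t) (k t))"
proof -
  have y: "y \<in> W \<iota> T S" and eq: "AE t in time T. \<forall>v\<in>S. ddt y t \<bullet> v + A t (y t) v = rz (B (u t)) \<bullet> v"
    using assms(1) by (auto simp: state_def solves_def)
  note i = ddt_integrable[OF W_sub(1)[OF y] k(1)] A_integrable[OF W_D(1)[OF y] k(1)] B_integrable[OF u k(1)]
  have "(LINT t|time T. time_deriv \<iota> T UNIV y t (k t) + A t (y t) (k t)) = (LINT t|time T. B (u t) (k t))"
  proof (rule integral_cong_AE)
    show "AE t in time T. time_deriv \<iota> T UNIV y t (k t) + A t (y t) (k t) = B (u t) (k t)"
      using eq k(2) by eventually_elim simp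
  qed (use i in auto)
  thus ?thesis using i by simp
qed

lemma state_pv_orthogonal:
  assumes "state y\<^sub>0 u y" "k \<in> W \<iota> T S" "t \<in> {0..T}"
  shows "(pv y 0 - y\<^sub>0) \<bullet> pv k t = 0"
  by (rule pv_orthogonal[OF assms(2) _ assms(3)]) (use assms(1) in \<open>auto simp: state_def\<close>)

text \<open>The adjoint equation is tested with \<open>h\<close>, and its time derivative is moved
  to \<open>h\<close>. Because the terminal value of \<open>p\<close> is zero, only the boundary
  term at 0 survives.\<close>

lemma adjoint_identity:
  assumes "adjoint_state y p" and y: "y \<in> Lsq (time T)" and h: "h \<in> W \<iota> T S"
  shows "(LINT t|time T. e y t \<bullet> C t (\<iota> (h t))) = (LINT t|time T. A t (h t) (p t))
    + (LINT t|time T. time_deriv \<iota> T UNIV h t (p t)) + pv h 0 \<bullet> pv p 0"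
proof -
  have p: "p \<in> W \<iota> T S" and pT: "pv p T = 0"
    and eq: "AE t in time T. \<forall>v\<in>S. - (ddt p t \<bullet> v) + A t v (p t) = e y t \<bullet> C t (\<iota> v)"
    using assms(1) by (auto simp: adjoint_state_def)
  note U = W_sub(1)[OF p] W_sub(1)[OF h] note L = W_D(1)[OF p] W_D(1)[OF h]
  note i = ddt_integrable[OF U(1) L(2)] ddt_integrable[OF U(2) L(1)] A_integrable[OF L(2) L(1)]
  have "(LINT t|time T. e y t \<bullet> C t (\<iota> (h t))) = (LINT t|time T. A t (h t) (p t) - time_deriv \<iota> T UNIV p t (h t))"
  proof (rule integral_cong_AE)
    show "AE t in time T. e y t \<bullet> C t (\<iota> (h t)) = A t (h t) (p t) - time_deriv \<iota> T UNIV p t (h t)"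
      using eq W_D(2)[OF h] by eventually_elim fastforce
  qed (use i integrable_inner_Lsq[OF resid_Lsq[OF y] Ci_Lsq[OF L(2)]] in auto)
  also have "\<dots> = (LINT t|time T. A t (h t) (p t)) - (LINT t|time T. time_deriv \<iota> T UNIV p t (h t))"
    using i by simp
  finally show ?thesis using integration_by_parts[OF T U(2) U(1)] pT by simp
qed

text \<open>Varying \<open>u\<close> by \<open>s *\<^sub>R h\<close> changes the state by
  \<open>s *\<^sub>R z\<close>, where \<open>z\<close> solves the equation with source B h and
  initial value zero. The cost is quadratic in \<open>s\<close>, so its linear coefficient vanishes
  at a minimum; the adjoint identity and the equation for \<open>z\<close> replace the observation
  of \<open>z\<close> by the term with \<open>p\<close>.\<close>

lemma optimality:
  assumes U: "subspace U" and u: "u \<in> Lsq (time T)" "AE t in time T. u t \<in> U"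
    and y: "state y\<^sub>0 u y" and p: "adjoint_state y p"
    and min: "\<And>u' y'. u' \<in> Lsq (time T) \<Longrightarrow> AE t in time T. u' t \<in> U \<Longrightarrow> state y\<^sub>0 u' y' \<Longrightarrow> J y u \<le> J y' u'"
    and h: "h \<in> Lsq (time T)" "AE t in time T. h t \<in> U"
  shows "\<beta> * (LINT t|time T. u t \<bullet> h t) + (LINT t|time T. B (h t) (p t)) = 0"
proof -
  obtain z where z: "solves (\<lambda>t. rz (B (h t))) z" "pv z 0 = 0" by (rule solution_exists[OF B_Lsq[OF h(1)]])
  have W: "y \<in> W \<iota> T S" "z \<in> W \<iota> T S" "p \<in> W \<iota> T S"
    using y z p by (auto simp: state_def solves_def adjoint_state_def)
  note L = W[THEN W_D(1)]
  have z': "state 0 h z" using z by (simp add: state_def)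
  have eC: "integrable (time T) (\<lambda>t. e y t \<bullet> C t (\<iota> (z t)))" by (intro integrable_inner_Lsq resid_Lsq Ci_Lsq L)
  have uh: "integrable (time T) (\<lambda>t. u t \<bullet> h t)" by (intro integrable_inner_Lsq u h)
  have lin: "J (\<lambda>t. y t + s *\<^sub>R z t) (\<lambda>t. u t + s *\<^sub>R h t) = J y u
     + s * ((LINT t|time T. e y t \<bullet> C t (\<iota> (z t))) + \<beta> * (LINT t|time T. u t \<bullet> h t))
     + s\<^sup>2 * (nsq (time T) (\<lambda>t. C t (\<iota> (z t))) / 2 + \<beta> / 2 * nsq (time T) h)" for s
  proof -
    have ys: "(\<lambda>t. y t + s *\<^sub>R z t) \<in> Lsq (time T)" and us: "(\<lambda>t. u t + s *\<^sub>R h t) \<in> Lsq (time T)"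
      by (intro Lsq_add Lsq_scaleR L u h)+
    have "nsq (time T) (e (\<lambda>t. y t + s *\<^sub>R z t)) = (LINT t|time T. e y t \<bullet> e y t + (2 * s) * (e y t \<bullet> C t (\<iota> (z t)))
        + s\<^sup>2 * (C t (\<iota> (z t)) \<bullet> C t (\<iota> (z t))))"
      unfolding nsq_inner resid_def
      by (rule Bochner_Integration.integral_cong) (simp_all add: blinfun.add_right blinfun.scaleR_right
          inner_add_left inner_add_right inner_diff_left inner_diff_right inner_commute algebra_simps power2_eq_square)
    also have "\<dots> = nsq (time T) (e y) + (2 * s) * (LINT t|time T. e y t \<bullet> C t (\<iota> (z t))) + s\<^sup>2 * nsq (time T) (\<lambda>t. C t (\<iota> (z t)))"
      unfolding nsq_inner using eC integrable_inner_Lsq[OF resid_Lsq[OF L(1)] resid_Lsq[OF L(1)]]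
        integrable_inner_Lsq[OF Ci_Lsq[OF L(2)] Ci_Lsq[OF L(2)]] by simp
    finally have 1: "nsq (time T) (e (\<lambda>t. y t + s *\<^sub>R z t)) = \<dots>" .
    have "nsq (time T) (\<lambda>t. u t + s *\<^sub>R h t) = (LINT t|time T. u t \<bullet> u t + (2 * s) * (u t \<bullet> h t) + s\<^sup>2 * (h t \<bullet> h t))"
      unfolding nsq_inner
      by (rule Bochner_Integration.integral_cong)
        (simp_all add: inner_add_left inner_add_right inner_commute algebra_simps power2_eq_square)
    also have "\<dots> = nsq (time T) u + (2 * s) * (LINT t|time T. u t \<bullet> h t) + s\<^sup>2 * nsq (time T) h"
      unfolding nsq_inner using uh integrable_inner_Lsq[OF u(1) u(1)] integrable_inner_Lsq[OF h(1) h(1)] by simp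
    finally have 2: "nsq (time T) (\<lambda>t. u t + s *\<^sub>R h t) = \<dots>" .
    show ?thesis unfolding cost_eq[OF ys us] cost_eq[OF L(1) u(1)] 1 2 by (simp add: field_simps)
  qed
  have "state y\<^sub>0 (\<lambda>t. u t + s *\<^sub>R h t) (\<lambda>t. y t + s *\<^sub>R z t)" for s
    unfolding state_def
  proof (intro conjI ballI)
    have "solves (\<lambda>t. rz (B (u t)) + s *\<^sub>R rz (B (h t))) (\<lambda>t. y t + s *\<^sub>R z t)"
      by (rule solves_lincomb) (use y z in \<open>auto simp: state_def\<close>)
    thus "solves (\<lambda>t. rz (B (u t + s *\<^sub>R h t))) (\<lambda>t. y t + s *\<^sub>R z t)"
      by (simp add: blinfun.add_right blinfun.scaleR_right rz_add rz_scaleR)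
    fix v assume "v \<in> S"
    thus "(pv (\<lambda>t. y t + s *\<^sub>R z t) 0 - y\<^sub>0) \<bullet> \<iota> v = 0"
      using point_value_lincomb[OF T W_sub(1)[OF W(1)] W_sub(1)[OF W(2)] pv_point(1), of s] y z(2)
      by (simp add: state_def)
  qed
  moreover have "(\<lambda>t. u t + s *\<^sub>R h t) \<in> Lsq (time T)" for s by (intro Lsq_add Lsq_scaleR u h)
  moreover have "AE t in time T. u t + s *\<^sub>R h t \<in> U" for s
    using u(2) h(2) by eventually_elim (intro subspace_add[OF U] subspace_scale[OF U])
  ultimately have "J y u \<le> J (\<lambda>t. y t + s *\<^sub>R z t) (\<lambda>t. u t + s *\<^sub>R h t)" for s by (intro min)
  hence "0 \<le> s * ((LINT t|time T. e y t \<bullet> C t (\<iota> (z t))) + \<beta> * (LINT t|time T. u t \<bullet> h t))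
     + s\<^sup>2 * (nsq (time T) (\<lambda>t. C t (\<iota> (z t))) / 2 + \<beta> / 2 * nsq (time T) h)" for s
    unfolding lin by (smt (verit))
  from linear_perturbation_eq_0[OF this]
  have "(LINT t|time T. e y t \<bullet> C t (\<iota> (z t))) + \<beta> * (LINT t|time T. u t \<bullet> h t) = 0" .
  with adjoint_identity[OF p L(1) W(2)] state_tested[OF z' h(1) L(3) W_D(2)[OF W(3)]] z(2)
  show ?thesis by simp
qed

text \<open>The gradient \<open>g\<close> itself takes values in \<open>U\<close> and is therefore
  an admissible direction. Testing with it gives \<open>nsq (time T) g = 0\<close>, and a gradient
  that vanishes almost everywhere is orthogonal to every \<open>h\<close>.\<close>

lemma optimality_gradient:
  assumes U: "subspace U" and u: "u \<in> Lsq (time T)" "AE t in time T. u t \<in> U"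
    and y: "state y\<^sub>0 u y" and p: "adjoint_state y p"
    and min: "\<And>u' y'. u' \<in> Lsq (time T) \<Longrightarrow> AE t in time T. u' t \<in> U \<Longrightarrow> state y\<^sub>0 u' y' \<Longrightarrow> J y u \<le> J y' u'"
    and BU: "\<And>s. s \<in> S \<Longrightarrow> rz (dual_op B s) \<in> U"
    and h: "h \<in> Lsq (time T)"
  shows "\<beta> * (LINT t|time T. u t \<bullet> h t) + (LINT t|time T. B (h t) (p t)) = 0"
proof -
  have W: "p \<in> W \<iota> T S" using p by (auto simp: adjoint_state_def)
  note L = W_D(1)[OF W]
  define g where "g t = \<beta> *\<^sub>R u t + rz (dual_op B (p t))" for t
  have g: "g \<in> Lsq (time T)" unfolding g_def[abs_def] by (intro Lsq_add Lsq_scaleR u dual_B_Lsq L)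
  have gh: "(LINT t|time T. g t \<bullet> k t) = \<beta> * (LINT t|time T. u t \<bullet> k t) + (LINT t|time T. B (k t) (p t))"
    if k: "k \<in> Lsq (time T)" for k
    unfolding g_def using integrable_inner_Lsq[OF u(1) k] B_integrable[OF k L] by (simp add: inner_add_left)
  have "AE t in time T. g t \<in> U"
    using u(2) W_D(2)[OF W]
    by eventually_elim (auto simp: g_def intro!: subspace_add[OF U] subspace_scale[OF U] BU)
  hence "nsq (time T) g = 0"
    unfolding nsq_inner gh[OF g] by (intro optimality[OF U u y p min g]) auto
  from Lsq_eq_0_AE[OF g this] have "(LINT t|time T. g t \<bullet> h t) = (LINT t|time T. 0)"
    by (intro integral_cong_AE) (use integrable_inner_Lsq[OF g h] in auto)
  thus ?thesis by (simp add: gh[OF h])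
qed

text \<open>The reduced cost functionals evaluate the cost at a chosen state; this lets any given
  state take its place.\<close>

lemma cost_state_unique:
  fixes u :: "real \<Rightarrow> 'u"
  assumes "state y\<^sub>0 u y" "state y\<^sub>0 u z" "u \<in> Lsq (time T)"
  shows "J y u = J z u"
proof -
  have L: "y \<in> Lsq (time T)" "z \<in> Lsq (time T)"
    using assms W_D(1) by (auto simp: state_def solves_def)
  have "AE t in time T. y t = z t"
    by (rule solves_unique[where h = y\<^sub>0]) (use assms in \<open>auto simp: state_def\<close>)
  hence "AE t in time T. e y t = e z t" by eventually_elim (simp add: resid_def)
  from Lsq_cong_AE(2)[OF Lsq_measurable[OF resid_Lsq[OF L(1)]] resid_Lsq[OF L(2)] this]
  show ?thesis by (simp add: cost_eq L assms(3))
qed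

end

section \<open>Derivatives of the Lagrange function\<close>

lemma has_frechet_derivI:
  assumes lin: "\<And>h k c. h \<in> X \<Longrightarrow> k \<in> X \<Longrightarrow> D (\<lambda>t. h t + c *\<^sub>R k t) = D h + c * D k"
    and bound: "\<And>h. h \<in> X \<Longrightarrow> \<bar>D h\<bar> \<le> K * N h"
    and quad: "\<And>h. h \<in> X \<Longrightarrow> \<bar>F (\<lambda>t. x t + h t) - F x - D h\<bar> \<le> M * (N h)\<^sup>2"
    and N: "\<And>h. h \<in> X \<Longrightarrow> N h \<ge> 0"
  shows "has_frechet_deriv X N F x D"
  unfolding has_frechet_deriv_def
proof (intro conjI)
  show "\<forall>h\<in>X. \<forall>k\<in>X. D (\<lambda>t. h t + k t) = D h + D k" using lin[of _ _ 1] by simp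
  show "\<forall>c. \<forall>h\<in>X. D (\<lambda>t. c *\<^sub>R h t) = c * D h"
  proof (intro allI ballI)
    fix c h assume "h \<in> X"
    from lin[OF this this, of "c - 1"] show "D (\<lambda>t. c *\<^sub>R h t) = c * D h"
      by (simp add: scaleR_left_diff_distrib left_diff_distrib)
  qed
  show "\<exists>K. \<forall>h\<in>X. \<bar>D h\<bar> \<le> K * N h" using bound by blast
  show "\<forall>\<epsilon>>0. \<exists>\<delta>>0. \<forall>h\<in>X. N h < \<delta> \<longrightarrow> \<bar>F (\<lambda>t. x t + h t) - F x - D h\<bar> \<le> \<epsilon> * N h"
  proof (intro allI impI)
    fix \<epsilon> :: real assume \<epsilon>: "\<epsilon> > 0"
    have "\<bar>F (\<lambda>t. x t + h t) - F x - D h\<bar> \<le> \<epsilon> * N h" if h: "h \<in> X" "N h < \<epsilon> / (\<bar>M\<bar> + 1)" for h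
    proof -
      have "M * N h \<le> (\<bar>M\<bar> + 1) * N h" by (intro mult_right_mono N h) auto
      also have "\<dots> \<le> \<epsilon>" using h(2) by (simp add: field_simps)
      finally have "M * N h * N h \<le> \<epsilon> * N h" by (intro mult_right_mono N h)
      thus ?thesis using quad[OF h(1)] by (simp add: power2_eq_square mult.assoc)
    qed
    thus "\<exists>\<delta>>0. \<forall>h\<in>X. N h < \<delta> \<longrightarrow> \<bar>F (\<lambda>t. x t + h t) - F x - D h\<bar> \<le> \<epsilon> * N h"
      using \<epsilon> by (intro exI[of _ "\<epsilon> / (\<bar>M\<bar> + 1)"]) auto
  qed
qed

text \<open>Two derivatives differ by at most \<open>2 * \<epsilon> * N\<close> on small increments.
  Homogeneity carries this bound from a small multiple of \<open>h\<close> to \<open>h\<close>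
  itself, and \<open>\<epsilon>\<close> is arbitrary.\<close>

lemma frechet_deriv_eq:
  assumes D: "has_frechet_deriv X N F x D" and h: "h \<in> X"
    and scale: "\<And>h c. h \<in> X \<Longrightarrow> (\<lambda>t. c *\<^sub>R h t) \<in> X" "\<And>h c. h \<in> X \<Longrightarrow> N (\<lambda>t. c *\<^sub>R h t) = \<bar>c\<bar> * N h"
    and N: "\<And>h. h \<in> X \<Longrightarrow> N h \<ge> 0"
  shows "frechet_deriv X N F x h = D h"
proof -
  define E where "E = frechet_deriv X N F x"
  have E: "has_frechet_deriv X N F x E"
    unfolding E_def frechet_deriv_def by (rule someI[of "has_frechet_deriv X N F x", OF D])
  have "\<bar>E h - D h\<bar> \<le> \<epsilon> * (2 * N h)" if \<epsilon>: "\<epsilon> > 0" for \<epsilon>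
  proof -
    obtain d1 where d1: "d1 > 0" "\<And>h. h \<in> X \<Longrightarrow> N h < d1 \<Longrightarrow> \<bar>F (\<lambda>t. x t + h t) - F x - D h\<bar> \<le> \<epsilon> * N h"
      using D \<epsilon> unfolding has_frechet_deriv_def by blast
    obtain d2 where d2: "d2 > 0" "\<And>h. h \<in> X \<Longrightarrow> N h < d2 \<Longrightarrow> \<bar>F (\<lambda>t. x t + h t) - F x - E h\<bar> \<le> \<epsilon> * N h"
      using E \<epsilon> unfolding has_frechet_deriv_def by blast
    \<comment> \<open>\<open>N h\<close> may be zero, hence the summand 1 in the denominator; the
      scaled increment lies within both radii.\<close>
    define c where "c = min d1 d2 / 2 / (N h + 1)"
    have "N h + 1 \<noteq> 0" using N[OF h] by linarith
    have c: "c > 0" using d1 d2 N[OF h] by (simp add: c_def)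
    let ?k = "\<lambda>t. c *\<^sub>R h t"
    have k: "?k \<in> X" and Nk: "N ?k = c * N h" using scale h c by auto
    have "c * N h < min d1 d2"
    proof -
      have "c * N h \<le> c * (N h + 1)" using c by simp
      also have "\<dots> = min d1 d2 / 2"
        using nonzero_eq_divide_eq[OF \<open>N h + 1 \<noteq> 0\<close>, of c "min d1 d2 / 2"] c_def by blast
      also have "\<dots> < min d1 d2"
      proof -
        have "min d1 d2 > 0" using d1(1) d2(1) by simp
        thus ?thesis by linarith
      qed
      finally show ?thesis .
    qed
    hence "\<bar>F (\<lambda>t. x t + ?k t) - F x - D ?k\<bar> \<le> \<epsilon> * (c * N h)" "\<bar>F (\<lambda>t. x t + ?k t) - F x - E ?k\<bar> \<le> \<epsilon> * (c * N h)"
      using d1(2)[OF k] d2(2)[OF k] Nk by auto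
    hence "\<bar>E ?k - D ?k\<bar> \<le> 2 * (\<epsilon> * (c * N h))" by linarith
    moreover have "E ?k = c * E h" "D ?k = c * D h" using D E h unfolding has_frechet_deriv_def by blast+
    ultimately have "c * \<bar>E h - D h\<bar> \<le> c * (\<epsilon> * (2 * N h))"
      using c by (simp add: abs_mult flip: right_diff_distrib)
    thus ?thesis using c by simp
  qed
  have "\<bar>E h - D h\<bar> \<le> 0"
  proof (rule field_le_epsilon)
    fix r :: real assume "r > 0"
    hence "r / (2 * N h + 1) > 0" using N[OF h] by simp
    from \<open>\<And>\<epsilon>. \<epsilon> > 0 \<Longrightarrow> _\<close>[OF this] have "\<bar>E h - D h\<bar> \<le> r / (2 * N h + 1) * (2 * N h)" .
    also have "\<dots> \<le> r" using N[OF h] \<open>r > 0\<close> by (simp add: field_simps)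
    finally show "\<bar>E h - D h\<bar> \<le> 0 + r" by simp
  qed
  thus ?thesis by (simp add: E_def)
qed

lemma norm_W_eq:
  fixes y :: "real \<Rightarrow> 'v::{real_inner, banach}"
  shows "norm_W \<iota> T y = sqrt (nsq (time T) y + nsq (time T) (dt \<iota> T UNIV y))"
  by (simp add: norm_W_def nsq_def dt_def norm_rz)

lemma norm_W_nonneg: "norm_W \<iota> T y \<ge> 0"
  by (simp add: norm_W_def)

lemma norm_W_bounds:
  fixes y :: "real \<Rightarrow> 'v::{real_inner, banach}"
  shows "sqrt (nsq (time T) y) \<le> norm_W \<iota> T y" "sqrt (nsq (time T) (dt \<iota> T UNIV y)) \<le> norm_W \<iota> T y"
  by (simp_all add: norm_W_eq)

lemma W_UNIV_scaleR:
  fixes y :: "real \<Rightarrow> 'v::{real_inner, banach, second_countable_topology}"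
    and \<iota> :: "'v \<Rightarrow>\<^sub>L 'h::{real_inner, banach, second_countable_topology}"
  assumes y: "y \<in> W \<iota> T UNIV"
  shows "(\<lambda>t. c *\<^sub>R y t) \<in> W \<iota> T UNIV" "norm_W \<iota> T (\<lambda>t. c *\<^sub>R y t) = \<bar>c\<bar> * norm_W \<iota> T y"
proof -
  have eq: "(\<lambda>t. y t + (c - 1) *\<^sub>R y t) = (\<lambda>t. c *\<^sub>R y t)" by (simp add: scaleR_left_diff_distrib)
  show cy: "(\<lambda>t. c *\<^sub>R y t) \<in> W \<iota> T UNIV" using W_lincomb[OF y y, of "c - 1"] by (simp add: eq)
  have "AE t in time T. dt \<iota> T UNIV (\<lambda>t. c *\<^sub>R y t) t = c *\<^sub>R dt \<iota> T UNIV y t"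
    using dt_lincomb[OF y y, of "c - 1"] unfolding eq by eventually_elim (simp add: scaleR_left_diff_distrib)
  from Lsq_cong_AE(2)[OF Lsq_measurable[OF W_D(4)[OF cy]] Lsq_scaleR(1)[OF W_D(4)[OF y]] this]
  have "nsq (time T) (dt \<iota> T UNIV (\<lambda>t. c *\<^sub>R y t)) = c\<^sup>2 * nsq (time T) (dt \<iota> T UNIV y)"
    by (simp add: Lsq_scaleR(2)[OF W_D(4)[OF y]])
  thus "norm_W \<iota> T (\<lambda>t. c *\<^sub>R y t) = \<bar>c\<bar> * norm_W \<iota> T y"
    by (simp add: norm_W_eq Lsq_scaleR(2)[OF W_D(1)[OF y]] real_sqrt_mult flip: distrib_left)
qed

context control
begin

text \<open>The candidate for the derivative of L in y, in direction \<open>h\<close>. The control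
  does not occur because L has no term that couples y and u.\<close>

definition Ly :: "(real \<Rightarrow> 'v) \<Rightarrow> (real \<Rightarrow> 'v) \<Rightarrow> (real \<Rightarrow> 'v) \<Rightarrow> real" where
  "Ly y p h = (LINT t|time T. e y t \<bullet> C t (\<iota> (h t))) - (LINT t|time T. A t (h t) (p t))
     - (LINT t|time T. time_deriv \<iota> T UNIV h t (p t)) - pv h 0 \<bullet> pv p 0"

text \<open>L is affine in p, so this is both the part of L that contains the multiplier and the
  candidate for the derivative of L in p.\<close>

definition Lp :: "'h \<Rightarrow> (real \<Rightarrow> 'v) \<Rightarrow> (real \<Rightarrow> 'u) \<Rightarrow> (real \<Rightarrow> 'v) \<Rightarrow> real" where
  "Lp y\<^sub>0 y u k = (LINT t|time T. B (u t) (k t)) - (LINT t|time T. A t (y t) (k t))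
     - (LINT t|time T. time_deriv \<iota> T UNIV y t (k t)) + (y\<^sub>0 - pv y 0) \<bullet> pv k 0"

lemma lagrangian_eq:
  assumes y: "y \<in> W \<iota> T UNIV" and u: "u \<in> Lsq (time T)" and p: "p \<in> W \<iota> T UNIV"
  shows "lagrangian \<iota> T A B C \<beta> y\<^sub>d y\<^sub>0 y u p = J y u + Lp y\<^sub>0 y u p"
  unfolding lagrangian_def Lp_def blinfun.diff_left
  using B_integrable[OF u W_D(1)[OF p]] A_integrable[OF W_D(1)[OF y] W_D(1)[OF p]] ddt_integrable[OF y W_D(1)[OF p]]
  by simp

lemma ddt_lincomb_integral:
  assumes y: "y \<in> W \<iota> T UNIV" and z: "z \<in> W \<iota> T UNIV" and p: "p \<in> Lsq (time T)"
  shows "(LINT t|time T. time_deriv \<iota> T UNIV (\<lambda>t. y t + c *\<^sub>R z t) t (p t))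
    = (LINT t|time T. time_deriv \<iota> T UNIV y t (p t)) + c * (LINT t|time T. time_deriv \<iota> T UNIV z t (p t))"
proof -
  have w: "(\<lambda>t. y t + c *\<^sub>R z t) \<in> W \<iota> T UNIV" by (rule W_lincomb[OF y z]) simp
  note i = ddt_integrable[OF y p] ddt_integrable[OF z p] ddt_integrable[OF w p]
  have "(LINT t|time T. time_deriv \<iota> T UNIV (\<lambda>t. y t + c *\<^sub>R z t) t (p t))
      = (LINT t|time T. time_deriv \<iota> T UNIV y t (p t) + c * time_deriv \<iota> T UNIV z t (p t))"
  proof (rule integral_cong_AE)
    show "AE t in time T. time_deriv \<iota> T UNIV (\<lambda>t. y t + c *\<^sub>R z t) t (p t)
        = time_deriv \<iota> T UNIV y t (p t) + c * time_deriv \<iota> T UNIV z t (p t)"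
      using dt_lincomb[OF y z, of c]
    proof eventually_elim
      case (elim t)
      hence "ddt (\<lambda>t. y t + c *\<^sub>R z t) t \<bullet> p t = (ddt y t + c *\<^sub>R ddt z t) \<bullet> p t" by (rule arg_cong)
      thus ?case by (simp add: inner_add_left)
    qed
  qed (use i in auto)
  thus ?thesis using i by simp
qed

lemma Ly_lincomb:
  assumes y: "y \<in> Lsq (time T)" and p: "p \<in> W \<iota> T UNIV" and h: "h \<in> W \<iota> T UNIV" and k: "k \<in> W \<iota> T UNIV"
  shows "Ly y p (\<lambda>t. h t + c *\<^sub>R k t) = Ly y p h + c * Ly y p k"
proof -
  note L = W_D(1)[OF h] W_D(1)[OF k] W_D(1)[OF p]
  have 1: "(LINT t|time T. e y t \<bullet> C t (\<iota> (h t + c *\<^sub>R k t)))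
      = (LINT t|time T. e y t \<bullet> C t (\<iota> (h t))) + c * (LINT t|time T. e y t \<bullet> C t (\<iota> (k t)))"
    using integrable_inner_Lsq[OF resid_Lsq[OF y] Ci_Lsq[OF L(1)]] integrable_inner_Lsq[OF resid_Lsq[OF y] Ci_Lsq[OF L(2)]]
    by (simp add: blinfun.add_right blinfun.scaleR_right inner_add_right)
  have 2: "(LINT t|time T. A t (h t + c *\<^sub>R k t) (p t)) = (LINT t|time T. A t (h t) (p t)) + c * (LINT t|time T. A t (k t) (p t))"
    using A_integrable[OF L(1) L(3)] A_integrable[OF L(2) L(3)]
    by (simp add: blinfun.add_right blinfun.scaleR_right blinfun.add_left blinfun.scaleR_left)
  show ?thesis unfolding Ly_def 1 2 ddt_lincomb_integral[OF h k L(3)] point_value_lincomb[OF T h k pv_point(1)]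
    by (simp add: inner_add_left algebra_simps)
qed

lemma Lp_lincomb:
  assumes y: "y \<in> W \<iota> T UNIV" and u: "u \<in> Lsq (time T)" and h: "h \<in> W \<iota> T UNIV" and k: "k \<in> W \<iota> T UNIV"
  shows "Lp y\<^sub>0 y u (\<lambda>t. h t + c *\<^sub>R k t) = Lp y\<^sub>0 y u h + c * Lp y\<^sub>0 y u k"
proof -
  note L = W_D(1)[OF h] W_D(1)[OF k] W_D(1)[OF y]
  show ?thesis unfolding Lp_def point_value_lincomb[OF T h k pv_point(1)]
    using B_integrable[OF u L(1)] B_integrable[OF u L(2)] A_integrable[OF L(3) L(1)] A_integrable[OF L(3) L(2)]
      ddt_integrable[OF y L(1)] ddt_integrable[OF y L(2)]
    by (simp add: blinfun.add_right blinfun.scaleR_right inner_add_right algebra_simps)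
qed

section \<open>Boundedness and identification of the partial derivatives\<close>

lemma pv_bound: "\<exists>K. \<forall>h\<in>W \<iota> T UNIV. norm (pv h 0) \<le> K * norm_W \<iota> T h"
proof (intro exI ballI)
  fix h assume h: "h \<in> W \<iota> T UNIV"
  have "norm (pv h 0) \<le> (norm \<iota> / sqrt T + 1) * (sqrt (nsq (time T) h) + sqrt (nsq (time T) (ddt h)))"
    by (rule point_value_W(4)[OF T h pv_point(1)])
  also have "\<dots> \<le> (norm \<iota> / sqrt T + 1) * (norm_W \<iota> T h + norm_W \<iota> T h)"
    by (intro mult_left_mono add_mono norm_W_bounds) (use T in simp)
  finally show "norm (pv h 0) \<le> ((norm \<iota> / sqrt T + 1) * 2) * norm_W \<iota> T h"
    unfolding mult_2[symmetric] by (simp only: mult.assoc)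
qed

lemma inner_Lsq_bound:
  fixes f :: "real \<Rightarrow> 'v"
  assumes f: "f \<in> Lsq (time T)" and h: "h \<in> W \<iota> T UNIV"
  shows "\<bar>LINT t|time T. f t \<bullet> h t\<bar> \<le> sqrt (nsq (time T) f) * norm_W \<iota> T h"
    "\<bar>LINT t|time T. time_deriv \<iota> T UNIV h t (f t)\<bar> \<le> sqrt (nsq (time T) f) * norm_W \<iota> T h"
proof -
  have "\<bar>LINT t|time T. f t \<bullet> h t\<bar> \<le> sqrt (nsq (time T) f) * sqrt (nsq (time T) h)"
    by (rule integral_inner_Lsq_le[OF f W_D(1)[OF h]])
  also have "\<dots> \<le> sqrt (nsq (time T) f) * norm_W \<iota> T h" by (intro mult_left_mono norm_W_bounds) simp
  finally show "\<bar>LINT t|time T. f t \<bullet> h t\<bar> \<le> sqrt (nsq (time T) f) * norm_W \<iota> T h" .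
  have "\<bar>LINT t|time T. ddt h t \<bullet> f t\<bar> \<le> sqrt (nsq (time T) (ddt h)) * sqrt (nsq (time T) f)"
    by (rule integral_inner_Lsq_le[OF W_D(4)[OF h] f])
  also have "\<dots> \<le> norm_W \<iota> T h * sqrt (nsq (time T) f)" by (intro mult_right_mono norm_W_bounds) simp
  finally show "\<bar>LINT t|time T. time_deriv \<iota> T UNIV h t (f t)\<bar> \<le> sqrt (nsq (time T) f) * norm_W \<iota> T h"
    by (simp add: mult.commute)
qed

lemma Ci_bound: "\<exists>K\<ge>0. \<forall>h\<in>W \<iota> T UNIV. sqrt (nsq (time T) (\<lambda>t. C t (\<iota> (h t)))) \<le> K * norm_W \<iota> T h"
proof -
  obtain K where K: "\<And>x. x \<in> Lsq (time T) \<Longrightarrow> nsq (time T) (\<lambda>t. C t (x t)) \<le> K\<^sup>2 * nsq (time T) x"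
    using C_Lsq_bound by blast
  show ?thesis
  proof (intro exI[of _ "\<bar>K\<bar> * norm \<iota>"] conjI ballI)
    fix h assume h: "h \<in> W \<iota> T UNIV"
    have "nsq (time T) (\<lambda>t. C t (\<iota> (h t))) \<le> K\<^sup>2 * nsq (time T) (\<lambda>t. \<iota> (h t))"
      by (rule K[OF Lsq_blinfun(1)[OF W_D(1)[OF h]]])
    also have "\<dots> \<le> K\<^sup>2 * ((norm \<iota>)\<^sup>2 * nsq (time T) h)"
      by (intro mult_left_mono Lsq_blinfun(2) W_D(1)[OF h]) simp
    finally have "sqrt (nsq (time T) (\<lambda>t. C t (\<iota> (h t)))) \<le> \<bar>K\<bar> * norm \<iota> * sqrt (nsq (time T) h)"
      using real_sqrt_le_mono by (fastforce simp: real_sqrt_mult mult.assoc)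
    also have "\<dots> \<le> \<bar>K\<bar> * norm \<iota> * norm_W \<iota> T h" by (intro mult_left_mono norm_W_bounds) simp
    finally show "sqrt (nsq (time T) (\<lambda>t. C t (\<iota> (h t)))) \<le> \<bar>K\<bar> * norm \<iota> * norm_W \<iota> T h" .
  qed simp
qed

text \<open>Apart from the tracking term L is affine in y, so the remainder is exactly half the
  squared norm of \<open>C t (\<iota> (h t))\<close>.\<close>

lemma lagrangian_y_eq:
  assumes y: "y \<in> W \<iota> T UNIV" and u: "u \<in> Lsq (time T)" and p: "p \<in> W \<iota> T UNIV" and h: "h \<in> W \<iota> T UNIV"
  shows "lagrangian_y \<iota> T A B C \<beta> y\<^sub>d y\<^sub>0 y u p h = Ly y p h"
  unfolding lagrangian_y_def
proof (rule frechet_deriv_eq[OF _ h W_UNIV_scaleR norm_W_nonneg])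
  note Ly = W_D(1)[OF y] and Lpp = W_D(1)[OF p]
  let ?F = "\<lambda>z. lagrangian \<iota> T A B C \<beta> y\<^sub>d y\<^sub>0 z u p"
  obtain K where K: "K \<ge> 0" "\<And>h. h \<in> W \<iota> T UNIV \<Longrightarrow> sqrt (nsq (time T) (\<lambda>t. C t (\<iota> (h t)))) \<le> K * norm_W \<iota> T h"
    using Ci_bound by blast
  obtain K0 where K0: "\<And>h. h \<in> W \<iota> T UNIV \<Longrightarrow> norm (pv h 0) \<le> K0 * norm_W \<iota> T h"
    using pv_bound by blast
  define M where "M = sqrt (nsq (time T) (e y)) * K + sqrt (nsq (time T) (\<lambda>t. rz (dual_op (A t) (p t))))
      + sqrt (nsq (time T) p) + K0 * norm (pv p 0)"
  show "has_frechet_deriv (W \<iota> T UNIV) (norm_W \<iota> T) ?F y (Ly y p)"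
  proof (rule has_frechet_derivI[where K = M and M = "K\<^sup>2 / 2"])
    show "Ly y p (\<lambda>t. h t + c *\<^sub>R k t) = Ly y p h + c * Ly y p k" if "h \<in> W \<iota> T UNIV" "k \<in> W \<iota> T UNIV" for h k c
      by (rule Ly_lincomb[OF W_D(1)[OF y] p that])
    fix h assume h: "h \<in> W \<iota> T UNIV"
    note Lh = W_D(1)[OF h]
    have "\<bar>LINT t|time T. e y t \<bullet> C t (\<iota> (h t))\<bar> \<le> sqrt (nsq (time T) (e y)) * (K * norm_W \<iota> T h)"
      by (rule order_trans[OF integral_inner_Lsq_le[OF resid_Lsq[OF W_D(1)[OF y]] Ci_Lsq[OF Lh]]])
        (intro mult_left_mono K h, simp)
    moreover have "\<bar>LINT t|time T. A t (h t) (p t)\<bar> \<le> sqrt (nsq (time T) (\<lambda>t. rz (dual_op (A t) (p t)))) * norm_W \<iota> T h"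
      using inner_Lsq_bound(1)[OF A_Lsq(2)[OF Lpp] h] by simp
    moreover have "\<bar>LINT t|time T. time_deriv \<iota> T UNIV h t (p t)\<bar> \<le> sqrt (nsq (time T) p) * norm_W \<iota> T h"
      by (rule inner_Lsq_bound(2)[OF Lpp h])
    moreover have "\<bar>pv h 0 \<bullet> pv p 0\<bar> \<le> K0 * norm_W \<iota> T h * norm (pv p 0)"
      by (rule order_trans[OF Cauchy_Schwarz_ineq2]) (intro mult_right_mono K0 h, simp)
    moreover have "M * norm_W \<iota> T h = sqrt (nsq (time T) (e y)) * (K * norm_W \<iota> T h)
      + sqrt (nsq (time T) (\<lambda>t. rz (dual_op (A t) (p t)))) * norm_W \<iota> T h
      + sqrt (nsq (time T) p) * norm_W \<iota> T h + K0 * norm_W \<iota> T h * norm (pv p 0)"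
      by (simp add: M_def algebra_simps)
    moreover have "\<bar>a - b - c - d\<bar> \<le> \<bar>a\<bar> + \<bar>b\<bar> + \<bar>c\<bar> + \<bar>d\<bar>" for a b c d :: real by linarith
    ultimately show "\<bar>Ly y p h\<bar> \<le> M * norm_W \<iota> T h" unfolding Ly_def
      by (smt (verit, best))
    have yh: "(\<lambda>t. y t + h t) \<in> W \<iota> T UNIV" using W_lincomb[OF y h, of 1] by simp
    have eC: "integrable (time T) (\<lambda>t. e y t \<bullet> C t (\<iota> (h t)))" by (intro integrable_inner_Lsq resid_Lsq Ci_Lsq W_D(1)[OF y] Lh)
    have "nsq (time T) (e (\<lambda>t. y t + h t)) = (LINT t|time T. e y t \<bullet> e y t + 2 * (e y t \<bullet> C t (\<iota> (h t)))
        + (C t (\<iota> (h t)) \<bullet> C t (\<iota> (h t))))"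
      unfolding nsq_inner resid_def
      by (rule Bochner_Integration.integral_cong) (simp_all add: blinfun.add_right
          inner_add_left inner_add_right inner_diff_left inner_diff_right inner_commute algebra_simps)
    also have "\<dots> = nsq (time T) (e y) + 2 * (LINT t|time T. e y t \<bullet> C t (\<iota> (h t))) + nsq (time T) (\<lambda>t. C t (\<iota> (h t)))"
      unfolding nsq_inner using eC integrable_inner_Lsq[OF resid_Lsq[OF W_D(1)[OF y]] resid_Lsq[OF W_D(1)[OF y]]]
        integrable_inner_Lsq[OF Ci_Lsq[OF Lh] Ci_Lsq[OF Lh]] by simp
    finally have n: "nsq (time T) (e (\<lambda>t. y t + h t)) = \<dots>" .
    have a: "(LINT t|time T. A t (y t + h t) (p t)) = (LINT t|time T. A t (y t) (p t)) + (LINT t|time T. A t (h t) (p t))"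
      using A_integrable[OF W_D(1)[OF y] Lpp] A_integrable[OF Lh Lpp] by (simp add: blinfun.add_right blinfun.add_left)
    have "?F (\<lambda>t. y t + h t) - ?F y - Ly y p h = nsq (time T) (\<lambda>t. C t (\<iota> (h t))) / 2"
      unfolding lagrangian_eq[OF yh u p] lagrangian_eq[OF y u p] cost_eq[OF W_D(1)[OF yh] u] cost_eq[OF W_D(1)[OF y] u] n Lp_def Ly_def a
      using ddt_lincomb_integral[OF y h Lpp, of 1] point_value_lincomb[OF T y h pv_point(1), of 1]
      by (simp add: inner_diff_left inner_add_left field_simps)
    also have "\<bar>\<dots>\<bar> \<le> (K * norm_W \<iota> T h)\<^sup>2 / 2"
      using power_mono[OF K(2)[OF h], of 2] by simp
    finally show "\<bar>?F (\<lambda>t. y t + h t) - ?F y - Ly y p h\<bar> \<le> K\<^sup>2 / 2 * (norm_W \<iota> T h)\<^sup>2"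
      by (simp add: power_mult_distrib)
  qed (rule norm_W_nonneg)
qed

lemma lagrangian_p_eq:
  assumes y: "y \<in> W \<iota> T UNIV" and u: "u \<in> Lsq (time T)" and p: "p \<in> W \<iota> T UNIV" and k: "k \<in> W \<iota> T UNIV"
  shows "lagrangian_p \<iota> T A B C \<beta> y\<^sub>d y\<^sub>0 y u p k = Lp y\<^sub>0 y u k"
  unfolding lagrangian_p_def
proof (rule frechet_deriv_eq[OF _ k W_UNIV_scaleR norm_W_nonneg])
  let ?F = "\<lambda>z. lagrangian \<iota> T A B C \<beta> y\<^sub>d y\<^sub>0 y u z"
  obtain K0 where K0: "\<And>h. h \<in> W \<iota> T UNIV \<Longrightarrow> norm (pv h 0) \<le> K0 * norm_W \<iota> T h"
    using pv_bound by blast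
  define M where "M = sqrt (nsq (time T) (\<lambda>t. rz (B (u t)))) + sqrt (nsq (time T) (\<lambda>t. rz (A t (y t))))
      + sqrt (nsq (time T) (ddt y)) + norm (y\<^sub>0 - pv y 0) * K0"
  show "has_frechet_deriv (W \<iota> T UNIV) (norm_W \<iota> T) ?F p (Lp y\<^sub>0 y u)"
  proof (rule has_frechet_derivI[where K = M and M = 0])
    show "Lp y\<^sub>0 y u (\<lambda>t. h t + c *\<^sub>R k t) = Lp y\<^sub>0 y u h + c * Lp y\<^sub>0 y u k" if "h \<in> W \<iota> T UNIV" "k \<in> W \<iota> T UNIV" for h k c
      by (rule Lp_lincomb[OF y u that])
    fix h assume h: "h \<in> W \<iota> T UNIV"
    have "\<bar>LINT t|time T. B (u t) (h t)\<bar> \<le> sqrt (nsq (time T) (\<lambda>t. rz (B (u t)))) * norm_W \<iota> T h"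
      using inner_Lsq_bound(1)[OF B_Lsq[OF u] h] by simp
    moreover have "\<bar>LINT t|time T. A t (y t) (h t)\<bar> \<le> sqrt (nsq (time T) (\<lambda>t. rz (A t (y t)))) * norm_W \<iota> T h"
      using inner_Lsq_bound(1)[OF A_Lsq(1)[OF W_D(1)[OF y]] h] by simp
    moreover have "\<bar>LINT t|time T. time_deriv \<iota> T UNIV y t (h t)\<bar> \<le> sqrt (nsq (time T) (ddt y)) * norm_W \<iota> T h"
      using inner_Lsq_bound(1)[OF W_D(4)[OF y] h] by simp
    moreover have "\<bar>(y\<^sub>0 - pv y 0) \<bullet> pv h 0\<bar> \<le> norm (y\<^sub>0 - pv y 0) * (K0 * norm_W \<iota> T h)"
      by (rule order_trans[OF Cauchy_Schwarz_ineq2]) (intro mult_left_mono K0 h, simp)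
    moreover have "M * norm_W \<iota> T h = sqrt (nsq (time T) (\<lambda>t. rz (B (u t)))) * norm_W \<iota> T h
      + sqrt (nsq (time T) (\<lambda>t. rz (A t (y t)))) * norm_W \<iota> T h
      + sqrt (nsq (time T) (ddt y)) * norm_W \<iota> T h + norm (y\<^sub>0 - pv y 0) * (K0 * norm_W \<iota> T h)"
      by (simp add: M_def algebra_simps)
    ultimately show "\<bar>Lp y\<^sub>0 y u h\<bar> \<le> M * norm_W \<iota> T h" unfolding Lp_def
      by (smt (verit, best))
    have ph: "(\<lambda>t. p t + h t) \<in> W \<iota> T UNIV" using W_lincomb[OF p h, of 1] by simp
    show "\<bar>?F (\<lambda>t. p t + h t) - ?F p - Lp y\<^sub>0 y u h\<bar> \<le> 0 * (norm_W \<iota> T h)\<^sup>2"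
      using Lp_lincomb[OF y u p h, where c = 1] by (simp add: lagrangian_eq[OF y u] ph p)
  qed (rule norm_W_nonneg)
qed

end

section \<open>Full and reduced problem\<close>

lemma orth_proj_eq:
  fixes S :: "'a::real_inner set"
  assumes "subspace S" "z \<in> S" "\<And>w. w \<in> S \<Longrightarrow> (x - z) \<bullet> w = 0"
  shows "orth_proj S x = z"
  unfolding orth_proj_def
proof (rule the_equality)
  show "z \<in> S \<and> (\<forall>w\<in>S. (x - z) \<bullet> w = 0)" using assms by blast
  fix z' assume z': "z' \<in> S \<and> (\<forall>w\<in>S. (x - z') \<bullet> w = 0)"
  have "z' - z \<in> S" using z' assms by (auto intro: subspace_diff)
  hence "(x - z) \<bullet> (z' - z) - (x - z') \<bullet> (z' - z) = 0" using assms(3) z' by simp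
  hence "(z' - z) \<bullet> (z' - z) = 0" by (simp add: inner_diff_left)
  thus "z' = z" by simp
qed

text \<open>Idempotence follows from injectivity of the embedding, symmetry from orthogonality
  alone. With the identity in place of \<open>\<iota>\<close> the same statement provides the
  V-orthogonal projection.\<close>

lemma finite_span_H_projection:
  fixes \<iota> :: "'v::real_inner \<Rightarrow>\<^sub>L 'h::real_inner"
  assumes "inj (blinfun_apply \<iota>)" "finite X"
  obtains Q :: "'h \<Rightarrow>\<^sub>L 'v" where "\<And>h. Q h \<in> span X" "\<And>h s. s \<in> span X \<Longrightarrow> (h - \<iota> (Q h)) \<bullet> \<iota> s = 0"
    "\<And>s. s \<in> span X \<Longrightarrow> Q (\<iota> s) = s" "\<And>h k. \<iota> (Q h) \<bullet> k = h \<bullet> \<iota> (Q k)"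
proof -
  obtain Q :: "'h \<Rightarrow>\<^sub>L 'v" where Q: "\<And>h. Q h \<in> span X"
    and orth: "\<And>h s. s \<in> span X \<Longrightarrow> (h - \<iota> (Q h)) \<bullet> \<iota> s = 0"
    using finite_span_projection[OF assms] by blast
  have id: "Q (\<iota> s) = s" if "s \<in> span X" for s
  proof -
    have "s - Q (\<iota> s) \<in> span X" using that Q by (intro span_diff)
    from orth[OF this, of "\<iota> s"] have "\<iota> (s - Q (\<iota> s)) \<bullet> \<iota> (s - Q (\<iota> s)) = 0"
      by (simp add: blinfun.diff_right)
    hence "\<iota> (s - Q (\<iota> s)) = \<iota> 0" by (simp add: blinfun.zero_right)
    thus ?thesis using injD[OF assms(1)] by fastforce
  qed
  have "\<iota> (Q h) \<bullet> k = h \<bullet> \<iota> (Q k)" for h k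
  proof -
    have "\<iota> (Q h) \<bullet> k = \<iota> (Q h) \<bullet> \<iota> (Q k)"
      using orth[OF Q[of h], of k] by (simp add: inner_diff_left inner_commute[of "\<iota> (Q h)"])
    also have "\<dots> = h \<bullet> \<iota> (Q k)" using orth[OF Q[of k], of h] by (simp add: inner_diff_left)
    finally show ?thesis .
  qed
  with Q orth id show ?thesis by (rule that)
qed

theorem theorem8:
  fixes T \<beta> \<eta> :: real
    and \<iota> :: "'v::{real_inner, banach, second_countable_topology}
                \<Rightarrow>\<^sub>L 'h::{real_inner, banach, second_countable_topology}"
    and A :: "real \<Rightarrow> ('v \<Rightarrow>\<^sub>L ('v \<Rightarrow>\<^sub>L real))"
    and B :: "'u::{real_inner, banach, second_countable_topology} \<Rightarrow>\<^sub>L ('v \<Rightarrow>\<^sub>L real)"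
    and C :: "real \<Rightarrow> ('h \<Rightarrow>\<^sub>L 'h)"
    and y\<^sub>d :: "real \<Rightarrow> 'h" and y\<^sub>0 :: 'h
    and r :: nat and v :: "nat \<Rightarrow> 'v" and V\<^sub>r :: "'v set" and U\<^sub>r :: "'u set"
    and u_opt ur_opt :: "real \<Rightarrow> 'u"
    and y_opt p_opt yr_opt pr_opt :: "real \<Rightarrow> 'v"
  assumes "T > 0"
    and "compact_dense_embedding \<iota>"
    and A_meas: "\<And>z w. (\<lambda>t. A t z w) \<in> borel_measurable (time T)"
    and A_bounded: "\<exists>K. AE t in time T. norm (A t) \<le> K"
    and "\<eta> > 0"
    and A_coercive: "\<And>t z. t \<in> {0<..<T} \<Longrightarrow> A t z z \<ge> \<eta> * (norm z)\<^sup>2"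
    and C_meas: "\<And>h k. (\<lambda>t. inner (C t h) k) \<in> borel_measurable (time T)"
    and C_bounded: "\<exists>K. AE t in time T. norm (C t) \<le> K"
    and "\<beta> > 0"
    and "y\<^sub>d \<in> L2 T"
    and V\<^sub>r: "V\<^sub>r = span (v ` {1..r})"
    and U\<^sub>r: "U\<^sub>r = span ((\<lambda>i. inv riesz (dual_op B (v i))) ` {1..r})"
    and u_opt: "is_arg_min (J_hat \<iota> T A B C \<beta> y\<^sub>d y\<^sub>0) (\<lambda>u. u \<in> L2 T) u_opt"
    and y_opt: "is_state \<iota> T A B y\<^sub>0 u_opt y_opt"
    and p_opt: "is_adjoint_state \<iota> T A C y\<^sub>d (\<lambda>t. \<iota> (y_opt t)) p_opt"
    and ur_opt: "is_arg_min (J_hat_reduced \<iota> T A B C \<beta> y\<^sub>d y\<^sub>0 V\<^sub>r) (\<lambda>u. u \<in> L2_in T U\<^sub>r) ur_opt"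
    and yr_opt: "is_reduced_state \<iota> T A B y\<^sub>0 V\<^sub>r ur_opt yr_opt"
    and pr_opt: "is_reduced_adjoint_state \<iota> T A C y\<^sub>d V\<^sub>r (\<lambda>t. \<iota> (yr_opt t)) pr_opt"
  shows "ereal (J_hat \<iota> T A B C \<beta> y\<^sub>d y\<^sub>0 u_opt - J_hat_reduced \<iota> T A B C \<beta> y\<^sub>d y\<^sub>0 V\<^sub>r ur_opt) =
    ereal (1/2) * Inf {ereal
        (lagrangian_y \<iota> T A B C \<beta> y\<^sub>d y\<^sub>0 yr_opt ur_opt pr_opt (\<lambda>t. y_opt t - y\<^sub>r t)
         + lagrangian_p \<iota> T A B C \<beta> y\<^sub>d y\<^sub>0 yr_opt ur_opt pr_opt (\<lambda>t. p_opt t - p\<^sub>r t))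
      | y\<^sub>r p\<^sub>r. y\<^sub>r \<in> W \<iota> T V\<^sub>r \<and> p\<^sub>r \<in> W \<iota> T V\<^sub>r}"
proof -
  let ?J = "\<lambda>y u. cost T C \<beta> y\<^sub>d (\<lambda>t. \<iota> (y t)) u" and ?pv = "point_value \<iota> T"
  note T = \<open>T > 0\<close>
  have inj: "inj (blinfun_apply \<iota>)" and dense: "closure (range (blinfun_apply \<iota>)) = UNIV"
    using \<open>compact_dense_embedding \<iota>\<close> by (auto simp: compact_dense_embedding_def)
  have X: "finite (v ` {1..r})" by simp
  obtain Q :: "'h \<Rightarrow>\<^sub>L 'v" where Q: "\<And>h. Q h \<in> V\<^sub>r" "\<And>h s. s \<in> V\<^sub>r \<Longrightarrow> (h - \<iota> (Q h)) \<bullet> \<iota> s = 0"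
    "\<And>s. s \<in> V\<^sub>r \<Longrightarrow> Q (\<iota> s) = s" "\<And>h k. \<iota> (Q h) \<bullet> k = h \<bullet> \<iota> (Q k)"
    using finite_span_H_projection[OF inj X] unfolding V\<^sub>r by metis
  \<comment> \<open>The V-orthogonal projection onto V_r: the finite-dimensional construction with H
    replaced by V.\<close>
  have "inj (blinfun_apply (id_blinfun :: 'v \<Rightarrow>\<^sub>L 'v))" by (auto intro: injI)
  from finite_span_H_projection[OF this X]
  obtain \<pi> :: "'v \<Rightarrow>\<^sub>L 'v" where \<pi>: "\<And>x. \<pi> x \<in> V\<^sub>r" "\<And>s. s \<in> V\<^sub>r \<Longrightarrow> \<pi> s = s" "\<And>x y. \<pi> x \<bullet> y = x \<bullet> \<pi> y"
    unfolding V\<^sub>r id_blinfun.rep_eq id_apply by metis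
  have Vr_range: "V\<^sub>r = range \<pi>"
    using \<pi>(1,2) by (auto simp: image_iff) metis
  have yd: "y\<^sub>d \<in> Lsq (time T)" using \<open>y\<^sub>d \<in> L2 T\<close> by (simp add: L2_Lsq)
  \<comment> \<open>With V as the test space both projections are the identity.\<close>
  interpret full: control \<iota> T UNIV id_blinfun id_blinfun A \<eta> B C \<beta> y\<^sub>d
    by unfold_locales (assumption | rule T A_meas A_bounded \<open>\<eta> > 0\<close> A_coercive C_meas C_bounded \<open>\<beta> > 0\<close> yd | simp)+
  have q: "(Q o\<^sub>L \<iota>) x \<in> V\<^sub>r" "s \<in> V\<^sub>r \<Longrightarrow> (Q o\<^sub>L \<iota>) s = s"
    "\<iota> ((Q o\<^sub>L \<iota>) x) \<bullet> \<iota> w = \<iota> x \<bullet> \<iota> ((Q o\<^sub>L \<iota>) w)" for x s w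
    by (simp_all add: Q)
  interpret red: control \<iota> T V\<^sub>r \<pi> "Q o\<^sub>L \<iota>" A \<eta> B C \<beta> y\<^sub>d
    by unfold_locales
      (assumption | rule T A_meas A_bounded \<open>\<eta> > 0\<close> A_coercive C_meas C_bounded \<open>\<beta> > 0\<close> yd q \<pi>(2,3) Vr_range)+

  have full_state: "is_state \<iota> T A B y\<^sub>0 u y \<longleftrightarrow> full.state y\<^sub>0 u y" for u y
  proof -
    have "?pv y 0 = y\<^sub>0 \<longleftrightarrow> (\<forall>s. (?pv y 0 - y\<^sub>0) \<bullet> \<iota> s = 0)"
    proof
      assume *: "\<forall>s. (?pv y 0 - y\<^sub>0) \<bullet> \<iota> s = 0"
      \<comment> \<open>Orthogonality to the dense range of \<open>\<iota>\<close> extends to all of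
        H, so the difference is orthogonal to itself.\<close>
      have "closed {x. (?pv y 0 - y\<^sub>0) \<bullet> x = 0}" by (intro closed_Collect_eq continuous_intros)
      moreover have "range \<iota> \<subseteq> {x. (?pv y 0 - y\<^sub>0) \<bullet> x = 0}" using * by auto
      ultimately have "?pv y 0 - y\<^sub>0 \<in> {x. (?pv y 0 - y\<^sub>0) \<bullet> x = 0}"
        using closure_minimal dense by blast
      thus "?pv y 0 = y\<^sub>0" by (simp only: mem_Collect_eq inner_eq_zero_iff right_minus_eq)
    qed simp
    moreover have "f = g \<longleftrightarrow> (\<forall>v. f v = g v)" for f g :: "'v \<Rightarrow>\<^sub>L real" by (auto intro: blinfun_eqI)
    ultimately show ?thesis unfolding is_state_def full.state_iff by simp
  qed
  have red_state: "is_reduced_state \<iota> T A B y\<^sub>0 V\<^sub>r u y \<longleftrightarrow> red.state y\<^sub>0 u y" for u y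
  proof -
    have proj: "orth_proj (blinfun_apply \<iota> ` V\<^sub>r) y\<^sub>0 = \<iota> (Q y\<^sub>0)"
    proof (rule orth_proj_eq)
      show "subspace (blinfun_apply \<iota> ` V\<^sub>r)"
        by (intro linear_subspace_image red.subspace_S bounded_linear.linear blinfun.bounded_linear_right)
    qed (use Q(1,2) in auto)
    have "?pv y 0 = \<iota> (Q y\<^sub>0) \<longleftrightarrow> (\<forall>s\<in>V\<^sub>r. (?pv y 0 - y\<^sub>0) \<bullet> \<iota> s = 0)" if y: "y \<in> W \<iota> T V\<^sub>r"
    proof
      assume "?pv y 0 = \<iota> (Q y\<^sub>0)"
      thus "\<forall>s\<in>V\<^sub>r. (?pv y 0 - y\<^sub>0) \<bullet> \<iota> s = 0" using Q(2)[of _ y\<^sub>0] by (simp add: inner_diff_left)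
    next
      assume *: "\<forall>s\<in>V\<^sub>r. (?pv y 0 - y\<^sub>0) \<bullet> \<iota> s = 0"
      \<comment> \<open>This defect is orthogonal to the image of V_r, hence to
        \<open>\<iota> (Q y\<^sub>0)\<close> and, by continuity in time, to the point value; so it
        is orthogonal to itself.\<close>
      define x where "x = ?pv y 0 - \<iota> (Q y\<^sub>0)"
      have x: "x \<bullet> \<iota> s = 0" if "s \<in> V\<^sub>r" for s
        using *[rule_format, OF that] Q(2)[OF that, of y\<^sub>0] by (simp add: x_def inner_diff_left)
      have "x \<bullet> ?pv y 0 = 0" by (rule red.pv_orthogonal[OF y x red.pv_point(1)])
      hence "x \<bullet> x = 0" using x[OF Q(1)[of y\<^sub>0]] by (simp add: x_def inner_diff_right)
      thus "?pv y 0 = \<iota> (Q y\<^sub>0)" by (simp add: x_def)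
    qed
    thus ?thesis unfolding is_reduced_state_def red.state_iff proj by blast
  qed
  have J_full: "J_hat \<iota> T A B C \<beta> y\<^sub>d y\<^sub>0 u = ?J y u" if "full.state y\<^sub>0 u y" "u \<in> Lsq (time T)" for u y
    unfolding J_hat_def full_state
    by (rule full.cost_state_unique[OF someI[of "full.state y\<^sub>0 u"] that(1,2)]) (rule that)
  have J_red: "J_hat_reduced \<iota> T A B C \<beta> y\<^sub>d y\<^sub>0 V\<^sub>r u = ?J y u" if "red.state y\<^sub>0 u y" "u \<in> Lsq (time T)" for u y
    unfolding J_hat_reduced_def red_state
    by (rule red.cost_state_unique[OF someI[of "red.state y\<^sub>0 u"] that(1,2)]) (rule that)

  have fy: "full.state y\<^sub>0 u_opt y_opt" using y_opt by (simp add: full_state)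
  have ry: "red.state y\<^sub>0 ur_opt yr_opt" using yr_opt by (simp add: red_state)
  have fp: "full.adjoint_state y_opt p_opt"
    unfolding full.adjoint_state_iff
  proof (intro conjI)
    show "AE t in time T. \<forall>v\<in>UNIV. (- time_deriv \<iota> T UNIV p_opt t + dual_op (A t) (p_opt t)) v
        = pivot \<iota> (adjoint (C t) (C t (\<iota> (y_opt t)) - y\<^sub>d t)) v"
      using p_opt[unfolded is_adjoint_state_def, THEN conjunct2, THEN conjunct1]
      by eventually_elim (intro ballI, rule arg_cong[where f = "\<lambda>f. blinfun_apply f _"])
  qed (use p_opt in \<open>simp_all add: is_adjoint_state_def\<close>)
  have rp: "red.adjoint_state yr_opt pr_opt"
    using pr_opt unfolding is_reduced_adjoint_state_def red.adjoint_state_iff by simp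
  have fu: "u_opt \<in> Lsq (time T)" using u_opt by (simp add: is_arg_min_def L2_Lsq)
  have ru: "ur_opt \<in> Lsq (time T)" "AE t in time T. ur_opt t \<in> U\<^sub>r"
    using ur_opt by (auto simp: is_arg_min_def L2_in_def L2_Lsq)
  have Wf: "y_opt \<in> W \<iota> T UNIV" "p_opt \<in> W \<iota> T UNIV"
    using fy fp by (auto simp: full.state_def full.solves_def full.adjoint_state_def)
  have Wr: "yr_opt \<in> W \<iota> T V\<^sub>r" "pr_opt \<in> W \<iota> T V\<^sub>r"
    using ry rp by (auto simp: red.state_def red.solves_def red.adjoint_state_def)
  note WU = red.W_sub(1)[OF Wr(1)] red.W_sub(1)[OF Wr(2)]
  note L = W_D(1)[OF Wf(1)] W_D(1)[OF Wf(2)] W_D(1)[OF Wr(1)] W_D(1)[OF Wr(2)]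

  have grad_full: "\<beta> * (LINT t|time T. u_opt t \<bullet> h t) + (LINT t|time T. B (h t) (p_opt t)) = 0"
    if h: "h \<in> Lsq (time T)" for h
  proof (rule full.optimality_gradient[OF subspace_UNIV fu _ fy fp _ _ h])
    fix u y assume "u \<in> Lsq (time T)" "full.state y\<^sub>0 u y"
    thus "?J y_opt u_opt \<le> ?J y u"
      using u_opt J_full[OF fy fu] J_full[of u y] by (auto simp: is_arg_min_def L2_Lsq not_less)
  qed auto
  have dual_U: "rz (dual_op B s) \<in> U\<^sub>r" if "s \<in> V\<^sub>r" for s
  proof -
    have "linear (\<lambda>s. rz (dual_op B s))"
      by (rule linearI) (simp_all add: blinfun.add_right blinfun.scaleR_right rz_add rz_scaleR)
    from linear_span_image[OF this, of "v ` {1..r}"] show ?thesis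
      using that unfolding U\<^sub>r V\<^sub>r image_image by blast
  qed
  have grad_red: "\<beta> * (LINT t|time T. ur_opt t \<bullet> h t) + (LINT t|time T. B (h t) (pr_opt t)) = 0"
    if h: "h \<in> Lsq (time T)" for h
  proof (rule red.optimality_gradient[OF _ ru ry rp _ _ h])
    show "subspace U\<^sub>r" by (simp add: U\<^sub>r)
    fix u y assume "u \<in> Lsq (time T)" "AE t in time T. u t \<in> U\<^sub>r" "red.state y\<^sub>0 u y"
    thus "?J yr_opt ur_opt \<le> ?J y u"
      using ur_opt J_red[OF ry ru(1)] J_red[of u y] by (auto simp: is_arg_min_def L2_in_def L2_Lsq not_less)
  qed (rule dual_U)

  have Ly_0: "full.Ly yr_opt pr_opt h = 0" if "h \<in> W \<iota> T V\<^sub>r" for h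
    using red.adjoint_identity[OF rp L(3) that] by (simp add: full.Ly_def)
  have Lp_0: "full.Lp y\<^sub>0 yr_opt ur_opt k = 0" if k: "k \<in> W \<iota> T V\<^sub>r" for k
    using red.state_tested[OF ry ru(1) W_D(1,2)[OF k]] red.state_pv_orthogonal[OF ry k red.pv_point(1)]
    by (simp add: full.Lp_def inner_diff_left)
  have const: "lagrangian_y \<iota> T A B C \<beta> y\<^sub>d y\<^sub>0 yr_opt ur_opt pr_opt (\<lambda>t. y_opt t - y\<^sub>r t)
      + lagrangian_p \<iota> T A B C \<beta> y\<^sub>d y\<^sub>0 yr_opt ur_opt pr_opt (\<lambda>t. p_opt t - p\<^sub>r t)
      = full.Ly yr_opt pr_opt y_opt + full.Lp y\<^sub>0 yr_opt ur_opt p_opt"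
    if yr: "y\<^sub>r \<in> W \<iota> T V\<^sub>r" and pr: "p\<^sub>r \<in> W \<iota> T V\<^sub>r" for y\<^sub>r p\<^sub>r
  proof -
    note W' = red.W_sub(1)[OF yr] red.W_sub(1)[OF pr]
    have d: "(\<lambda>t. y_opt t - y\<^sub>r t) = (\<lambda>t. y_opt t + (-1) *\<^sub>R y\<^sub>r t)" "(\<lambda>t. p_opt t - p\<^sub>r t) = (\<lambda>t. p_opt t + (-1) *\<^sub>R p\<^sub>r t)"
      by simp_all
    have D: "(\<lambda>t. y_opt t + (-1) *\<^sub>R y\<^sub>r t) \<in> W \<iota> T UNIV" "(\<lambda>t. p_opt t + (-1) *\<^sub>R p\<^sub>r t) \<in> W \<iota> T UNIV"
      by (intro W_lincomb Wf W' subspace_UNIV)+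
    show ?thesis
      unfolding d full.lagrangian_y_eq[OF WU(1) ru(1) WU(2) D(1)] full.lagrangian_p_eq[OF WU(1) ru(1) WU(2) D(2)]
        full.Ly_lincomb[OF L(3) WU(2) Wf(1) W'(1)] full.Lp_lincomb[OF WU(1) ru(1) Wf(2) W'(2)] Ly_0[OF yr] Lp_0[OF pr]
      by simp
  qed
  define m where "m = full.Ly yr_opt pr_opt y_opt + full.Lp y\<^sub>0 yr_opt ur_opt p_opt"
  \<comment> \<open>A member of the reduced space, which makes the set under the infimum nonempty
    and thus a singleton.\<close>
  have zero: "(\<lambda>t. 0) \<in> W \<iota> T V\<^sub>r" by (rule W_zero) (rule subspace_0[OF red.subspace_S])
  have "{ereal (lagrangian_y \<iota> T A B C \<beta> y\<^sub>d y\<^sub>0 yr_opt ur_opt pr_opt (\<lambda>t. y_opt t - y\<^sub>r t)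
         + lagrangian_p \<iota> T A B C \<beta> y\<^sub>d y\<^sub>0 yr_opt ur_opt pr_opt (\<lambda>t. p_opt t - p\<^sub>r t))
      | y\<^sub>r p\<^sub>r. y\<^sub>r \<in> W \<iota> T V\<^sub>r \<and> p\<^sub>r \<in> W \<iota> T V\<^sub>r} = {ereal m}" (is "?S = _")
  proof
    show "?S \<subseteq> {ereal m}" using const by (auto simp: m_def)
    show "{ereal m} \<subseteq> ?S" using const[OF zero zero] zero unfolding m_def by force
  qed
  moreover have "?J y_opt u_opt - ?J yr_opt ur_opt = m / 2"
  proof -
    define IC where "IC f g = (LINT t|time T. f t \<bullet> C t (\<iota> (g t)))" for f :: "real \<Rightarrow> 'h" and g
    define c where "c f t = C t (\<iota> (f t))" for f :: "real \<Rightarrow> 'v" and t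
    have i: "integrable (time T) (\<lambda>t. y\<^sub>d t \<bullet> c f t)" "integrable (time T) (\<lambda>t. c g t \<bullet> c f t)"
      if "f \<in> Lsq (time T)" "g \<in> Lsq (time T)" for f g
      unfolding c_def by (intro integrable_inner_Lsq yd full.Ci_Lsq that)+
    have IC: "IC (resid \<iota> C y\<^sub>d g) f = (LINT t|time T. c g t \<bullet> c f t) - (LINT t|time T. y\<^sub>d t \<bullet> c f t)"
      if "f \<in> Lsq (time T)" "g \<in> Lsq (time T)" for f g
      using i[OF that] by (simp add: IC_def resid_def c_def inner_diff_left)
    have n: "nsq (time T) (resid \<iota> C y\<^sub>d f) = (LINT t|time T. c f t \<bullet> c f t) - 2 * (LINT t|time T. y\<^sub>d t \<bullet> c f t) + (LINT t|time T. y\<^sub>d t \<bullet> y\<^sub>d t)"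
      if f: "f \<in> Lsq (time T)" for f
    proof -
      have "nsq (time T) (resid \<iota> C y\<^sub>d f) = (LINT t|time T. c f t \<bullet> c f t - 2 * (y\<^sub>d t \<bullet> c f t) + y\<^sub>d t \<bullet> y\<^sub>d t)"
        unfolding nsq_inner resid_def c_def
        by (rule Bochner_Integration.integral_cong) (simp_all add: inner_diff_left inner_diff_right inner_commute)
      thus ?thesis using i[OF f f] integrable_inner_Lsq[OF yd yd] by simp
    qed
    have sym: "(LINT t|time T. c y_opt t \<bullet> c yr_opt t) = (LINT t|time T. c yr_opt t \<bullet> c y_opt t)"
      "(LINT t|time T. ur_opt t \<bullet> u_opt t) = (LINT t|time T. u_opt t \<bullet> ur_opt t)" by (simp_all add: inner_commute)
    have pv0: "?pv y_opt 0 = y\<^sub>0" using y_opt by (simp add: is_state_def)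
    \<comment> \<open>The projection error of the initial value is H-orthogonal to the initial value
      of the reduced adjoint state.\<close>
    have pvr: "?pv yr_opt 0 \<bullet> ?pv pr_opt 0 = y\<^sub>0 \<bullet> ?pv pr_opt 0"
      using red.state_pv_orthogonal[OF ry Wr(2) red.pv_point(1)] by (simp add: inner_diff_left)
    \<comment> \<open>Linear algebra in the integrals. The full state equation tested with
      \<open>pr_opt\<close> and the full adjoint identity at \<open>yr_opt\<close> remove the
      derivative and \<open>A\<close> terms from \<open>m\<close>. The terms with
      \<open>y\<^sub>0\<close> come from each adjoint identity at its own state, and the gradient
      conditions turn all \<open>B\<close> terms into products of controls. The mixed products of
      controls and of observations cancel by symmetry, which leaves the difference of the squared
      norms.\<close>
    have "m = 2 * (?J y_opt u_opt - ?J yr_opt ur_opt)"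
      using full.adjoint_identity[OF fp L(1) Wf(1)] full.adjoint_identity[OF fp L(1) WU(1)]
        red.adjoint_identity[OF rp L(3) Wr(1)]
        full.state_tested[OF fy fu L(2)] full.state_tested[OF fy fu L(4)]
        red.state_tested[OF ry ru(1) L(4) W_D(2)[OF Wr(2)]]
        grad_full[OF fu] grad_full[OF ru(1)] grad_red[OF fu] grad_red[OF ru(1)]
      unfolding m_def full.Ly_def full.Lp_def full.cost_eq[OF L(1) fu] full.cost_eq[OF L(3) ru(1)]
        IC_def[symmetric] IC[OF L(1) L(1)] IC[OF L(3) L(1)] IC[OF L(1) L(3)] IC[OF L(3) L(3)] n[OF L(1)] n[OF L(3)]
        nsq_inner[of _ u_opt] nsq_inner[of _ ur_opt] sym pv0 pvr inner_diff_left
      by (simp add: field_simps)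
    thus ?thesis by simp
  qed
  ultimately show ?thesis by (simp add: J_full[OF fy fu] J_red[OF ry ru(1)])
qed

end
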